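(* Let $k\ge 2$ be a natural number. Over $\mathsf{RCA}_0$ the following are equivalent: (1) $\mathsf{WKL}_0$; (2) every bounded locally $k$-chromatic graph is $(2k-2)$-chromatic.
   Context: Work in second-order arithmetic, whose number variables range over $\mathbb{N}$ and set variables over subsets of $\mathbb{N}$; finite sequences, functions, graphs, etc. are coded by sets of natural numbers in the standard way. $\mathsf{RCA}_0$ is the subsystem consisting of the basic axioms of Peano arithmetic, induction restricted to $\Sigma^0_1$ formulas, and recursive comprehension (any set definable by both a $\Sigma^0_1$ formula and a $\Pi^0_1$ formula, with set parameters, exists). $\mathsf{WKL}_0$ is $\mathsf{RCA}_0$ together with the axiom that every infinite tree of finite $0$--$1$ sequences has an infinite path. A graph $G=\langle V,E\rangle$ has vertex set $V\subseteq\mathbb{N}$ and edge set $E$ a set of unordered pairs of elements of $V$. A $k$-coloring of $G$ is a function $\chi:V\to\{0,\dots,k-1\}$ with $\chi(x)\ne\chi(y)$ whenever $(x,y)\in E$; $G$ is $k$-chromatic if it has a $k$-coloring, and locally $k$-chromatic if every finite subgraph of $G$ is $k$-chromatic. $G$ is bounded if there is a function $h:V\to\mathbb{N}$ such that for all $x,y\in V$, $(x,y)\in E$ implies $h(x)\ge y$. *)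

theory Defs
  imports Main
begin

text \<open>
  Structures for the language of second-order arithmetic. The number variables range over the
  whole type \<open>'a\<close> and the set variables over \<open>Sets\<close>, a collection of subsets of \<open>'a\<close> that need not
  be the full power set. Equality of numbers is true equality.
\<close>

record 'a l2_structure =
  Zero :: 'a (\<open>\<zero>\<index>\<close>)
  One :: 'a (\<open>\<one>\<index>\<close>)
  Add :: "'a \<Rightarrow> 'a \<Rightarrow> 'a" (infixl \<open>\<oplus>\<index>\<close> 65)
  Mult :: "'a \<Rightarrow> 'a \<Rightarrow> 'a" (infixl \<open>\<otimes>\<index>\<close> 70)
  Less :: "'a \<Rightarrow> 'a \<Rightarrow> bool" (infix \<open>\<prec>\<index>\<close> 50)
  Sets :: "'a set set"


text \<open>
  Arithmetical formulas: no set quantifiers, but free set variables. Number variables and set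
  variables are named by natural numbers, in two separate name spaces.
\<close>

datatype trm = Var nat | TZero | TOne | TAdd trm trm | TMult trm trm

datatype fm =
    FEq trm trm
  | FLess trm trm
  | FMem trm nat
  | FNeg fm
  | FAnd fm fm
  | FImp fm fm
  | FAll nat fm
  | FEx nat fm

primrec tvars :: "trm \<Rightarrow> nat set" where
  "tvars (Var x) = {x}"
| "tvars TZero = {}"
| "tvars TOne = {}"
| "tvars (TAdd s t) = tvars s \<union> tvars t"
| "tvars (TMult s t) = tvars s \<union> tvars t"

inductive bounded_fm :: "fm \<Rightarrow> bool" where
  "bounded_fm (FEq s t)"
| "bounded_fm (FLess s t)"
| "bounded_fm (FMem t X)"
| "bounded_fm \<phi> \<Longrightarrow> bounded_fm (FNeg \<phi>)"
| "bounded_fm \<phi> \<Longrightarrow> bounded_fm \<psi> \<Longrightarrow> bounded_fm (FAnd \<phi> \<psi>)"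
| "bounded_fm \<phi> \<Longrightarrow> bounded_fm \<psi> \<Longrightarrow> bounded_fm (FImp \<phi> \<psi>)"
| "bounded_fm \<phi> \<Longrightarrow> x \<notin> tvars t \<Longrightarrow> bounded_fm (FAll x (FImp (FLess (Var x) t) \<phi>))"
| "bounded_fm \<phi> \<Longrightarrow> x \<notin> tvars t \<Longrightarrow> bounded_fm (FEx x (FAnd (FLess (Var x) t) \<phi>))"

definition Sigma01 :: "fm \<Rightarrow> bool" where
  "Sigma01 \<phi> \<longleftrightarrow> (\<exists>x \<theta>. bounded_fm \<theta> \<and> \<phi> = FEx x \<theta>)"

definition Pi01 :: "fm \<Rightarrow> bool" where
  "Pi01 \<phi> \<longleftrightarrow> (\<exists>x \<theta>. bounded_fm \<theta> \<and> \<phi> = FAll x \<theta>)"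


text \<open>
  In every definition below, \<open>M\<close> is an implicit first argument. Quantified sets range over \<open>Sets M\<close>
  only, and other sets (such as \<open>below b\<close> or \<open>elems c\<close>) occur merely as abbreviations for
  formulas, so the axioms and principles on \<open>M\<close> express that sentences of second-order arithmetic
  are true in \<open>M\<close>. A statement about all \<open>M\<close> with \<open>RCA0 M\<close>, over an arbitrary type \<open>'a\<close>, is thus a
  statement of logical consequence from the axioms of \<open>RCA0\<close>.
\<close>

context
  fixes M :: "'a l2_structure" (structure)
begin

primrec tval :: "(nat \<Rightarrow> 'a) \<Rightarrow> trm \<Rightarrow> 'a" where
  "tval e (Var x) = e x"
| "tval e TZero = \<zero>"
| "tval e TOne = \<one>"
| "tval e (TAdd s t) = tval e s \<oplus> tval e t"
| "tval e (TMult s t) = tval e s \<otimes> tval e t"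

primrec sat :: "(nat \<Rightarrow> 'a) \<Rightarrow> (nat \<Rightarrow> 'a set) \<Rightarrow> fm \<Rightarrow> bool" where
  "sat e S (FEq s t) \<longleftrightarrow> tval e s = tval e t"
| "sat e S (FLess s t) \<longleftrightarrow> tval e s \<prec> tval e t"
| "sat e S (FMem t X) \<longleftrightarrow> tval e t \<in> S X"
| "sat e S (FNeg \<phi>) \<longleftrightarrow> \<not> sat e S \<phi>"
| "sat e S (FAnd \<phi> \<psi>) \<longleftrightarrow> sat e S \<phi> \<and> sat e S \<psi>"
| "sat e S (FImp \<phi> \<psi>) \<longleftrightarrow> (sat e S \<phi> \<longrightarrow> sat e S \<psi>)"
| "sat e S (FAll x \<phi>) \<longleftrightarrow> (\<forall>a. sat (e(x := a)) S \<phi>)"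
| "sat e S (FEx x \<phi>) \<longleftrightarrow> (\<exists>a. sat (e(x := a)) S \<phi>)"

definition basic_axioms :: bool where
  "basic_axioms \<longleftrightarrow>
     (\<forall>m. m \<oplus> \<one> \<noteq> \<zero>) \<and>
     (\<forall>m n. m \<oplus> \<one> = n \<oplus> \<one> \<longrightarrow> m = n) \<and>
     (\<forall>m. m \<oplus> \<zero> = m) \<and>
     (\<forall>m n. m \<oplus> (n \<oplus> \<one>) = (m \<oplus> n) \<oplus> \<one>) \<and>
     (\<forall>m. m \<otimes> \<zero> = \<zero>) \<and>
     (\<forall>m n. m \<otimes> (n \<oplus> \<one>) = (m \<otimes> n) \<oplus> m) \<and>
     (\<forall>m. \<not> m \<prec> \<zero>) \<and>
     (\<forall>m n. m \<prec> n \<oplus> \<one> \<longleftrightarrow> m \<prec> n \<or> m = n)"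

definition Sigma01_induction :: bool where
  "Sigma01_induction \<longleftrightarrow>
     (\<forall>\<phi> x e S. Sigma01 \<phi> \<and> range S \<subseteq> Sets M \<and>
        sat (e(x := \<zero>)) S \<phi> \<and>
        (\<forall>a. sat (e(x := a)) S \<phi> \<longrightarrow> sat (e(x := a \<oplus> \<one>)) S \<phi>) \<longrightarrow>
        (\<forall>a. sat (e(x := a)) S \<phi>))"

definition recursive_comprehension :: bool where
  "recursive_comprehension \<longleftrightarrow>
     (\<forall>\<phi> \<psi> x e S. Sigma01 \<phi> \<and> Pi01 \<psi> \<and> range S \<subseteq> Sets M \<and>
        (\<forall>a. sat (e(x := a)) S \<phi> \<longleftrightarrow> sat (e(x := a)) S \<psi>) \<longrightarrow>
        {a. sat (e(x := a)) S \<phi>} \<in> Sets M)"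

text \<open>
  The range of the set variables is nonempty, as always for the domains of a two-sorted structure.
  Without this condition the two schemes, which quantify over assignments to set variables, would
  hold vacuously.
\<close>

definition RCA0 :: bool where
  "RCA0 \<longleftrightarrow> Sets M \<noteq> {} \<and> basic_axioms \<and> Sigma01_induction \<and> recursive_comprehension"


primrec num :: "nat \<Rightarrow> 'a" where
  "num 0 = \<zero>"
| "num (Suc n) = num n \<oplus> \<one>"

definition below :: "'a \<Rightarrow> 'a set" where
  "below b = {x. x \<prec> b}"

definition finite_set :: "'a set \<Rightarrow> bool" where
  "finite_set X \<longleftrightarrow> X \<in> Sets M \<and> (\<exists>b. X \<subseteq> below b)"

definition pair :: "'a \<Rightarrow> 'a \<Rightarrow> 'a" where
  "pair x y = (x \<oplus> y) \<otimes> (x \<oplus> y) \<oplus> x"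

text \<open>\<open>F\<close> is (the graph of) a function from \<open>A\<close> to \<open>B\<close>.\<close>

definition is_function :: "'a set \<Rightarrow> 'a set \<Rightarrow> 'a set \<Rightarrow> bool" where
  "is_function F A B \<longleftrightarrow> F \<in> Sets M \<and>
     (\<forall>p \<in> F. \<exists>x \<in> A. \<exists>y \<in> B. p = pair x y) \<and>
     (\<forall>x \<in> A. \<exists>!y. pair x y \<in> F)"


text \<open>
  The usual coding of finite sets by numbers (Goedel's beta function): a triple \<open>(k,(m,n))\<close>
  represents the set of all \<open>i < k\<close> such that \<open>m(i + 1) + 1\<close> divides \<open>n\<close>, and the code of a finite
  set is the least triple representing it. A finite sequence is coded as the finite set
  of pairs that is its graph.
\<close>

definition is_triple :: "'a \<Rightarrow> bool" where
  "is_triple c \<longleftrightarrow> (\<exists>k m n. c = pair k (pair m n))"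

definition elems :: "'a \<Rightarrow> 'a set" where
  "elems c = {i. \<exists>k m n. c = pair k (pair m n) \<and> i \<prec> k \<and>
                   (\<exists>q. n = (m \<otimes> (i \<oplus> \<one>) \<oplus> \<one>) \<otimes> q)}"

definition is_code :: "'a \<Rightarrow> bool" where
  "is_code c \<longleftrightarrow> is_triple c \<and> (\<forall>d. is_triple d \<and> elems d = elems c \<longrightarrow> \<not> d \<prec> c)"

text \<open>\<open>s\<close> is the code of a 0-1 sequence of length \<open>l\<close>.\<close>

definition binary_seq :: "'a \<Rightarrow> 'a \<Rightarrow> bool" where
  "binary_seq s l \<longleftrightarrow> is_code s \<and>
     (\<forall>p \<in> elems s. \<exists>i v. i \<prec> l \<and> (v = \<zero> \<or> v = \<one>) \<and> p = pair i v) \<and>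
     (\<forall>i. i \<prec> l \<longrightarrow> (\<exists>!v. pair i v \<in> elems s))"

text \<open>For two sequences, inclusion of their graphs says that one is an initial segment of the other.\<close>

definition binary_tree :: "'a set \<Rightarrow> bool" where
  "binary_tree T \<longleftrightarrow> T \<in> Sets M \<and>
     (\<forall>s \<in> T. \<exists>l. binary_seq s l) \<and>
     (\<forall>s \<in> T. \<forall>t l. binary_seq t l \<and> elems t \<subseteq> elems s \<longrightarrow> t \<in> T)"

text \<open>\<open>F\<close> is a 0-1 valued function all of whose finite initial segments belong to \<open>T\<close>.\<close>

definition infinite_path :: "'a set \<Rightarrow> 'a set \<Rightarrow> bool" where
  "infinite_path F T \<longleftrightarrow> is_function F UNIV {\<zero>, \<one>} \<and>
     (\<forall>l. \<exists>s \<in> T. binary_seq s l \<and> elems s \<subseteq> F)"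

definition weak_koenig_lemma :: bool where
  "weak_koenig_lemma \<longleftrightarrow>
     (\<forall>T. binary_tree T \<and> \<not> finite_set T \<longrightarrow> (\<exists>F. infinite_path F T))"

definition WKL0 :: bool where
  "WKL0 \<longleftrightarrow> RCA0 \<and> weak_koenig_lemma"


text \<open>
  An unordered pair is represented by both ordered pairs, so \<open>E\<close> is a symmetric relation. Loops are
  not excluded here; a locally \<open>k\<close>-chromatic graph has none.
\<close>

definition is_graph :: "'a set \<Rightarrow> 'a set \<Rightarrow> bool" where
  "is_graph V E \<longleftrightarrow> V \<in> Sets M \<and> E \<in> Sets M \<and>
     (\<forall>p \<in> E. \<exists>x \<in> V. \<exists>y \<in> V. p = pair x y) \<and>
     (\<forall>x y. pair x y \<in> E \<longrightarrow> pair y x \<in> E)"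

definition is_coloring :: "nat \<Rightarrow> 'a set \<Rightarrow> 'a set \<Rightarrow> 'a set \<Rightarrow> bool" where
  "is_coloring k V E C \<longleftrightarrow> is_function C V (below (num k)) \<and>
     (\<forall>x y u v. pair x y \<in> E \<and> pair x u \<in> C \<and> pair y v \<in> C \<longrightarrow> u \<noteq> v)"

definition chromatic :: "nat \<Rightarrow> 'a set \<Rightarrow> 'a set \<Rightarrow> bool" where
  "chromatic k V E \<longleftrightarrow> (\<exists>C. is_coloring k V E C)"

definition locally_chromatic :: "nat \<Rightarrow> 'a set \<Rightarrow> 'a set \<Rightarrow> bool" where
  "locally_chromatic k V E \<longleftrightarrow>
     (\<forall>V' E'. is_graph V' E' \<and> finite_set V' \<and> V' \<subseteq> V \<and> E' \<subseteq> E \<longrightarrow> chromatic k V' E')"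

definition bounded_graph :: "'a set \<Rightarrow> 'a set \<Rightarrow> bool" where
  "bounded_graph V E \<longleftrightarrow>
     (\<exists>H. is_function H V UNIV \<and>
        (\<forall>x y b. pair x y \<in> E \<and> pair x b \<in> H \<longrightarrow> y \<prec> b \<or> y = b))"

end

end

theory Submission
  imports Defs
begin

text \<open>
  If \<open>WKL\<^sub>0\<close> holds, then the finite partial \<open>k\<close>-colorings of a locally \<open>k\<close>-chromatic graph form an
  infinite binary tree, and a path gives a \<open>k\<close>-coloring; moreover \<open>k \<le> 2k - 2\<close>.

  For the converse, consider the categorical product \<open>K\<^sub>k \<times> K\<^sub>k\<close>. In a coloring with \<open>2k - 2\<close> colors
  either every row or every column has a repeated color: a row and a column without repetition would
  show \<open>2k - 1\<close> distinct colors. Rows of one copy and columns of a second copy, joined to the first as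
  each copy is joined to itself, cannot all have repetitions, as this would give \<open>2k\<close> distinct colors.
  Hence an infinite chain of copies stores one bit, the same at every copy, and coloring by rows or by
  columns realizes either value with only \<open>k\<close> colors. For each \<open>\<sigma>\<close> there is such a chain, joined to a
  reference chain, straight or transposed, at the stages \<open>t \<ge> \<sigma>\<close> at which one of two disjoint
  \<open>\<Sigma>\<^sub>1\<close> events is seen to happen for \<open>\<sigma>\<close>; since \<open>\<sigma> \<le> t\<close>, the graph is bounded. A \<open>(2k - 2)\<close>-coloring thus
  separates two disjoint \<open>\<Sigma>\<^sub>1\<close> sets. If these say that the left, respectively the right, child of the
  node \<open>\<sigma>\<close> of a binary tree is the first to be seen without extensions of some length, a separating
  set computes a path.
\<close>

section \<open>Definability, induction and comprehension\<close>

text \<open>Two demands shape the construction. A bounded graph must give a bound on the neighbors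
  of each vertex, while the event for \<sigma> may be seen at any later stage or never; a single
  grid for \<sigma> could not tell whether it is to be joined to the reference grid. Stretching the
  grid into a chain allows the edges to be placed at the stage that sees the event, and the stored
  bit travels there. As a coloring may realize either bit on a chain, a bit is read only relative to
  the reference chain. The other demand is that induction is available for
  \<open>\<Sigma>\<^sub>1\<close> formulas and comprehension for \<open>\<Delta>\<^sub>1\<close>
  relations. Relations used in them are therefore written with bounded quantifiers, if need be with
  an extra number that bounds the codes of all sequences of a given length. Since \<open>k\<close>
  is a natural number of the metatheory, colors are counted with genuinely finite sets, whereas
  stages range over all numbers of \<open>M\<close> and need induction inside
  \<open>M\<close>.\<close>

locale rca =
  fixes M :: "'a l2_structure" (structure)
  assumes RCA0: "RCA0 M"
begin

text \<open>
  \<open>delta0 P\<close> says that a bounded formula with number parameters \<open>C\<close> and set parameters \<open>X\<close> expresses \<open>P\<close>.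
  Environments are used as in de Bruijn notation, so that a quantifier binds \<open>e 0\<close>. In the formula, \<open>\<rho> i\<close>
  is the variable that carries \<open>e i\<close>, and \<open>\<kappa> c\<close> the one that carries the parameter \<open>c\<close>; \<open>- range \<rho>\<close> is
  infinite to have fresh variables for the quantifiers.
\<close>

definition names :: "('a \<Rightarrow> nat) \<Rightarrow> 'a set \<Rightarrow> (nat \<Rightarrow> 'a) \<Rightarrow> bool" where
  "names \<kappa> C e \<longleftrightarrow> (\<forall>c\<in>C. e (\<kappa> c) = c)"

lemma names_Un: "names \<kappa> (C \<union> D) e \<longleftrightarrow> names \<kappa> C e \<and> names \<kappa> D e"
  unfolding names_def by blast

definition term_rep :: "((nat \<Rightarrow> 'a) \<Rightarrow> 'a) \<Rightarrow> 'a set \<Rightarrow> ((nat \<Rightarrow> nat) \<Rightarrow> ('a \<Rightarrow> nat) \<Rightarrow> trm) \<Rightarrow> bool" where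
  "term_rep t C s \<longleftrightarrow> finite C \<and> (\<forall>\<rho> \<kappa>. tvars (s \<rho> \<kappa>) \<subseteq> range \<rho> \<union> \<kappa> ` C \<and>
     (\<forall>e. names \<kappa> C e \<longrightarrow> tval M e (s \<rho> \<kappa>) = t (\<lambda>i. e (\<rho> i))))"

definition delta0_rep ::
  "((nat \<Rightarrow> 'a) \<Rightarrow> bool) \<Rightarrow> 'a set \<Rightarrow> 'a set set \<Rightarrow>
     ((nat \<Rightarrow> 'a set) \<Rightarrow> (nat \<Rightarrow> nat) \<Rightarrow> ('a \<Rightarrow> nat) \<Rightarrow> fm) \<Rightarrow> bool" where
  "delta0_rep P C X \<phi> \<longleftrightarrow> finite C \<and> finite X \<and> X \<subseteq> Sets M \<and>
     (\<forall>S \<rho> \<kappa>. X \<subseteq> range S \<longrightarrow> infinite (- range \<rho>) \<longrightarrow> bounded_fm (\<phi> S \<rho> \<kappa>) \<and>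
       (\<forall>e. names \<kappa> C e \<longrightarrow> sat M e S (\<phi> S \<rho> \<kappa>) \<longleftrightarrow> P (\<lambda>i. e (\<rho> i))))"

definition term_definable :: "((nat \<Rightarrow> 'a) \<Rightarrow> 'a) \<Rightarrow> bool" where
  "term_definable t \<longleftrightarrow> (\<exists>C s. term_rep t C s)"

definition delta0 :: "((nat \<Rightarrow> 'a) \<Rightarrow> bool) \<Rightarrow> bool" where
  "delta0 P \<longleftrightarrow> (\<exists>C X \<phi>. delta0_rep P C X \<phi>)"

lemma term_repI:
  assumes "finite C"
    and "\<And>\<rho> \<kappa>. tvars (s \<rho> \<kappa>) \<subseteq> range \<rho> \<union> \<kappa> ` C"
    and "\<And>\<rho> \<kappa> e. names \<kappa> C e \<Longrightarrow> tval M e (s \<rho> \<kappa>) = t (\<lambda>i. e (\<rho> i))"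
  shows "term_definable t"
proof -
  have "term_rep t C s" unfolding term_rep_def using assms by simp
  then show ?thesis unfolding term_definable_def by blast
qed

lemma term_repD:
  assumes "term_rep t C s"
  shows "finite C" "tvars (s \<rho> \<kappa>) \<subseteq> range \<rho> \<union> \<kappa> ` C"
    "names \<kappa> C e \<Longrightarrow> tval M e (s \<rho> \<kappa>) = t (\<lambda>i. e (\<rho> i))"
  using assms unfolding term_rep_def by simp_all

lemma delta0_repI:
  assumes "finite C" "finite X" "X \<subseteq> Sets M"
    and "\<And>S \<rho> \<kappa>. X \<subseteq> range S \<Longrightarrow> infinite (- range \<rho>) \<Longrightarrow> bounded_fm (\<phi> S \<rho> \<kappa>)"
    and "\<And>S \<rho> \<kappa> e. X \<subseteq> range S \<Longrightarrow> infinite (- range \<rho>) \<Longrightarrow> names \<kappa> C e \<Longrightarrow>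
      sat M e S (\<phi> S \<rho> \<kappa>) \<longleftrightarrow> P (\<lambda>i. e (\<rho> i))"
  shows "delta0 P"
proof -
  have "delta0_rep P C X \<phi>" unfolding delta0_rep_def using assms by simp
  then show ?thesis unfolding delta0_def by blast
qed

lemma delta0_repD:
  assumes "delta0_rep P C X \<phi>"
  shows "finite C" "finite X" "X \<subseteq> Sets M"
    "X \<subseteq> range S \<Longrightarrow> infinite (- range \<rho>) \<Longrightarrow> bounded_fm (\<phi> S \<rho> \<kappa>)"
    "X \<subseteq> range S \<Longrightarrow> infinite (- range \<rho>) \<Longrightarrow> names \<kappa> C e \<Longrightarrow>
      sat M e S (\<phi> S \<rho> \<kappa>) \<longleftrightarrow> P (\<lambda>i. e (\<rho> i))"
  using assms unfolding delta0_rep_def by simp_all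

section \<open>Definable terms and closure properties of bounded definability\<close>

lemma term_var: "term_definable (\<lambda>e. e i)"
  by (rule term_repI[of "{}" "\<lambda>\<rho> \<kappa>. Var (\<rho> i)"]) simp_all

lemma term_const: "term_definable (\<lambda>e. c)"
  by (rule term_repI[of "{c}" "\<lambda>\<rho> \<kappa>. Var (\<kappa> c)"]) (simp_all add: names_def)

lemma term_binop:
  assumes "term_definable t" "term_definable u"
    and op: "\<And>s s'. tvars (op s s') = tvars s \<union> tvars s'"
      "\<And>e s s'. tval M e (op s s') = f (tval M e s) (tval M e s')"
  shows "term_definable (\<lambda>e. f (t e) (u e))"
proof -
  from assms(1) obtain C s where r1: "term_rep t C s" unfolding term_definable_def by blast
  note 1 = term_repD[OF r1]
  from assms(2) obtain D r where r2: "term_rep u D r" unfolding term_definable_def by blast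
  note 2 = term_repD[OF r2]
  show ?thesis
  proof (rule term_repI[of "C \<union> D" "\<lambda>\<rho> \<kappa>. op (s \<rho> \<kappa>) (r \<rho> \<kappa>)"])
    fix \<rho> and \<kappa> :: "'a \<Rightarrow> nat"
    show "tvars (op (s \<rho> \<kappa>) (r \<rho> \<kappa>)) \<subseteq> range \<rho> \<union> \<kappa> ` (C \<union> D)"
      unfolding op image_Un using 1(2)[of \<rho> \<kappa>] 2(2)[of \<rho> \<kappa>] by blast
  qed (simp_all add: op 1 2 names_Un)
qed

lemma term_add:
  assumes "term_definable t" "term_definable u"
  shows "term_definable (\<lambda>e. t e \<oplus> u e)"
  by (rule term_binop[OF assms, of TAdd]) simp_all

lemma term_mult:
  assumes "term_definable t" "term_definable u"
  shows "term_definable (\<lambda>e. t e \<otimes> u e)"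
  by (rule term_binop[OF assms, of TMult]) simp_all

lemma term_pair:
  assumes "term_definable t" "term_definable u"
  shows "term_definable (\<lambda>e. pair M (t e) (u e))"
  unfolding pair_def by (intro term_add term_mult assms)

lemma delta0_atom:
  assumes "term_definable t" "term_definable u"
    and op: "\<And>s s'. bounded_fm (op s s')" "\<And>e S s s'. sat M e S (op s s') \<longleftrightarrow> R (tval M e s) (tval M e s')"
  shows "delta0 (\<lambda>e. R (t e) (u e))"
proof -
  from assms(1) obtain C s where r1: "term_rep t C s" unfolding term_definable_def by blast
  note 1 = term_repD(1,3)[OF r1]
  from assms(2) obtain D r where r2: "term_rep u D r" unfolding term_definable_def by blast
  note 2 = term_repD(1,3)[OF r2]
  show ?thesis
    by (rule delta0_repI[of "C \<union> D" "{}" "\<lambda>S \<rho> \<kappa>. op (s \<rho> \<kappa>) (r \<rho> \<kappa>)"])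
      (simp_all add: op 1 2 names_Un)
qed

lemma delta0_eq:
  assumes "term_definable t" "term_definable u"
  shows "delta0 (\<lambda>e. t e = u e)"
  by (rule delta0_atom[OF assms, of FEq]) (simp_all add: bounded_fm.intros)

lemma delta0_less:
  assumes "term_definable t" "term_definable u"
  shows "delta0 (\<lambda>e. t e \<prec> u e)"
  by (rule delta0_atom[OF assms, of FLess]) (simp_all add: bounded_fm.intros)

lemma delta0_mem:
  assumes "term_definable t" "Y \<in> Sets M"
  shows "delta0 (\<lambda>e. t e \<in> Y)"
proof -
  from assms(1) obtain C s where r1: "term_rep t C s" unfolding term_definable_def by blast
  note 1 = term_repD(1,3)[OF r1]
  \<comment> \<open>\<open>inv S Y\<close> is the index of some set variable whose value under
    \<open>S\<close> is \<open>Y\<close>.\<close>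
  show ?thesis
    by (intro delta0_repI[of "C" "{Y}" "\<lambda>S \<rho> \<kappa>. FMem (s \<rho> \<kappa>) (inv S Y)"])
      (simp_all add: 1 assms(2) bounded_fm.intros f_inv_into_f)
qed

lemma delta0_not:
  assumes "delta0 P"
  shows "delta0 (\<lambda>e. \<not> P e)"
proof -
  from assms obtain C X \<phi> where r: "delta0_rep P C X \<phi>" unfolding delta0_def by blast
  note R = delta0_repD[OF r]
  show ?thesis
    by (rule delta0_repI[of C X "\<lambda>S \<rho> \<kappa>. FNeg (\<phi> S \<rho> \<kappa>)"]) (simp_all add: R bounded_fm.intros)
qed

lemma delta0_and:
  assumes "delta0 P" "delta0 Q"
  shows "delta0 (\<lambda>e. P e \<and> Q e)"
proof -
  from assms(1) obtain C X \<phi> where r1: "delta0_rep P C X \<phi>" unfolding delta0_def by blast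
  note 1 = delta0_repD[OF r1]
  from assms(2) obtain D Y \<psi> where r2: "delta0_rep Q D Y \<psi>" unfolding delta0_def by blast
  note 2 = delta0_repD[OF r2]
  show ?thesis
    by (rule delta0_repI[of "C \<union> D" "X \<union> Y" "\<lambda>S \<rho> \<kappa>. FAnd (\<phi> S \<rho> \<kappa>) (\<psi> S \<rho> \<kappa>)"])
      (simp_all add: 1 2 names_Un bounded_fm.intros)
qed

text \<open>The variable \<open>x \<rho> \<kappa>\<close> avoids the variables of the environment
  and of the parameters, so assigning to it changes neither the bound \<open>t\<close> nor the outer
  values. It is pushed in front of \<open>\<rho>\<close> to become \<open>e 0\<close> for
  \<open>P\<close>; this uses up one name, so infinitely many stay fresh.\<close>

lemma delta0_ex:
  assumes "delta0 (\<lambda>e. P (e 0) (\<lambda>i. e (Suc i)))" "term_definable t"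
  shows "delta0 (\<lambda>e. \<exists>a. a \<prec> t e \<and> P a e)"
proof -
  from assms(1) obtain C X \<phi> where r1: "delta0_rep (\<lambda>e. P (e 0) (\<lambda>i. e (Suc i))) C X \<phi>" unfolding delta0_def by blast
  note 1 = delta0_repD[OF r1]
  from assms(2) obtain D r where r2: "term_rep t D r" unfolding term_definable_def by blast
  note 2 = term_repD[OF r2]
  define x where "x = (\<lambda>(\<rho> :: nat \<Rightarrow> nat) (\<kappa> :: 'a \<Rightarrow> nat). SOME x. x \<in> - range \<rho> - \<kappa> ` (C \<union> D))"
  define \<rho>' where "\<rho>' = (\<lambda>\<rho> \<kappa>. case_nat (x \<rho> \<kappa>) \<rho>)"
  have x: "x \<rho> \<kappa> \<notin> range \<rho>" "x \<rho> \<kappa> \<notin> \<kappa> ` (C \<union> D)" if "infinite (- range \<rho>)" for \<rho> \<kappa>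
  proof -
    have "infinite (- range \<rho> - \<kappa> ` (C \<union> D))" using that 1(1) 2(1) by simp
    then have "\<exists>x. x \<in> - range \<rho> - \<kappa> ` (C \<union> D)" using infinite_imp_nonempty by blast
    then have "x \<rho> \<kappa> \<in> - range \<rho> - \<kappa> ` (C \<union> D)" unfolding x_def by (rule someI_ex)
    then show "x \<rho> \<kappa> \<notin> range \<rho>" "x \<rho> \<kappa> \<notin> \<kappa> ` (C \<union> D)" by auto
  qed
  have inf: "infinite (- range (\<rho>' \<rho> \<kappa>))" if "infinite (- range \<rho>)" for \<rho> \<kappa>
  proof -
    have "- range \<rho> - {x \<rho> \<kappa>} \<subseteq> - range (\<rho>' \<rho> \<kappa>)" by (auto simp: \<rho>'_def split: nat.splits)
    moreover have "infinite (- range \<rho> - {x \<rho> \<kappa>})" using that by simp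
    ultimately show ?thesis using finite_subset by blast
  qed
  show ?thesis
  proof (rule delta0_repI[of "C \<union> D" X "\<lambda>S \<rho> \<kappa>. FEx (x \<rho> \<kappa>) (FAnd (FLess (Var (x \<rho> \<kappa>)) (r \<rho> \<kappa>)) (\<phi> S (\<rho>' \<rho> \<kappa>) \<kappa>))"])
    fix S :: "nat \<Rightarrow> 'a set" and \<rho> :: "nat \<Rightarrow> nat" and \<kappa> :: "'a \<Rightarrow> nat"
    assume S: "X \<subseteq> range S" and \<rho>: "infinite (- range \<rho>)"
    note x = x[OF \<rho>] and inf = inf[OF \<rho>]
    have "x \<rho> \<kappa> \<notin> tvars (r \<rho> \<kappa>)" using 2(2)[of \<rho> \<kappa>] x[of \<kappa>] by blast
    then show "bounded_fm (FEx (x \<rho> \<kappa>) (FAnd (FLess (Var (x \<rho> \<kappa>)) (r \<rho> \<kappa>)) (\<phi> S (\<rho>' \<rho> \<kappa>) \<kappa>)))"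
      using 1(4)[OF S inf] by (rule bounded_fm.intros(8)[rotated])
    fix e assume e: "names \<kappa> (C \<union> D) e"
    have "sat M (e(x \<rho> \<kappa> := a)) S (\<phi> S (\<rho>' \<rho> \<kappa>) \<kappa>) \<longleftrightarrow> P a (\<lambda>i. e (\<rho> i))"
      "tval M (e(x \<rho> \<kappa> := a)) (r \<rho> \<kappa>) = t (\<lambda>i. e (\<rho> i))" for a
    proof -
      have "names \<kappa> (C \<union> D) (e(x \<rho> \<kappa> := a))" using e x(2)[of \<kappa>] unfolding names_def by (metis fun_upd_other imageI)
      then have n: "names \<kappa> C (e(x \<rho> \<kappa> := a))" "names \<kappa> D (e(x \<rho> \<kappa> := a))" by (simp_all add: names_Un)
      have ne: "\<rho> i \<noteq> x \<rho> \<kappa>" for i using x(1)[of \<kappa>] by (metis rangeI)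
      show "sat M (e(x \<rho> \<kappa> := a)) S (\<phi> S (\<rho>' \<rho> \<kappa>) \<kappa>) \<longleftrightarrow> P a (\<lambda>i. e (\<rho> i))"
        unfolding 1(5)[OF S inf n(1)] using ne by (simp add: \<rho>'_def)
      show "tval M (e(x \<rho> \<kappa> := a)) (r \<rho> \<kappa>) = t (\<lambda>i. e (\<rho> i))"
        unfolding 2(3)[OF n(2)] using ne by simp
    qed
    then show "sat M e S (FEx (x \<rho> \<kappa>) (FAnd (FLess (Var (x \<rho> \<kappa>)) (r \<rho> \<kappa>)) (\<phi> S (\<rho>' \<rho> \<kappa>) \<kappa>))) \<longleftrightarrow>
       (\<exists>a. a \<prec> t (\<lambda>i. e (\<rho> i)) \<and> P a (\<lambda>i. e (\<rho> i)))"
      by simp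
  qed (simp_all add: 1(1-3) 2(1))
qed

lemma delta0_rename:
  assumes "delta0 P"
  shows "delta0 (\<lambda>e. P (\<lambda>i. e (f i)))"
proof -
  from assms obtain C X \<phi> where r: "delta0_rep P C X \<phi>" unfolding delta0_def by blast
  note R = delta0_repD[OF r]
  have "infinite (- range (\<lambda>i. \<rho> (f i)))" if "infinite (- range \<rho>)" for \<rho> :: "nat \<Rightarrow> nat"
  proof -
    have "- range \<rho> \<subseteq> - range (\<lambda>i. \<rho> (f i))" by auto
    then show ?thesis using that by (rule infinite_super)
  qed
  then show ?thesis
    by (intro delta0_repI[of C X "\<lambda>S \<rho> \<kappa>. \<phi> S (\<lambda>i. \<rho> (f i)) \<kappa>"]) (simp_all add: R)
qed

lemma delta0_or:
  assumes "delta0 P" "delta0 Q"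
  shows "delta0 (\<lambda>e. P e \<or> Q e)"
  using delta0_not[OF delta0_and[OF delta0_not[OF assms(1)] delta0_not[OF assms(2)]]] by simp

lemma delta0_imp:
  assumes "delta0 P" "delta0 Q"
  shows "delta0 (\<lambda>e. P e \<longrightarrow> Q e)"
  using delta0_not[OF delta0_and[OF assms(1) delta0_not[OF assms(2)]]] by simp

lemma delta0_iff:
  assumes "delta0 P" "delta0 Q"
  shows "delta0 (\<lambda>e. P e \<longleftrightarrow> Q e)"
proof -
  have "(\<lambda>e. P e \<longleftrightarrow> Q e) = (\<lambda>e. (P e \<longrightarrow> Q e) \<and> (Q e \<longrightarrow> P e))" by auto
  then show ?thesis using delta0_and[OF delta0_imp[OF assms] delta0_imp[OF assms(2,1)]] by simp
qed

lemma delta0_all: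
  assumes "delta0 (\<lambda>e. P (e 0) (\<lambda>i. e (Suc i)))" "term_definable t"
  shows "delta0 (\<lambda>e. \<forall>a. a \<prec> t e \<longrightarrow> P a e)"
proof -
  have "(\<lambda>e. \<forall>a. a \<prec> t e \<longrightarrow> P a e) = (\<lambda>e. \<not> (\<exists>a. a \<prec> t e \<and> \<not> P a e))" by auto
  then show ?thesis using delta0_not[OF delta0_ex[OF delta0_not[OF assms(1)] assms(2)]] by simp
qed

lemmas definable = delta0_eq delta0_less delta0_mem delta0_not delta0_iff delta0_and delta0_or delta0_imp
  delta0_ex delta0_all term_add term_mult term_pair term_var term_const


section \<open>From bounded definability to induction and comprehension\<close>

lemma sets_nonempty: "Sets M \<noteq> {}"
  using RCA0 unfolding RCA0_def by blast

text \<open>Even variables carry the environment and odd ones the parameters. Variable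
  \<open>2\<close> is the argument \<open>a\<close> of the schemes and variable \<open>0\<close>
  their unbounded quantifier \<open>b\<close>, so the tail lists the values of \<open>e\<close> at
  \<open>4\<close>, \<open>6\<close> and so on. Both formulas share \<open>S\<close> and
  \<open>e\<close> because recursive comprehension evaluates its two formulas under one
  assignment.\<close>

lemma delta0_representation:
  assumes "delta0 P" "delta0 Q"
  obtains \<phi> \<psi> S e where "bounded_fm \<phi>" "bounded_fm \<psi>" "range S \<subseteq> Sets M"
    "\<And>a b. sat M (e(2 := a, 0 := b)) S \<phi> \<longleftrightarrow> P (case_nat b (case_nat a (\<lambda>i. e (Suc (Suc (Suc (Suc (2 * i))))))))"
    "\<And>a b. sat M (e(2 := a, 0 := b)) S \<psi> \<longleftrightarrow> Q (case_nat b (case_nat a (\<lambda>i. e (Suc (Suc (Suc (Suc (2 * i))))))))"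
proof -
  from assms(1) obtain C1 X1 \<phi>1 where r1: "delta0_rep P C1 X1 \<phi>1" unfolding delta0_def by blast
  note 1 = delta0_repD[OF r1]
  from assms(2) obtain C2 X2 \<phi>2 where r2: "delta0_rep Q C2 X2 \<phi>2" unfolding delta0_def by blast
  note 2 = delta0_repD[OF r2]
  define C X where "C = C1 \<union> C2" and "X = X1 \<union> X2"
  \<comment> \<open>\<open>Y\<close> pads the finite list of set parameters to a total assignment,
    also if there are no parameters.\<close>
  obtain Y where Y: "Y \<in> Sets M" using sets_nonempty by blast
  then have fin: "finite (insert Y X)" using 1(2) 2(2) by (simp add: X_def)
  obtain xs where xs: "set xs = insert Y X" using finite_list[OF fin] by blast
  define S :: "nat \<Rightarrow> 'a set" where "S = (\<lambda>i. if i < length xs then xs ! i else Y)"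
  have rS: "range S = insert Y X"
  proof
    have "S i \<in> insert Y X" for i
      using nth_mem[of i xs] unfolding xs S_def by (cases "i < length xs") simp_all
    then show "range S \<subseteq> insert Y X" by (rule image_subsetI)
    show "insert Y X \<subseteq> range S"
    proof
      fix Z assume "Z \<in> insert Y X"
      then obtain i where "i < length xs" "xs ! i = Z" using xs by (metis in_set_conv_nth)
      then have "S i = Z" by (simp add: S_def)
      then show "Z \<in> range S" by blast
    qed
  qed
  have "finite C" using 1(1) 2(1) by (simp add: C_def)
  then obtain h :: "'a \<Rightarrow> nat" where h: "inj_on h C" using finite_imp_inj_to_nat_seg by blast
  define \<kappa> where "\<kappa> = (\<lambda>c. 2 * h c + 1)"
  have inj: "inj_on \<kappa> C" using h by (auto simp: \<kappa>_def inj_on_def)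
  define \<rho> :: "nat \<Rightarrow> nat" where "\<rho> = (\<lambda>i. 2 * i)"
  have "range (\<lambda>i. 2 * i + 1) \<subseteq> - range \<rho>" by (auto simp: \<rho>_def) presburger
  moreover have "infinite (range (\<lambda>i::nat. 2 * i + 1))"
    by (simp add: finite_image_iff inj_on_def)
  ultimately have inf: "infinite (- range \<rho>)" by (rule infinite_super)
  have X: "X1 \<subseteq> range S" "X2 \<subseteq> range S" using rS X_def by blast+
  define e where "e = inv_into C \<kappa>"
  show thesis
  proof (rule that[of "\<phi>1 S \<rho> \<kappa>" "\<phi>2 S \<rho> \<kappa>" S e])
    show "bounded_fm (\<phi>1 S \<rho> \<kappa>)" "bounded_fm (\<phi>2 S \<rho> \<kappa>)" using 1(4)[OF X(1) inf] 2(4)[OF X(2) inf] by simp_all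
    show "range S \<subseteq> Sets M" using rS 1(3) 2(3) X_def Y by simp
    fix a b
    have "(e(2 := a, 0 := b)) (\<kappa> c) = c" if "c \<in> C" for c
    proof -
      have "\<kappa> c \<noteq> 2" "\<kappa> c \<noteq> 0" unfolding \<kappa>_def by presburger+
      then show "(e(2 := a, 0 := b)) (\<kappa> c) = c" using inj that by (simp add: e_def)
    qed
    then have "names \<kappa> C (e(2 := a, 0 := b))" unfolding names_def by blast
    then have c: "names \<kappa> C1 (e(2 := a, 0 := b))" "names \<kappa> C2 (e(2 := a, 0 := b))"
      unfolding C_def names_Un by blast+
    have eq: "(\<lambda>i. (e(2 := a, 0 := b)) (\<rho> i)) = case_nat b (case_nat a (\<lambda>i. e (Suc (Suc (Suc (Suc (2 * i)))))))"
      by (rule ext) (auto simp: \<rho>_def split: nat.splits)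
    show "sat M (e(2 := a, 0 := b)) S (\<phi>1 S \<rho> \<kappa>) \<longleftrightarrow> P (case_nat b (case_nat a (\<lambda>i. e (Suc (Suc (Suc (Suc (2 * i))))))))"
      using 1(5)[OF X(1) inf c(1)] unfolding eq .
    show "sat M (e(2 := a, 0 := b)) S (\<phi>2 S \<rho> \<kappa>) \<longleftrightarrow> Q (case_nat b (case_nat a (\<lambda>i. e (Suc (Suc (Suc (Suc (2 * i))))))))"
      using 2(5)[OF X(2) inf c(2)] unfolding eq .
  qed
qed

lemma sigma1_induct:
  assumes "delta0 (\<lambda>e. P (e 0) (e (Suc 0)))"
    and "\<exists>b. P b \<zero>" "\<And>a. \<exists>b. P b a \<Longrightarrow> \<exists>b. P b (a \<oplus> \<one>)"
  shows "\<exists>b. P b a"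
proof -
  obtain \<phi> S e where \<phi>: "bounded_fm \<phi>" "range S \<subseteq> Sets M"
    "\<And>a b. sat M (e(2 := a, 0 := b)) S \<phi> \<longleftrightarrow> P b a"
    by (rule delta0_representation[OF assms(1) assms(1)]) auto
  have "\<forall>a. sat M (e(2 := a)) S (FEx 0 \<phi>)"
  proof -
    have "Sigma01 (FEx 0 \<phi>)" unfolding Sigma01_def using \<phi>(1) by blast
    moreover have "sat M (e(2 := \<zero>)) S (FEx 0 \<phi>)" using assms(2) \<phi>(3) by simp
    moreover have "\<forall>a. sat M (e(2 := a)) S (FEx 0 \<phi>) \<longrightarrow> sat M (e(2 := a \<oplus> \<one>)) S (FEx 0 \<phi>)"
      using assms(3) \<phi>(3) by simp
    moreover have "Sigma01_induction M" using RCA0 unfolding RCA0_def by blast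
    ultimately show ?thesis using \<phi>(2) unfolding Sigma01_induction_def by blast
  qed
  then show ?thesis using \<phi>(3) by simp
qed

lemma delta1_comprehension:
  assumes "delta0 (\<lambda>e. P (e 0) (e (Suc 0)))" "delta0 (\<lambda>e. Q (e 0) (e (Suc 0)))"
    and "\<And>a. (\<exists>b. P b a) \<longleftrightarrow> (\<forall>b. Q b a)"
  shows "{a. \<exists>b. P b a} \<in> Sets M"
proof -
  obtain \<phi> \<psi> S e where \<phi>: "bounded_fm \<phi>" "bounded_fm \<psi>" "range S \<subseteq> Sets M"
    "\<And>a b. sat M (e(2 := a, 0 := b)) S \<phi> \<longleftrightarrow> P b a"
    "\<And>a b. sat M (e(2 := a, 0 := b)) S \<psi> \<longleftrightarrow> Q b a"
    by (rule delta0_representation[OF assms(1,2)]) auto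
  have "{a. sat M (e(2 := a)) S (FEx 0 \<phi>)} \<in> Sets M"
  proof -
    have "Sigma01 (FEx 0 \<phi>)" "Pi01 (FAll 0 \<psi>)"
      unfolding Sigma01_def Pi01_def using \<phi>(1,2) by blast+
    moreover have "\<forall>a. sat M (e(2 := a)) S (FEx 0 \<phi>) \<longleftrightarrow> sat M (e(2 := a)) S (FAll 0 \<psi>)"
      using assms(3) \<phi>(4,5) by simp
    moreover have "recursive_comprehension M" using RCA0 unfolding RCA0_def by blast
    ultimately show ?thesis using \<phi>(3) unfolding recursive_comprehension_def by blast
  qed
  then show ?thesis using \<phi>(4) by simp
qed

lemma delta0_comprehension:
  assumes "delta0 (\<lambda>e. P (e 0))"
  shows "{a. P a} \<in> Sets M"
proof -
  have "delta0 (\<lambda>e. P (e (Suc 0)))" using delta0_rename[OF assms, of Suc] by simp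
  from delta1_comprehension[OF this this] show ?thesis by simp
qed

section \<open>Arithmetic\<close>

lemma delta0_induct:
  assumes "delta0 (\<lambda>e. P (e 0))" and "P \<zero>" and "\<And>a. P a \<Longrightarrow> P (a \<oplus> \<one>)"
  shows "P a"
  using sigma1_induct[of "\<lambda>b a. P a" a] delta0_rename[OF assms(1), of Suc] assms(2,3) by simp

definition le :: "'a \<Rightarrow> 'a \<Rightarrow> bool" (infix \<open>\<preceq>\<close> 50) where
  "x \<preceq> y \<longleftrightarrow> x \<prec> y \<or> x = y"

text \<open>Truncated subtraction, the operation that the class \<open>linordered_semidom\<close>
  expects.\<close>

definition minus :: "'a \<Rightarrow> 'a \<Rightarrow> 'a" (infixl \<open>\<ominus>\<close> 65) where
  "x \<ominus> y = (if y \<preceq> x then THE d. y \<oplus> d = x else \<zero>)"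

lemma peano:
  "m \<oplus> \<one> \<noteq> \<zero>" "m \<oplus> \<one> = n \<oplus> \<one> \<longleftrightarrow> m = n" "m \<oplus> \<zero> = m" "m \<oplus> (n \<oplus> \<one>) = (m \<oplus> n) \<oplus> \<one>"
  "m \<otimes> \<zero> = \<zero>" "m \<otimes> (n \<oplus> \<one>) = (m \<otimes> n) \<oplus> m" "\<not> m \<prec> \<zero>" "m \<prec> n \<oplus> \<one> \<longleftrightarrow> m \<prec> n \<or> m = n"
  using RCA0 unfolding RCA0_def basic_axioms_def by blast+

section \<open>Addition and multiplication\<close>

lemma add_assoc': "(a \<oplus> b) \<oplus> c = a \<oplus> (b \<oplus> c)"
  by (rule delta0_induct[of "\<lambda>c. (a \<oplus> b) \<oplus> c = a \<oplus> (b \<oplus> c)"])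
    (intro definable, simp_all add: peano)

lemma zero_add: "\<zero> \<oplus> a = a"
  by (rule delta0_induct[of "\<lambda>a. \<zero> \<oplus> a = a"]) (intro definable, simp_all add: peano)

lemma one_add: "\<one> \<oplus> a = a \<oplus> \<one>"
  by (rule delta0_induct[of "\<lambda>a. \<one> \<oplus> a = a \<oplus> \<one>"]) (intro definable, simp_all add: peano zero_add)

lemma add_comm': "a \<oplus> b = b \<oplus> a"
proof (rule delta0_induct[of "\<lambda>b. a \<oplus> b = b \<oplus> a"])
  show "a \<oplus> (b \<oplus> \<one>) = (b \<oplus> \<one>) \<oplus> a" if "a \<oplus> b = b \<oplus> a" for b
    using that by (metis peano(4) add_assoc' one_add)
qed (intro definable, simp add: peano zero_add)

lemma add_cancel: "a \<oplus> c = b \<oplus> c \<Longrightarrow> a = b"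
proof -
  have "a \<oplus> c = b \<oplus> c \<longrightarrow> a = b"
    by (rule delta0_induct[of "\<lambda>c. a \<oplus> c = b \<oplus> c \<longrightarrow> a = b"])
      (intro definable, simp_all add: peano)
  then show "a \<oplus> c = b \<oplus> c \<Longrightarrow> a = b" by simp
qed

lemma add_left_commute': "b \<oplus> (a \<oplus> c) = a \<oplus> (b \<oplus> c)"
  using add_assoc' add_comm' by metis

lemmas add_acs = add_assoc' add_comm' add_left_commute'

lemma zero_mult: "\<zero> \<otimes> a = \<zero>"
  by (rule delta0_induct[of "\<lambda>a. \<zero> \<otimes> a = \<zero>"]) (intro definable, simp_all add: peano)

lemma succ_mult: "(a \<oplus> \<one>) \<otimes> b = a \<otimes> b \<oplus> b"
  by (rule delta0_induct[of "\<lambda>b. (a \<oplus> \<one>) \<otimes> b = a \<otimes> b \<oplus> b"])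
    (intro definable, simp add: peano, simp add: peano(6) add_acs)

lemma mult_comm': "a \<otimes> b = b \<otimes> a"
  by (rule delta0_induct[of "\<lambda>b. a \<otimes> b = b \<otimes> a"])
    (intro definable, simp_all add: peano(5,6) zero_mult succ_mult)

lemma distrib': "a \<otimes> (b \<oplus> c) = a \<otimes> b \<oplus> a \<otimes> c"
proof (rule delta0_induct[of "\<lambda>c. a \<otimes> (b \<oplus> c) = a \<otimes> b \<oplus> a \<otimes> c"])
  show "a \<otimes> (b \<oplus> (c \<oplus> \<one>)) = a \<otimes> b \<oplus> a \<otimes> (c \<oplus> \<one>)" if "a \<otimes> (b \<oplus> c) = a \<otimes> b \<oplus> a \<otimes> c" for c
    using that by (simp add: peano(6) add_assoc'[symmetric])
qed (intro definable, simp add: peano)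

lemma mult_one: "a \<otimes> \<one> = a"
  using peano(6)[of a \<zero>] peano(5) zero_add by metis

lemma mult_assoc': "(a \<otimes> b) \<otimes> c = a \<otimes> (b \<otimes> c)"
  by (rule delta0_induct[of "\<lambda>c. (a \<otimes> b) \<otimes> c = a \<otimes> (b \<otimes> c)"])
    (intro definable, simp_all add: peano distrib' mult_one)

text \<open>The basic axioms describe the order by recursion on its right argument; expressed
  through addition, it inherits the laws of addition. The difference \<open>d\<close> is carried
  through the induction as the \<open>\<Sigma>\<^sub>1\<close> witness.\<close>

lemma less_iff: "a \<prec> b \<longleftrightarrow> (\<exists>d. (a \<oplus> d) \<oplus> \<one> = b)"
proof
  have "\<exists>d. a \<prec> b \<longrightarrow> (a \<oplus> d) \<oplus> \<one> = b"
  proof (rule sigma1_induct[of "\<lambda>d b. a \<prec> b \<longrightarrow> (a \<oplus> d) \<oplus> \<one> = b"])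
    fix b assume "\<exists>d. a \<prec> b \<longrightarrow> (a \<oplus> d) \<oplus> \<one> = b"
    then show "\<exists>d. a \<prec> b \<oplus> \<one> \<longrightarrow> (a \<oplus> d) \<oplus> \<one> = b \<oplus> \<one>"
      unfolding peano(8) using peano(3,4) by metis
  qed (intro definable, simp add: peano)
  then show "a \<prec> b \<Longrightarrow> \<exists>d. (a \<oplus> d) \<oplus> \<one> = b" by blast
  have "a \<prec> (a \<oplus> d) \<oplus> \<one>" for d
    by (rule delta0_induct[of "\<lambda>d. a \<prec> (a \<oplus> d) \<oplus> \<one>"]) (intro definable, simp_all add: peano)
  then show "\<exists>d. (a \<oplus> d) \<oplus> \<one> = b \<Longrightarrow> a \<prec> b" by blast
qed

section \<open>Linear order and truncated subtraction\<close>

lemma less_irrefl': "\<not> a \<prec> a"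
proof
  assume "a \<prec> a"
  then obtain d where "(a \<oplus> d) \<oplus> \<one> = a" unfolding less_iff by blast
  then have "(d \<oplus> \<one>) \<oplus> a = \<zero> \<oplus> a" by (simp add: peano(3) add_acs)
  then show False using add_cancel peano(1) by blast
qed

lemma less_trans': "a \<prec> b \<Longrightarrow> b \<prec> c \<Longrightarrow> a \<prec> c"
  unfolding less_iff by (metis add_assoc')

lemma zero_or_succ: "a = \<zero> \<or> (\<exists>p. a = p \<oplus> \<one>)"
proof -
  have "a = \<zero> \<or> \<zero> \<prec> a"
    by (rule delta0_induct[of "\<lambda>a. a = \<zero> \<or> \<zero> \<prec> a"]) (intro definable, auto simp: peano)
  then show ?thesis unfolding less_iff by blast
qed

lemma less_linear': "a \<prec> n \<or> a = n \<or> n \<prec> a"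
proof (rule delta0_induct[of "\<lambda>n. a \<prec> n \<or> a = n \<or> n \<prec> a"])
  show "a \<prec> \<zero> \<or> a = \<zero> \<or> \<zero> \<prec> a" using zero_or_succ[of a] by (auto simp: less_iff zero_add)
  fix n assume "a \<prec> n \<or> a = n \<or> n \<prec> a"
  moreover have "a \<prec> n \<oplus> \<one> \<or> a = n \<oplus> \<one> \<or> n \<oplus> \<one> \<prec> a" if "n \<prec> a"
  proof -
    from that obtain d where d: "(n \<oplus> d) \<oplus> \<one> = a" unfolding less_iff by blast
    from zero_or_succ[of d] show ?thesis
    proof
      assume "d = \<zero>" then show ?thesis using d by (simp add: peano)
    next
      assume "\<exists>p. d = p \<oplus> \<one>"
      then obtain p where "d = p \<oplus> \<one>" by blast
      then have "((n \<oplus> \<one>) \<oplus> p) \<oplus> \<one> = a" using d by (simp add: add_acs)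
      then show ?thesis unfolding less_iff by blast
    qed
  qed
  ultimately show "a \<prec> n \<oplus> \<one> \<or> a = n \<oplus> \<one> \<or> n \<oplus> \<one> \<prec> a" using peano(8) by blast
qed (intro definable)

lemma le_iff: "a \<preceq> b \<longleftrightarrow> (\<exists>d. a \<oplus> d = b)"
  unfolding le_def less_iff using zero_or_succ peano(3,4) by metis

lemma one_neq_zero: "\<one> \<noteq> \<zero>"
  using peano(1)[of \<zero>] by (simp add: zero_add)

lemma diff_eqI: "b \<oplus> d = a \<Longrightarrow> a \<ominus> b = d"
proof -
  assume *: "b \<oplus> d = a"
  then have "b \<preceq> a" unfolding le_iff by blast
  moreover have "(THE d. b \<oplus> d = a) = d"
    by (rule the_equality) (use * add_cancel add_comm' in metis)+
  ultimately show "a \<ominus> b = d" unfolding minus_def by simp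
qed

lemma diff_eq_zero: "a \<prec> b \<Longrightarrow> a \<ominus> b = \<zero>"
  unfolding minus_def le_def using less_irrefl' less_trans' by auto

lemma le_or_less: "a \<preceq> b \<or> b \<prec> a"
  using less_linear' le_def by blast

lemma add_eq_zero: "a \<oplus> b = \<zero> \<Longrightarrow> a = \<zero>"
  using zero_or_succ[of b] peano(1,3,4) by metis

lemma add_left_less: "a \<prec> b \<Longrightarrow> c \<oplus> a \<prec> c \<oplus> b"
  unfolding less_iff by (metis add_assoc')

lemma mult_left_less:
  assumes "a \<prec> b" "\<zero> \<prec> c"
  shows "c \<otimes> a \<prec> c \<otimes> b"
proof -
  obtain d p where "b = (a \<oplus> d) \<oplus> \<one>" "c = p \<oplus> \<one>" using assms unfolding less_iff zero_add by blast
  then have "c \<otimes> b = (c \<otimes> a \<oplus> (c \<otimes> d \<oplus> p)) \<oplus> \<one>" by (simp add: distrib' mult_one add_acs)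
  then show ?thesis unfolding less_iff by metis
qed

lemma diff_diff: "a \<ominus> b \<ominus> c = a \<ominus> (b \<oplus> c)"
proof (cases "b \<oplus> c \<preceq> a")
  case True
  then obtain d where d: "(b \<oplus> c) \<oplus> d = a" unfolding le_iff by blast
  then have "a \<ominus> b = c \<oplus> d" by (intro diff_eqI) (simp add: add_assoc')
  with d show ?thesis by (simp add: diff_eqI)
next
  case False
  then have z: "a \<ominus> (b \<oplus> c) = \<zero>" unfolding minus_def by simp
  show ?thesis
  proof (cases "b \<preceq> a")
    case True
    then obtain d where d: "b \<oplus> d = a" unfolding le_iff by blast
    have "\<not> c \<preceq> d" using False d unfolding le_iff by (metis add_assoc')
    then show ?thesis using z d by (simp add: diff_eqI minus_def[of d])
  next
    case F: False
    have "\<zero> \<ominus> c = \<zero>" unfolding minus_def le_iff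
      by (metis add_eq_zero diff_eqI peano(3) le_iff minus_def)
    then show ?thesis using z F by (simp add: minus_def[of a])
  qed
qed

lemma mult_diff_distrib: "a \<otimes> (b \<ominus> c) = a \<otimes> b \<ominus> a \<otimes> c"
proof (cases "c \<preceq> b")
  case True
  then obtain d where "c \<oplus> d = b" unfolding le_iff by blast
  then have "b \<ominus> c = d" "a \<otimes> c \<oplus> a \<otimes> d = a \<otimes> b" using diff_eqI distrib' by metis+
  then show ?thesis by (simp add: diff_eqI)
next
  case False
  then have bc: "b \<prec> c" using le_or_less by blast
  show ?thesis
  proof (cases "a = \<zero>")
    case True
    then show ?thesis using diff_eqI[of \<zero> \<zero> \<zero>] by (simp add: zero_mult peano)
  next
    case False
    then have "\<zero> \<prec> a" using less_linear' peano(7) by blast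
    then show ?thesis using mult_left_less bc by (simp add: diff_eq_zero peano)
  qed
qed

text \<open>The lemmas on ordered semidoms thereby apply to the possibly nonstandard numbers of
  \<open>M\<close>; induction still has to go through definability.\<close>

sublocale linordered_semidom where minus = "(\<ominus>)" and plus = "(\<oplus>)" and zero = "\<zero>" and times = "(\<otimes>)"
  and one = "\<one>" and less_eq = "(\<preceq>)" and less = "(\<prec>)"
proof unfold_locales
  fix a b c
  show "a \<oplus> b \<oplus> c = a \<oplus> (b \<oplus> c)" by (rule add_assoc')
  show "a \<oplus> b = b \<oplus> a" by (rule add_comm')
  show "a \<oplus> b \<ominus> a = b" by (simp add: diff_eqI)
  show "a \<ominus> b \<ominus> c = a \<ominus> (b \<oplus> c)" by (rule diff_diff)
  show "(a \<prec> b) = (a \<preceq> b \<and> \<not> b \<preceq> a)" unfolding le_def using less_irrefl' less_trans' by blast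
  show "a \<preceq> a" unfolding le_def by simp
  show "a \<preceq> b \<Longrightarrow> b \<preceq> c \<Longrightarrow> a \<preceq> c" unfolding le_def using less_trans' by blast
  show "a \<preceq> b \<Longrightarrow> b \<preceq> a \<Longrightarrow> a = b" unfolding le_def using less_irrefl' less_trans' by blast
  show "a \<preceq> b \<Longrightarrow> c \<oplus> a \<preceq> c \<oplus> b" unfolding le_def using add_left_less by blast
  show "a \<preceq> b \<or> b \<preceq> a" using le_or_less le_def by blast
  show "\<zero> \<oplus> a = a" by (rule zero_add)
  show "a \<otimes> b \<otimes> c = a \<otimes> (b \<otimes> c)" by (rule mult_assoc')
  show "a \<otimes> b = b \<otimes> a" by (rule mult_comm')
  show "\<one> \<otimes> a = a" using mult_one mult_comm' by metis
  show "(a \<oplus> b) \<otimes> c = a \<otimes> c \<oplus> b \<otimes> c" using distrib' mult_comm' by metis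
  show "a \<otimes> (b \<ominus> c) = a \<otimes> b \<ominus> a \<otimes> c" by (rule mult_diff_distrib)
  show "\<zero> \<otimes> a = \<zero>" by (rule zero_mult)
  show "a \<otimes> \<zero> = \<zero>" by (rule peano(5))
  show "a \<otimes> (b \<oplus> c) = a \<otimes> b \<oplus> a \<otimes> c" by (rule distrib')
  show "\<zero> \<noteq> \<one>" using one_neq_zero by simp
  show "\<zero> \<prec> \<one>" using less_linear' peano(7) one_neq_zero by blast
  show "a \<prec> b \<Longrightarrow> \<zero> \<prec> c \<Longrightarrow> c \<otimes> a \<prec> c \<otimes> b" by (rule mult_left_less)
  show "b \<preceq> a \<Longrightarrow> a \<ominus> b \<oplus> b = a" unfolding le_iff using diff_eqI add_comm' by metis
  show "a \<noteq> \<zero> \<Longrightarrow> b \<noteq> \<zero> \<Longrightarrow> a \<otimes> b \<noteq> \<zero>"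
    using mult_left_less[of \<zero> b a] less_linear' peano(5,7) by metis
qed

lemma less_succ_iff: "a \<prec> b \<oplus> \<one> \<longleftrightarrow> a \<preceq> b"
  using peano(8) le_def by simp

lemma succ_le_iff: "a \<oplus> \<one> \<preceq> b \<longleftrightarrow> a \<prec> b"
proof -
  have "a \<oplus> \<one> \<preceq> b \<longleftrightarrow> \<not> b \<prec> a \<oplus> \<one>" by (simp add: not_less)
  then show ?thesis unfolding less_succ_iff by (simp add: not_le)
qed

lemma le_self_mult: "a \<preceq> a \<otimes> a"
proof (cases "a = \<zero>")
  case False
  then have "\<zero> \<oplus> \<one> \<preceq> a" unfolding succ_le_iff using peano(7) less_linear' by blast
  then show ?thesis using mult_left_mono[of \<one> a a] by (simp add: le_iff)
qed simp

lemma zero_le_all [simp]: "\<zero> \<preceq> a"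
  unfolding le_iff by simp

lemma le_add_left: "a \<preceq> b \<oplus> a" and le_add_right: "a \<preceq> a \<oplus> b"
  unfolding le_iff using add_comm' by blast+

lemma delta0_le:
  assumes "term_definable t" "term_definable u"
  shows "delta0 (\<lambda>e. t e \<preceq> u e)"
  unfolding le_def by (intro delta0_or delta0_less delta0_eq assms)

section \<open>Substitution of terms into definable relations\<close>

lemma term_rename:
  assumes "term_definable t"
  shows "term_definable (\<lambda>e. t (\<lambda>i. e (f i)))"
proof -
  from assms obtain C s where r: "term_rep t C s" unfolding term_definable_def by blast
  note R = term_repD[OF r]
  have "tvars (s (\<lambda>i. \<rho> (f i)) \<kappa>) \<subseteq> range \<rho> \<union> \<kappa> ` C" for \<rho> \<kappa>
    using R(2)[of "\<lambda>i. \<rho> (f i)" \<kappa>] by auto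
  then show ?thesis
    by (intro term_repI[of C "\<lambda>\<rho> \<kappa>. s (\<lambda>i. \<rho> (f i)) \<kappa>"]) (simp_all add: R(1,3))
qed

text \<open>Instead of substituting in a formula, a quantifier bounded by
  \<open>t e \<oplus> \<one>\<close> names the value of \<open>t\<close>.\<close>

lemma delta0_subst:
  assumes "delta0 (\<lambda>e. R (e 0))" "term_definable t"
  shows "delta0 (\<lambda>e. R (t e))"
proof -
  note t = term_rename[OF assms(2)]
  have "(\<lambda>e. R (t e)) = (\<lambda>e. \<exists>a. a \<prec> t e \<oplus> \<one> \<and> (a = t e \<and> R a))" by (auto simp: less_succ_iff)
  moreover have "delta0 (\<lambda>e. \<exists>a. a \<prec> t e \<oplus> \<one> \<and> (a = t e \<and> R a))"
    by (rule delta0_ex) (intro delta0_and delta0_eq t assms term_var term_add term_const)+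
  ultimately show ?thesis by simp
qed

lemma delta0_subst2:
  assumes "delta0 (\<lambda>e. R (e 0) (e (Suc 0)))" "term_definable t" "term_definable u"
  shows "delta0 (\<lambda>e. R (t e) (u e))"
proof -
  note t = term_rename[OF assms(2)] and u = term_rename[OF assms(3)]
  \<comment> \<open>Inside both quantifiers the inner witness \<open>b\<close> is variable
    \<open>0\<close> and the outer witness \<open>a\<close> is variable \<open>1\<close>, hence the
    exchange.\<close>
  have R: "delta0 (\<lambda>e. R (e (Suc 0)) (e 0))"
    using delta0_rename[OF assms(1), of "\<lambda>i. if i = 0 then Suc 0 else 0"] by simp
  have "(\<lambda>e. R (t e) (u e)) = (\<lambda>e. \<exists>a. a \<prec> t e \<oplus> \<one> \<and> (a = t e \<and> (\<exists>b. b \<prec> u e \<oplus> \<one> \<and> (b = u e \<and> R a b))))"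
    by (auto simp: less_succ_iff)
  moreover have "delta0 (\<lambda>e. \<exists>a. a \<prec> t e \<oplus> \<one> \<and> (a = t e \<and> (\<exists>b. b \<prec> u e \<oplus> \<one> \<and> (b = u e \<and> R a b))))"
    by (intro delta0_ex delta0_and delta0_eq t u assms(2,3) R term_var term_add term_const)
  ultimately show ?thesis by simp
qed

lemma delta0_subst3:
  assumes "delta0 (\<lambda>e. R (e 0) (e (Suc 0)) (e (Suc (Suc 0))))"
    "term_definable t" "term_definable u" "term_definable v"
  shows "delta0 (\<lambda>e. R (t e) (u e) (v e))"
proof -
  note t = term_rename[OF assms(2)] and u = term_rename[OF assms(3)] and v = term_rename[OF assms(4)]
  have R: "delta0 (\<lambda>e. R (e (Suc (Suc 0))) (e (Suc 0)) (e 0))"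
    using delta0_rename[OF assms(1), of "\<lambda>i. if i = 0 then Suc (Suc 0) else if i = Suc 0 then Suc 0 else 0"] by simp
  have "(\<lambda>e. R (t e) (u e) (v e)) = (\<lambda>e. \<exists>a. a \<prec> t e \<oplus> \<one> \<and> (a = t e \<and> (\<exists>b. b \<prec> u e \<oplus> \<one> \<and>
     (b = u e \<and> (\<exists>c. c \<prec> v e \<oplus> \<one> \<and> (c = v e \<and> R a b c))))))"
    by (auto simp: less_succ_iff)
  moreover have "delta0 (\<lambda>e. \<exists>a. a \<prec> t e \<oplus> \<one> \<and> (a = t e \<and> (\<exists>b. b \<prec> u e \<oplus> \<one> \<and>
     (b = u e \<and> (\<exists>c. c \<prec> v e \<oplus> \<one> \<and> (c = v e \<and> R a b c))))))"
    by (intro delta0_ex delta0_and delta0_eq t u v assms(2,3,4) R term_var term_add term_const)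
  ultimately show ?thesis by simp
qed

section \<open>Least numbers and the pairing function\<close>

lemma least_number:
  assumes "delta0 (\<lambda>e. P (e 0))" "P a"
  shows "\<exists>m. P m \<and> (\<forall>b. b \<prec> m \<longrightarrow> \<not> P b)"
proof (rule ccontr)
  assume "\<not> (\<exists>m. P m \<and> (\<forall>b. b \<prec> m \<longrightarrow> \<not> P b))"
  then have *: "P m \<Longrightarrow> \<exists>b. b \<prec> m \<and> P b" for m by blast
  have "\<forall>b. b \<prec> n \<longrightarrow> \<not> P b" for n
    by (rule delta0_induct[of "\<lambda>n. \<forall>b. b \<prec> n \<longrightarrow> \<not> P b"],
      intro delta0_all delta0_not assms term_var) (use * peano in blast)+
  then show False using assms(2) peano(8)[of a a] by blast
qed

text \<open>Pairs with sum \<open>s\<close> lie between the square of \<open>s\<close> and the next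
  square. So a pair determines its sum, and then \<open>x\<close> is what remains.\<close>

lemma pair_less_square: "pair M x y \<prec> (x \<oplus> y \<oplus> \<one>) \<otimes> (x \<oplus> y \<oplus> \<one>)"
proof -
  have "(x \<oplus> y \<oplus> \<one>) \<otimes> (x \<oplus> y \<oplus> \<one>) = (pair M x y \<oplus> (x \<oplus> y \<oplus> y)) \<oplus> \<one>"
    unfolding pair_def by (simp add: algebra_simps)
  then show ?thesis unfolding less_iff by metis
qed

lemma pair_less_if_sum_less: "x \<oplus> y \<prec> x' \<oplus> y' \<Longrightarrow> pair M x y \<prec> pair M x' y'"
proof -
  assume "x \<oplus> y \<prec> x' \<oplus> y'"
  then have "x \<oplus> y \<oplus> \<one> \<preceq> x' \<oplus> y'" by (simp add: succ_le_iff)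
  then have "(x \<oplus> y \<oplus> \<one>) \<otimes> (x \<oplus> y \<oplus> \<one>) \<preceq> (x' \<oplus> y') \<otimes> (x' \<oplus> y')" by (intro mult_mono) auto
  also have "\<dots> \<preceq> pair M x' y'" unfolding pair_def by (rule le_add_right)
  finally show ?thesis using pair_less_square less_le_trans by blast
qed

lemma pair_eq_iff [simp]: "pair M x y = pair M x' y' \<longleftrightarrow> x = x' \<and> y = y'"
proof
  assume eq: "pair M x y = pair M x' y'"
  then have s: "x \<oplus> y = x' \<oplus> y'" using pair_less_if_sum_less less_linear' less_irrefl' by metis
  then have "x = x'" using eq unfolding pair_def by simp
  then show "x = x' \<and> y = y'" using s by simp
qed simp

lemma le_pair1: "x \<preceq> pair M x y"
  unfolding pair_def by (rule le_add_left)

lemma le_pair2: "y \<preceq> pair M x y"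
proof -
  have "y \<preceq> x \<oplus> y" by (rule le_add_left)
  also have "\<dots> \<preceq> (x \<oplus> y) \<otimes> (x \<oplus> y)" by (rule le_self_mult)
  also have "\<dots> \<preceq> pair M x y" unfolding pair_def by (rule le_add_right)
  finally show ?thesis .
qed

lemma pair_mono: "x \<preceq> x' \<Longrightarrow> y \<preceq> y' \<Longrightarrow> pair M x y \<preceq> pair M x' y'"
  unfolding pair_def by (intro add_mono mult_mono) auto

lemma less_pair_succ1: "p = pair M x y \<Longrightarrow> x \<prec> p \<oplus> \<one>" and less_pair_succ2: "p = pair M x y \<Longrightarrow> y \<prec> p \<oplus> \<one>"
  by (simp_all add: less_succ_iff le_pair1 le_pair2)

lemma pair_less2: "y \<prec> y' \<Longrightarrow> pair M x y \<prec> pair M x y'"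
  by (rule pair_less_if_sum_less) simp

section \<open>Coding of finite sets and sequences\<close>

lemma zero_less_if_neq: "a \<noteq> \<zero> \<Longrightarrow> \<zero> \<prec> a"
  using less_linear' peano(7) by blast

section \<open>Divisibility\<close>

definition divides :: "'a \<Rightarrow> 'a \<Rightarrow> bool" where
  "divides a b \<longleftrightarrow> (\<exists>q. b = a \<otimes> q)"

lemma divides_bounded: "divides a b \<longleftrightarrow> (\<exists>q. q \<prec> b \<oplus> \<one> \<and> b = a \<otimes> q)"
proof
  assume "divides a b"
  then obtain q where q: "b = a \<otimes> q" unfolding divides_def by blast
  show "\<exists>q. q \<prec> b \<oplus> \<one> \<and> b = a \<otimes> q"
  proof (cases "a = \<zero>")
    \<comment> \<open>Now \<open>b\<close> is zero and the given quotient may be arbitrarily large,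
      so \<open>\<zero>\<close> takes its place.\<close>
    case True
    then show ?thesis using q by (intro exI[of _ \<zero>]) (simp add: less_succ_iff)
  next
    case False
    then have "\<zero> \<oplus> \<one> \<preceq> a" unfolding succ_le_iff using peano(7) less_linear' by blast
    then have "\<one> \<otimes> q \<preceq> a \<otimes> q" by (intro mult_right_mono) simp_all
    then show ?thesis using q by (auto simp: less_succ_iff)
  qed
qed (auto simp: divides_def)

lemma delta0_divides:
  assumes "term_definable t" "term_definable u"
  shows "delta0 (\<lambda>e. divides (t e) (u e))"
  by (rule delta0_subst2[OF _ assms]) (unfold divides_bounded, intro definable)

lemma divides_mult_left: "divides a b \<Longrightarrow> divides a (b \<otimes> c)"
  unfolding divides_def using mult_assoc' by metis

lemma divides_mult_right: "divides a b \<Longrightarrow> divides a (c \<otimes> b)"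
  using divides_mult_left mult_comm' by metis

lemma divides_add: "divides a b \<Longrightarrow> divides a c \<Longrightarrow> divides a (b \<oplus> c)"
  unfolding divides_def using distrib' by metis

lemma divides_cancel:
  assumes "divides a (b \<oplus> c)" "divides a c"
  shows "divides a b"
proof -
  obtain q r where "b \<oplus> c = a \<otimes> q" "c = a \<otimes> r" using assms unfolding divides_def by blast
  then have "b = a \<otimes> (q \<ominus> r)" by (metis add_diff_cancel_right' right_diff_distrib')
  then show ?thesis unfolding divides_def by blast
qed

lemma divides_self: "divides a a"
  unfolding divides_def by (metis mult_one)

lemma divides_one: "divides a \<one> \<Longrightarrow> a = \<one>"
proof -
  assume "divides a \<one>"
  then obtain q where q: "\<one> = a \<otimes> q" unfolding divides_def by blast
  then have "a \<noteq> \<zero>" "q \<noteq> \<zero>" by (auto simp: one_neq_zero zero_mult peano)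
  then obtain b r where br: "a = b \<oplus> \<one>" "q = r \<oplus> \<one>" using zero_or_succ by metis
  with q have "(b \<otimes> r \<oplus> r \<oplus> b) \<oplus> \<one> = \<zero> \<oplus> \<one>" by (simp add: algebra_simps)
  then have "b \<otimes> r \<oplus> r \<oplus> b = \<zero>" by simp
  then show "a = \<one>" using br add_eq_zero by (metis add_comm' zero_add)
qed

lemma division:
  assumes "b \<noteq> \<zero>"
  obtains q r where "a = b \<otimes> q \<oplus> r" "r \<prec> b"
proof -
  have "\<exists>q. \<exists>r. r \<prec> b \<and> a = b \<otimes> q \<oplus> r"
  proof (rule sigma1_induct[of "\<lambda>q a. \<exists>r. r \<prec> b \<and> a = b \<otimes> q \<oplus> r"])
    show "\<exists>q. \<exists>r. r \<prec> b \<and> \<zero> = b \<otimes> q \<oplus> r"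
      using assms by (intro exI[of _ \<zero>]) (simp add: zero_less_if_neq)
    fix a assume "\<exists>q. \<exists>r. r \<prec> b \<and> a = b \<otimes> q \<oplus> r"
    then obtain q r where qr: "r \<prec> b" "a = b \<otimes> q \<oplus> r" by blast
    show "\<exists>q. \<exists>r. r \<prec> b \<and> a \<oplus> \<one> = b \<otimes> q \<oplus> r"
    proof (cases "r \<oplus> \<one> \<prec> b")
      case True
      then show ?thesis using qr by (intro exI[of _ q] exI[of _ "r \<oplus> \<one>"]) (simp add: ac_simps)
    next
      case False
      then have "r \<oplus> \<one> = b" using qr(1) succ_le_iff le_def by blast
      then show ?thesis using qr assms
        by (intro exI[of _ "q \<oplus> \<one>"] exI[of _ \<zero>]) (auto simp: zero_less_if_neq algebra_simps)
    qed
  qed (intro definable)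
  then show thesis using that by blast
qed

text \<open>The moduli of Goedel's beta function, as they occur in \<open>elems\<close>.\<close>

definition factor :: "'a \<Rightarrow> 'a \<Rightarrow> 'a" where
  "factor m i = m \<otimes> (i \<oplus> \<one>) \<oplus> \<one>"

lemma term_factor:
  assumes "term_definable t" "term_definable u"
  shows "term_definable (\<lambda>e. factor (t e) (u e))"
  unfolding factor_def by (intro definable assms)

lemma factor_neq_one: "m \<noteq> \<zero> \<Longrightarrow> factor m i \<noteq> \<one>"
proof
  assume m: "m \<noteq> \<zero>" and "factor m i = \<one>"
  then have "m \<otimes> (i \<oplus> \<one>) \<oplus> \<one> = \<zero> \<oplus> \<one>" unfolding factor_def by simp
  then have "m \<otimes> (i \<oplus> \<one>) = \<zero>" by simp
  then show False using m peano(1) by simp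
qed

text \<open>The product of \<open>factor m i\<close> with \<open>j \<oplus> \<one>\<close> exceeds
  that of \<open>factor m j\<close> with \<open>i \<oplus> \<one>\<close> by exactly
  \<open>d\<close>. Since \<open>d\<close> divides \<open>m\<close>, \<open>factor m i\<close> is
  \<open>w \<otimes> d \<oplus> \<one>\<close> for a suitable \<open>w\<close>; so \<open>w\<close>
  times this difference gives a Bezout identity, written without subtraction.\<close>

lemma factor_bezout:
  assumes "j = i \<oplus> d" "divides d m"
  obtains x y where "factor m i \<otimes> x \<oplus> \<one> = factor m j \<otimes> y \<oplus> factor m i"
proof -
  obtain t where t: "m = d \<otimes> t" using assms(2) unfolding divides_def by blast
  define w where "w = t \<otimes> (i \<oplus> \<one>)"
  have A: "factor m i = w \<otimes> d \<oplus> \<one>" unfolding factor_def w_def t by (simp add: ac_simps)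
  have "factor m i \<otimes> (w \<otimes> (j \<oplus> \<one>)) = factor m j \<otimes> (w \<otimes> (i \<oplus> \<one>)) \<oplus> w \<otimes> d"
    unfolding factor_def assms(1) by (simp add: algebra_simps)
  then have "factor m i \<otimes> (w \<otimes> (j \<oplus> \<one>)) \<oplus> \<one> = factor m j \<otimes> (w \<otimes> (i \<oplus> \<one>)) \<oplus> (w \<otimes> d \<oplus> \<one>)"
    by (simp add: ac_simps)
  then show thesis using that A by metis
qed

text \<open>The Bezout identity does the work of prime factors: multiplied by \<open>n\<close>, it
  says that \<open>n\<close> plus a multiple of \<open>factor m i\<close> is again a multiple of
  \<open>factor m i\<close>. It is oriented by the order of \<open>i\<close> and \<open>j\<close>,
  hence the two cases.\<close>

lemma factor_coprime:
  assumes "\<And>d. d \<noteq> \<zero> \<Longrightarrow> d \<preceq> k \<Longrightarrow> divides d m" "i \<preceq> k" "j \<preceq> k" "i \<noteq> j"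
    and "divides (factor m i) (n \<otimes> factor m j)"
  shows "divides (factor m i) n"
proof -
  have "i \<prec> j \<or> j \<prec> i" using assms less_linear' by blast
  then show ?thesis
  proof
    assume "i \<prec> j"
    then obtain d where d: "j = i \<oplus> (d \<oplus> \<one>)" unfolding less_iff by (metis add_assoc')
    then have "d \<oplus> \<one> \<preceq> k" using assms(3) le_add_left order_trans by metis
    then have "divides (d \<oplus> \<one>) m" using assms(1) peano(1) by blast
    from factor_bezout[OF d this] obtain x y
      where xy: "factor m i \<otimes> x \<oplus> \<one> = factor m j \<otimes> y \<oplus> factor m i" .
    have "n \<oplus> n \<otimes> (factor m i \<otimes> x) = n \<otimes> factor m j \<otimes> y \<oplus> n \<otimes> factor m i"
      using arg_cong[OF xy, of "\<lambda>z. n \<otimes> z"] by (simp add: algebra_simps)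
    moreover have "divides (factor m i) (n \<otimes> factor m j \<otimes> y \<oplus> n \<otimes> factor m i)"
      by (intro divides_add divides_mult_left[OF assms(5)] divides_mult_right divides_self)
    ultimately show ?thesis
      using divides_cancel divides_mult_right divides_mult_left divides_self by metis
  next
    assume "j \<prec> i"
    then obtain d where d: "i = j \<oplus> (d \<oplus> \<one>)" unfolding less_iff by (metis add_assoc')
    then have "d \<oplus> \<one> \<preceq> k" using assms(2) le_add_left order_trans by metis
    then have "divides (d \<oplus> \<one>) m" using assms(1) peano(1) by blast
    from factor_bezout[OF d this] obtain x y
      where xy: "factor m j \<otimes> x \<oplus> \<one> = factor m i \<otimes> y \<oplus> factor m j" .
    have "n \<oplus> n \<otimes> factor m j \<otimes> x = n \<otimes> (factor m i \<otimes> y) \<oplus> n \<otimes> factor m j"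
      using arg_cong[OF xy, of "\<lambda>z. n \<otimes> z"] by (simp add: algebra_simps)
    moreover have "divides (factor m i) (n \<otimes> (factor m i \<otimes> y) \<oplus> n \<otimes> factor m j)"
      by (intro divides_add assms(5) divides_mult_right divides_mult_left divides_self)
    ultimately show ?thesis
      using divides_cancel divides_mult_left[OF assms(5)] by metis
  qed
qed

text \<open>The induction multiplies by the next number, so its witness plays the part of a
  factorial, which is no term of the language.\<close>

lemma common_multiple: "\<exists>m. m \<noteq> \<zero> \<and> (\<forall>d. d \<prec> k \<longrightarrow> divides (d \<oplus> \<one>) m)"
proof (rule sigma1_induct[of "\<lambda>m k. m \<noteq> \<zero> \<and> (\<forall>d. d \<prec> k \<longrightarrow> divides (d \<oplus> \<one>) m)"])
  show "\<exists>m. m \<noteq> \<zero> \<and> (\<forall>d. d \<prec> \<zero> \<longrightarrow> divides (d \<oplus> \<one>) m)" using one_neq_zero peano(7) by blast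
  fix k assume "\<exists>m. m \<noteq> \<zero> \<and> (\<forall>d. d \<prec> k \<longrightarrow> divides (d \<oplus> \<one>) m)"
  then obtain m where "m \<noteq> \<zero>" "\<forall>d. d \<prec> k \<longrightarrow> divides (d \<oplus> \<one>) m" by blast
  then have "m \<otimes> (k \<oplus> \<one>) \<noteq> \<zero> \<and> (\<forall>d. d \<prec> k \<oplus> \<one> \<longrightarrow> divides (d \<oplus> \<one>) (m \<otimes> (k \<oplus> \<one>)))"
    using divides_mult_left divides_mult_right divides_self peano(1,8) by auto
  then show "\<exists>m. m \<noteq> \<zero> \<and> (\<forall>d. d \<prec> k \<oplus> \<one> \<longrightarrow> divides (d \<oplus> \<one>) m)" by blast
qed (intro definable delta0_divides)

text \<open>The witness is the product of the factors that belong to members of \<open>X\<close>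
  below \<open>k\<close>, extended one \<open>j\<close> at a time. \<open>factor_coprime\<close>
  prevents a new factor from making another one a divisor, and no factor divides the initial
  \<open>\<one>\<close>.\<close>

lemma beta_coding:
  assumes m: "m \<noteq> \<zero>" "\<forall>d. d \<prec> k \<longrightarrow> divides (d \<oplus> \<one>) m" and X: "X \<in> Sets M"
  shows "\<exists>n. n \<noteq> \<zero> \<and> (\<forall>i. i \<prec> k \<longrightarrow> (divides (factor m i) n \<longleftrightarrow> i \<in> X))"
proof -
  have cop: "divides (factor m i) (n \<otimes> factor m j) \<Longrightarrow> i \<noteq> j \<Longrightarrow> i \<prec> k \<Longrightarrow> j \<prec> k \<Longrightarrow> divides (factor m i) n"
    for i j n
  proof (rule factor_coprime[of k m i j n])
    fix d assume "d \<noteq> \<zero>" "d \<preceq> k"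
    moreover from this obtain p where "d = p \<oplus> \<one>" using zero_or_succ by blast
    ultimately show "divides d m" using m(2) by (simp add: succ_le_iff)
  qed (simp_all add: le_def)
  have "\<exists>n. n \<noteq> \<zero> \<and> (\<forall>i. i \<prec> k \<longrightarrow> (divides (factor m i) n \<longleftrightarrow> i \<prec> j \<and> i \<in> X))" for j
  proof (rule sigma1_induct[of "\<lambda>n j. n \<noteq> \<zero> \<and> (\<forall>i. i \<prec> k \<longrightarrow> (divides (factor m i) n \<longleftrightarrow> i \<prec> j \<and> i \<in> X))"])
    show "\<exists>n. n \<noteq> \<zero> \<and> (\<forall>i. i \<prec> k \<longrightarrow> (divides (factor m i) n \<longleftrightarrow> i \<prec> \<zero> \<and> i \<in> X))"
      using one_neq_zero peano(7) divides_one factor_neq_one[OF m(1)] by (intro exI[of _ \<one>]) blast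
    fix j assume "\<exists>n. n \<noteq> \<zero> \<and> (\<forall>i. i \<prec> k \<longrightarrow> (divides (factor m i) n \<longleftrightarrow> i \<prec> j \<and> i \<in> X))"
    then obtain n where n: "n \<noteq> \<zero>" "\<And>i. i \<prec> k \<Longrightarrow> divides (factor m i) n \<longleftrightarrow> i \<prec> j \<and> i \<in> X" by blast
    show "\<exists>n. n \<noteq> \<zero> \<and> (\<forall>i. i \<prec> k \<longrightarrow> (divides (factor m i) n \<longleftrightarrow> i \<prec> j \<oplus> \<one> \<and> i \<in> X))"
    proof (cases "j \<prec> k \<and> j \<in> X")
      case True
      have "divides (factor m i) (n \<otimes> factor m j) \<longleftrightarrow> i \<prec> j \<oplus> \<one> \<and> i \<in> X" if "i \<prec> k" for i
      proof (cases "i = j")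
        case i: True
        then show ?thesis using True by (simp add: divides_mult_right divides_self peano(8))
      next
        case False
        then show ?thesis
          using cop[of i n j] divides_mult_left n(2)[OF that] that True peano(8) by blast
      qed
      moreover have "n \<otimes> factor m j \<noteq> \<zero>" using n(1) peano(1) by (simp add: factor_def)
      ultimately show ?thesis by blast
    next
      case False
      then have "i \<prec> j \<oplus> \<one> \<and> i \<in> X \<longleftrightarrow> i \<prec> j \<and> i \<in> X" if "i \<prec> k" for i
        using that peano(8) by blast
      then show ?thesis using n by blast
    qed
  qed (intro definable delta0_divides term_factor X)
  from this[of k] show ?thesis by auto
qed

section \<open>Codes of finite sets\<close>

lemma elems_pair: "elems M (pair M k (pair M m n)) = {i. i \<prec> k \<and> divides (factor m i) n}"
  unfolding elems_def divides_def factor_def by auto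

text \<open>The inner pair gets a quantified variable \<open>a\<close> of its own, so that every
  quantifier is bounded by a term.\<close>

lemma ex_triple_bounded:
  "(\<exists>k m n. c = pair M k (pair M m n) \<and> P k m n) \<longleftrightarrow>
   (\<exists>k. k \<prec> c \<oplus> \<one> \<and> (\<exists>a. a \<prec> c \<oplus> \<one> \<and> (\<exists>m. m \<prec> a \<oplus> \<one> \<and> (\<exists>n. n \<prec> a \<oplus> \<one> \<and>
     a = pair M m n \<and> c = pair M k a \<and> P k m n))))" (is "?l \<longleftrightarrow> ?r")
proof
  assume ?l
  then obtain k m n where c: "c = pair M k (pair M m n)" "P k m n" by blast
  define a where "a = pair M m n"
  have "k \<prec> c \<oplus> \<one>" "a \<prec> c \<oplus> \<one>" "m \<prec> a \<oplus> \<one>" "n \<prec> a \<oplus> \<one>" "c = pair M k a"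
    using less_pair_succ1 less_pair_succ2 c a_def by simp_all
  then show ?r using c(2) a_def by blast
next
  assume ?r then show ?l by (elim exE conjE) blast
qed

lemma mem_elems_iff:
  "i \<in> elems M c \<longleftrightarrow> (\<exists>k. k \<prec> c \<oplus> \<one> \<and> (\<exists>a. a \<prec> c \<oplus> \<one> \<and> (\<exists>m. m \<prec> a \<oplus> \<one> \<and> (\<exists>n. n \<prec> a \<oplus> \<one> \<and>
     a = pair M m n \<and> c = pair M k a \<and> i \<prec> k \<and> divides (factor m i) n))))"
  unfolding ex_triple_bounded[symmetric] by (simp add: elems_def divides_def factor_def)

text \<open>The trivial conjunct makes this an instance of \<open>ex_triple_bounded\<close>.\<close>

lemma is_triple_iff:
  "is_triple M c \<longleftrightarrow> (\<exists>k. k \<prec> c \<oplus> \<one> \<and> (\<exists>a. a \<prec> c \<oplus> \<one> \<and> (\<exists>m. m \<prec> a \<oplus> \<one> \<and> (\<exists>n. n \<prec> a \<oplus> \<one> \<and>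
     a = pair M m n \<and> c = pair M k a \<and> \<zero> = \<zero>))))"
  unfolding ex_triple_bounded[symmetric] by (simp add: is_triple_def)

lemma delta0_mem_elems:
  assumes "term_definable t" "term_definable u"
  shows "delta0 (\<lambda>e. t e \<in> elems M (u e))"
  by (rule delta0_subst2[OF _ assms]) (unfold mem_elems_iff, intro definable delta0_divides term_factor)

lemma delta0_is_triple:
  assumes "term_definable t"
  shows "delta0 (\<lambda>e. is_triple M (t e))"
  by (rule delta0_subst[OF _ assms]) (unfold is_triple_iff, intro definable)

lemma elems_less: "i \<in> elems M c \<Longrightarrow> i \<prec> c"
proof -
  assume "i \<in> elems M c"
  then obtain k m n where "c = pair M k (pair M m n)" "i \<prec> k" unfolding elems_def by blast
  then show ?thesis using le_pair1 less_le_trans by blast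
qed

lemma elems_in_Sets: "elems M c \<in> Sets M"
proof -
  have "{i. i \<in> elems M c} \<in> Sets M"
    by (rule delta0_comprehension) (intro delta0_mem_elems definable)
  then show ?thesis by simp
qed

lemma elems_subset_iff: "elems M c \<subseteq> elems M d \<longleftrightarrow> (\<forall>i. i \<prec> c \<longrightarrow> i \<in> elems M c \<longrightarrow> i \<in> elems M d)"
  using elems_less by blast

lemma delta0_elems_subset:
  assumes "term_definable t" "term_definable u"
  shows "delta0 (\<lambda>e. elems M (t e) \<subseteq> elems M (u e))"
  by (rule delta0_subst2[OF _ assms]) (unfold elems_subset_iff, intro definable delta0_mem_elems)

lemma is_code_iff:
  "is_code M c \<longleftrightarrow> is_triple M c \<and> (\<forall>d. d \<prec> c \<longrightarrow> \<not> (is_triple M d \<and> elems M d \<subseteq> elems M c \<and> elems M c \<subseteq> elems M d))"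
  unfolding is_code_def by blast

lemma delta0_is_code:
  assumes "term_definable t"
  shows "delta0 (\<lambda>e. is_code M (t e))"
  by (rule delta0_subst[OF _ assms])
    (unfold is_code_iff, intro definable delta0_elems_subset delta0_is_triple)

lemma binary_seq_iff:
  "binary_seq M s l \<longleftrightarrow> is_code M s \<and>
     (\<forall>p. p \<prec> s \<longrightarrow> p \<in> elems M s \<longrightarrow> (\<exists>i. i \<prec> l \<and> (\<exists>v. v \<prec> p \<oplus> \<one> \<and> (v = \<zero> \<or> v = \<one>) \<and> p = pair M i v))) \<and>
     (\<forall>i. i \<prec> l \<longrightarrow> (\<exists>v. v \<prec> s \<and> pair M i v \<in> elems M s \<and> (\<forall>w. w \<prec> s \<longrightarrow> pair M i w \<in> elems M s \<longrightarrow> w = v)))"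
proof -
  have 1: "v \<prec> s" if "pair M i v \<in> elems M s" for i v
    using elems_less[OF that] le_pair2 le_less_trans by blast
  have "(\<exists>!v. pair M i v \<in> elems M s) \<longleftrightarrow>
    (\<exists>v. v \<prec> s \<and> pair M i v \<in> elems M s \<and> (\<forall>w. w \<prec> s \<longrightarrow> pair M i w \<in> elems M s \<longrightarrow> w = v))" for i
    using 1 by blast
  moreover have "(\<forall>p\<in>elems M s. \<exists>i v. i \<prec> l \<and> (v = \<zero> \<or> v = \<one>) \<and> p = pair M i v) \<longleftrightarrow>
    (\<forall>p. p \<prec> s \<longrightarrow> p \<in> elems M s \<longrightarrow> (\<exists>i. i \<prec> l \<and> (\<exists>v. v \<prec> p \<oplus> \<one> \<and> (v = \<zero> \<or> v = \<one>) \<and> p = pair M i v)))"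
    using elems_less less_pair_succ2 by blast
  ultimately show ?thesis unfolding binary_seq_def by simp
qed

lemma delta0_binary_seq:
  assumes "term_definable t" "term_definable u"
  shows "delta0 (\<lambda>e. binary_seq M (t e) (u e))"
  by (rule delta0_subst2[OF _ assms])
    (unfold binary_seq_iff, intro definable delta0_mem_elems delta0_is_code)

text \<open>
  Whether \<open>n\<close> is divisible by the factors depends only on \<open>n\<close> modulo a common multiple of them. This
  bounds the codes of all subsets of \<open>below M k\<close> at once.
\<close>

definition code_bound :: "'a \<Rightarrow> 'a \<Rightarrow> bool" where
  "code_bound k B \<longleftrightarrow> (\<exists>m. m \<prec> B \<oplus> \<one> \<and> (\<exists>n. n \<prec> B \<oplus> \<one> \<and> B = pair M k (pair M m n) \<and> m \<noteq> \<zero> \<and> n \<noteq> \<zero> \<and>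
     (\<forall>d. d \<prec> k \<longrightarrow> divides (d \<oplus> \<one>) m) \<and> (\<forall>i. i \<prec> k \<longrightarrow> divides (factor m i) n)))"

lemma delta0_code_bound:
  assumes "term_definable t" "term_definable u"
  shows "delta0 (\<lambda>e. code_bound (t e) (u e))"
  by (rule delta0_subst2[OF _ assms])
    (unfold code_bound_def, intro definable delta0_divides term_factor)

lemma UNIV_in_Sets: "UNIV \<in> Sets M"
proof -
  have "{a. a = a} \<in> Sets M" by (rule delta0_comprehension) (intro definable)
  then show ?thesis by simp
qed

lemma code_bound_exists: "\<exists>B. code_bound k B"
proof -
  obtain m where m: "m \<noteq> \<zero>" "\<forall>d. d \<prec> k \<longrightarrow> divides (d \<oplus> \<one>) m" using common_multiple by blast
  \<comment> \<open>Coding the full set yields a common multiple of all the factors.\<close>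
  from beta_coding[OF m UNIV_in_Sets] obtain n where
    n: "n \<noteq> \<zero>" "\<forall>i. i \<prec> k \<longrightarrow> divides (factor m i) n" by blast
  have "m \<preceq> pair M k (pair M m n)" "n \<preceq> pair M k (pair M m n)"
    using le_pair1 le_pair2 order_trans by blast+
  with m n show ?thesis unfolding code_bound_def less_succ_iff by blast
qed

lemma code_bound_triple:
  assumes "code_bound k B" "X \<in> Sets M" "X \<subseteq> below M k"
  obtains d where "is_triple M d" "elems M d = X" "d \<prec> B"
proof -
  obtain m N where B: "B = pair M k (pair M m N)" "m \<noteq> \<zero>" "N \<noteq> \<zero>"
    "\<forall>d. d \<prec> k \<longrightarrow> divides (d \<oplus> \<one>) m" "\<forall>i. i \<prec> k \<longrightarrow> divides (factor m i) N"
    using assms(1) unfolding code_bound_def by blast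
  from beta_coding[OF B(2,4) assms(2)] obtain n where
    n: "\<forall>i. i \<prec> k \<longrightarrow> (divides (factor m i) n \<longleftrightarrow> i \<in> X)" by blast
  obtain q r where qr: "n = N \<otimes> q \<oplus> r" "r \<prec> N" using division[OF B(3)] by blast
  have "divides (factor m i) r \<longleftrightarrow> i \<in> X" if "i \<prec> k" for i
  proof -
    have "divides (factor m i) (N \<otimes> q)" using B(5) that divides_mult_left by blast
    then have "divides (factor m i) r \<longleftrightarrow> divides (factor m i) n"
      unfolding qr using divides_add divides_cancel add_comm' by metis
    then show ?thesis using n that by blast
  qed
  then have "elems M (pair M k (pair M m r)) = X"
    using assms(3) unfolding elems_pair below_def by blast
  moreover have "is_triple M (pair M k (pair M m r))" unfolding is_triple_def by blast
  moreover have "pair M k (pair M m r) \<prec> B" unfolding B(1) by (intro pair_less2 qr)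
  ultimately show thesis using that by blast
qed

text \<open>A code is the least triple for its set, hence not above the triple found below
  \<open>B\<close>.\<close>

lemma code_less_bound:
  assumes "is_code M c" "elems M c \<subseteq> below M k" "code_bound k B"
  shows "c \<prec> B"
proof -
  from code_bound_triple[OF assms(3) elems_in_Sets assms(2)] obtain d
    where d: "is_triple M d" "elems M d = elems M c" "d \<prec> B" .
  then have "\<not> d \<prec> c" using assms(1) unfolding is_code_def by blast
  then show ?thesis using d(3) by (simp add: not_less)
qed

lemma code_exists:
  assumes "X \<in> Sets M" "X \<subseteq> below M k"
  obtains c where "is_code M c" "elems M c = X"
proof -
  obtain B where "code_bound k B" using code_bound_exists by blast
  from code_bound_triple[OF this assms] obtain d where d: "is_triple M d" "elems M d = X" .
  define P where "P = (\<lambda>c. is_triple M c \<and> elems M c \<subseteq> elems M d \<and> elems M d \<subseteq> elems M c)"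
  have "delta0 (\<lambda>e. P (e 0))" unfolding P_def
    by (intro definable delta0_is_triple delta0_elems_subset)
  moreover have "P d" using d P_def by simp
  ultimately obtain c where c: "P c" "\<forall>b. b \<prec> c \<longrightarrow> \<not> P b" using least_number[of P d] by blast
  have "elems M c = X" using d c(1) unfolding P_def by blast
  moreover have "\<not> b \<prec> c" if "is_triple M b" "elems M b = elems M c" for b
    using c that unfolding P_def by auto
  then have "is_code M c" using c(1) unfolding is_code_def P_def by blast
  ultimately show thesis using that by blast
qed

lemma code_eqI: "is_code M c \<Longrightarrow> is_code M d \<Longrightarrow> elems M c = elems M d \<Longrightarrow> c = d"
  unfolding is_code_def using less_linear' by metis

section \<open>Codes of 0-1 sequences\<close>

lemma binary_seqD:
  assumes "binary_seq M s l"
  shows "is_code M s"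
    "p \<in> elems M s \<Longrightarrow> \<exists>i v. i \<prec> l \<and> (v = \<zero> \<or> v = \<one>) \<and> p = pair M i v"
    "i \<prec> l \<Longrightarrow> \<exists>v. (v = \<zero> \<or> v = \<one>) \<and> pair M i v \<in> elems M s"
    "pair M i v \<in> elems M s \<Longrightarrow> i \<prec> l"
    "pair M i v \<in> elems M s \<Longrightarrow> v = \<zero> \<or> v = \<one>"
    "pair M i v \<in> elems M s \<Longrightarrow> pair M i w \<in> elems M s \<Longrightarrow> v = w"
proof -
  note D = assms[unfolded binary_seq_def]
  show "is_code M s" using D by (rule conjunct1)
  have D2: "\<forall>p\<in>elems M s. \<exists>i v. i \<prec> l \<and> (v = \<zero> \<or> v = \<one>) \<and> p = pair M i v"
    and D3: "\<forall>i. i \<prec> l \<longrightarrow> (\<exists>!v. pair M i v \<in> elems M s)" using D by simp_all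
  show 2: "p \<in> elems M s \<Longrightarrow> \<exists>i v. i \<prec> l \<and> (v = \<zero> \<or> v = \<one>) \<and> p = pair M i v" for p
    using D2 by (rule bspec)
  show 4: "pair M i v \<in> elems M s \<Longrightarrow> i \<prec> l" for i v using 2[of "pair M i v"] by auto
  show 5: "pair M i v \<in> elems M s \<Longrightarrow> v = \<zero> \<or> v = \<one>" for i v using 2[of "pair M i v"] by auto
  show "i \<prec> l \<Longrightarrow> \<exists>v. (v = \<zero> \<or> v = \<one>) \<and> pair M i v \<in> elems M s" for i
    using D3 5 by (metis ex1_implies_ex)
  show "pair M i v \<in> elems M s \<Longrightarrow> pair M i w \<in> elems M s \<Longrightarrow> v = w" for i v w
    using D3 4 by metis
qed

lemma pair_bit_less:
  assumes "i \<preceq> l" "v = \<zero> \<or> v = \<one>"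
  shows "pair M i v \<prec> pair M l \<one> \<oplus> \<one>"
proof -
  have "v \<preceq> \<one>" using assms(2) zero_le_all order_refl by metis
  then show ?thesis unfolding less_succ_iff by (rule pair_mono[OF assms(1)])
qed

lemma binary_seq_exists:
  assumes "X \<in> Sets M"
    and "\<And>p. p \<in> X \<Longrightarrow> \<exists>i v. i \<prec> l \<and> (v = \<zero> \<or> v = \<one>) \<and> p = pair M i v"
    and "\<And>i. i \<prec> l \<Longrightarrow> \<exists>v. pair M i v \<in> X"
    and "\<And>i v w. pair M i v \<in> X \<Longrightarrow> pair M i w \<in> X \<Longrightarrow> v = w"
  obtains s where "binary_seq M s l" "elems M s = X"
proof -
  have "X \<subseteq> below M (pair M l \<one> \<oplus> \<one>)"
  proof
    fix p assume "p \<in> X"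
    then obtain i v where "i \<prec> l" "v = \<zero> \<or> v = \<one>" "p = pair M i v" using assms(2) by blast
    then show "p \<in> below M (pair M l \<one> \<oplus> \<one>)"
      unfolding below_def using pair_bit_less less_imp_le by simp
  qed
  from code_exists[OF assms(1) this] obtain s where s: "is_code M s" "elems M s = X" .
  then have "binary_seq M s l" unfolding binary_seq_def using assms(2-4) by auto
  then show thesis using s that by blast
qed

text \<open>The graph of a 0-1 sequence of length at most \<open>l\<close> lies below
  \<open>pair M l \<one> \<oplus> \<one>\<close>. Once such a \<open>B\<close> is given as a number,
  quantifiers over all these sequences are bounded.\<close>

definition seq_bound :: "'a \<Rightarrow> 'a \<Rightarrow> bool" where
  "seq_bound l B \<longleftrightarrow> code_bound (pair M l \<one> \<oplus> \<one>) B"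

lemma delta0_seq_bound:
  assumes "term_definable t" "term_definable u"
  shows "delta0 (\<lambda>e. seq_bound (t e) (u e))"
  unfolding seq_bound_def by (intro delta0_code_bound definable assms)

lemma binary_seq_less:
  assumes "binary_seq M s l'" "l' \<preceq> l" "seq_bound l B"
  shows "s \<prec> B"
proof (rule code_less_bound)
  show "is_code M s" using binary_seqD(1) assms(1) .
  show "code_bound (pair M l \<one> \<oplus> \<one>) B" using assms(3) seq_bound_def by simp
  show "elems M s \<subseteq> below M (pair M l \<one> \<oplus> \<one>)"
  proof
    fix p assume "p \<in> elems M s"
    then obtain i v where "i \<prec> l'" "v = \<zero> \<or> v = \<one>" "p = pair M i v"
      using binary_seqD(2)[OF assms(1)] by blast
    moreover from this have "i \<preceq> l" using assms(2) by (simp add: less_le_trans less_imp_le)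
    ultimately show "p \<in> below M (pair M l \<one> \<oplus> \<one>)"
      unfolding below_def using pair_bit_less by simp
  qed
qed

text \<open>In a sequence longer than its code \<open>s\<close>, the entry at position
  \<open>s\<close> would be a pair no smaller than \<open>s\<close>, yet elements lie below their
  code. So the code bounds quantifiers over the length, and long nodes of a tree have large
  codes.\<close>

lemma binary_seq_length_le: "binary_seq M s l \<Longrightarrow> l \<preceq> s"
proof (rule ccontr)
  assume s: "binary_seq M s l" and "\<not> l \<preceq> s"
  then have "s \<prec> l" by (simp add: not_le)
  then obtain v where "pair M s v \<in> elems M s" using binary_seqD(3)[OF s] by blast
  then have "pair M s v \<prec> s" using elems_less by blast
  then show False using le_pair1[of s v] by (simp add: not_le[symmetric])
qed

lemma binary_seq_restrict:
  assumes "binary_seq M s l" "l' \<preceq> l"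
  obtains t where "binary_seq M t l'" "elems M t \<subseteq> elems M s"
proof -
  define X where "X = {p. p \<in> elems M s \<and> (\<exists>i. i \<prec> l' \<and> (\<exists>v. v \<prec> p \<oplus> \<one> \<and> p = pair M i v))}"
  have X: "X \<in> Sets M" unfolding X_def
    by (rule delta0_comprehension) (intro definable delta0_mem_elems)
  have iff: "pair M i v \<in> X \<longleftrightarrow> pair M i v \<in> elems M s \<and> i \<prec> l'" for i v
    unfolding X_def using less_pair_succ2 by auto
  from X obtain t where "binary_seq M t l'" "elems M t = X"
  proof (rule binary_seq_exists)
    fix p assume "p \<in> X"
    then obtain i v where p: "p = pair M i v" "i \<prec> l'" "p \<in> elems M s" unfolding X_def by blast
    then show "\<exists>i v. i \<prec> l' \<and> (v = \<zero> \<or> v = \<one>) \<and> p = pair M i v"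
      using binary_seqD(5)[OF assms(1)] by blast
  next
    fix i assume "i \<prec> l'"
    then show "\<exists>v. pair M i v \<in> X" using iff binary_seqD(3)[OF assms(1), of i] assms(2) less_le_trans by blast
  next
    fix i v w assume "pair M i v \<in> X" "pair M i w \<in> X"
    then show "v = w" using iff binary_seqD(6)[OF assms(1)] by blast
  qed
  then show thesis using that unfolding X_def by blast
qed

lemma binary_seq_extend:
  assumes "binary_seq M s l" "v = \<zero> \<or> v = \<one>"
  obtains t where "binary_seq M t (l \<oplus> \<one>)" "elems M t = insert (pair M l v) (elems M s)"
proof -
  define X where "X = {p. p \<in> elems M s \<or> p = pair M l v}"
  have X: "X \<in> Sets M" unfolding X_def
    by (rule delta0_comprehension) (intro definable delta0_mem_elems)
  have X': "X = insert (pair M l v) (elems M s)" unfolding X_def by blast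
  have nl: "pair M l w \<notin> elems M s" for w using binary_seqD(4)[OF assms(1)] by blast
  from X obtain t where "binary_seq M t (l \<oplus> \<one>)" "elems M t = X"
  proof (rule binary_seq_exists)
    fix p assume "p \<in> X"
    then show "\<exists>i v. i \<prec> l \<oplus> \<one> \<and> (v = \<zero> \<or> v = \<one>) \<and> p = pair M i v"
      using binary_seqD(2)[OF assms(1), of p] assms(2) unfolding X' peano(8) by blast
  next
    fix i assume "i \<prec> l \<oplus> \<one>"
    then show "\<exists>v. pair M i v \<in> X" using binary_seqD(3)[OF assms(1), of i] unfolding X' peano(8) by blast
  next
    fix i v w assume "pair M i v \<in> X" "pair M i w \<in> X"
    then show "v = w" using nl binary_seqD(6)[OF assms(1), of i v w] unfolding X' by auto
  qed
  then show thesis using that X' by blast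
qed

text \<open>Two initial segments of one functional relation \<open>Y\<close> can differ in length
  only. \<open>Y\<close> may be a longer sequence or a path.\<close>

lemma binary_seq_subset_mono:
  assumes "binary_seq M s l" "binary_seq M t l'" "l \<preceq> l'" "elems M s \<subseteq> Y" "elems M t \<subseteq> Y"
    and Y: "\<And>i v w. pair M i v \<in> Y \<Longrightarrow> pair M i w \<in> Y \<Longrightarrow> v = w"
  shows "elems M s \<subseteq> elems M t"
proof
  fix p assume p: "p \<in> elems M s"
  then obtain i v where iv: "p = pair M i v" "i \<prec> l" using binary_seqD(2)[OF assms(1)] by blast
  then obtain w where "pair M i w \<in> elems M t"
    using binary_seqD(3)[OF assms(2), of i] less_le_trans assms(3) by blast
  moreover from this have "v = w" using Y[of i v w] p iv assms(4,5) by blast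
  ultimately show "p \<in> elems M t" using iv by simp
qed

lemma binary_seq_unique:
  assumes "binary_seq M s l" "binary_seq M t l" "elems M s \<subseteq> elems M t"
  shows "s = t"
proof -
  have "elems M t \<subseteq> elems M s"
    by (rule binary_seq_subset_mono[OF assms(2,1) order_refl _ assms(3)])
      (simp, rule binary_seqD(6)[OF assms(2)])
  then show ?thesis using code_eqI binary_seqD(1) assms by blast
qed

section \<open>Colorings from paths\<close>

text \<open>No nonstandard number lies below a standard numeral. Colors therefore form a genuinely
  finite set, and pigeonhole arguments can use \<open>card\<close>.\<close>

lemma below_num: "below M (num M n) = num M ` {..<n}"
proof (induction n)
  case 0
  then show ?case unfolding below_def using peano(7) by simp
next
  case (Suc n)
  have "below M (num M (Suc n)) = insert (num M n) (below M (num M n))"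
    unfolding below_def by (auto simp: peano(8))
  then show ?case using Suc by (simp add: lessThan_Suc)
qed

lemma num_strict_mono: "i < j \<Longrightarrow> num M i \<prec> num M j"
proof -
  assume "i < j"
  then have "num M i \<in> below M (num M j)" unfolding below_num by simp
  then show ?thesis unfolding below_def by simp
qed

lemma inj_num: "inj (num M)"
  by (rule injI) (metis num_strict_mono less_irrefl' nat_neq_iff)

lemma card_below_num: "card (below M (num M n)) = n" and finite_below_num: "finite (below M (num M n))"
  unfolding below_num using card_image[of "num M" "{..<n}"] inj_num by (auto intro: inj_on_subset)

section \<open>Colorings and partial colorings\<close>

lemma is_coloringD:
  assumes "is_coloring M k V E C"
  shows "C \<in> Sets M" "pair M x u \<in> C \<Longrightarrow> x \<in> V" "pair M x u \<in> C \<Longrightarrow> u \<prec> num M k"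
    "x \<in> V \<Longrightarrow> \<exists>u. pair M x u \<in> C"
    "pair M x u \<in> C \<Longrightarrow> pair M x v \<in> C \<Longrightarrow> u = v"
    "pair M x y \<in> E \<Longrightarrow> pair M x u \<in> C \<Longrightarrow> pair M y v \<in> C \<Longrightarrow> u \<noteq> v"
proof -
  note D = assms[unfolded is_coloring_def is_function_def]
  show "C \<in> Sets M" using D by simp
  have D2: "\<forall>p\<in>C. \<exists>x\<in>V. \<exists>y\<in>below M (num M k). p = pair M x y"
    and D3: "\<forall>x\<in>V. \<exists>!y. pair M x y \<in> C" using D by simp_all
  show 1: "x \<in> V" if "pair M x u \<in> C" for x u using bspec[OF D2 that] by auto
  show "u \<prec> num M k" if "pair M x u \<in> C" for x u using bspec[OF D2 that] by (auto simp: below_def)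
  show "\<exists>u. pair M x u \<in> C" if "x \<in> V" for x using D3 that by blast
  show "u = v" if "pair M x u \<in> C" "pair M x v \<in> C" for x u v using D3 1 that by blast
  show "u \<noteq> v" if "pair M x y \<in> E" "pair M x u \<in> C" "pair M y v \<in> C" for x y u v using D that by blast
qed

lemma chromatic_mono:
  assumes "chromatic M m V E" "m \<le> n"
  shows "chromatic M n V E"
proof -
  obtain C where "is_coloring M m V E C" using assms(1) unfolding chromatic_def by blast
  moreover have "below M (num M m) \<subseteq> below M (num M n)"
    unfolding below_num using assms(2) by auto
  ultimately have "is_coloring M n V E C" unfolding is_coloring_def is_function_def by blast
  then show ?thesis unfolding chromatic_def by blast
qed

text \<open>
  The bit at position \<open>pair M v c\<close> says whether \<open>v\<close> may have the color \<open>c\<close>. Several colors may be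
  allowed; the coloring read off a path takes the least one.
\<close>

definition partial_coloring :: "'a \<Rightarrow> 'a set \<Rightarrow> 'a set \<Rightarrow> 'a \<Rightarrow> 'a \<Rightarrow> bool" where
  "partial_coloring K V E s l \<longleftrightarrow>
     (\<forall>v. v \<prec> l \<longrightarrow> v \<in> V \<longrightarrow> pair M v K \<prec> l \<longrightarrow> (\<exists>c. c \<prec> K \<and> pair M (pair M v c) \<one> \<in> elems M s)) \<and>
     (\<forall>x. x \<prec> s \<longrightarrow> (\<forall>y. y \<prec> s \<longrightarrow> (\<forall>c. c \<prec> s \<longrightarrow> pair M x y \<in> E \<longrightarrow>
       \<not> (pair M (pair M x c) \<one> \<in> elems M s \<and> pair M (pair M y c) \<one> \<in> elems M s))))"

text \<open>A vertex must have a color as soon as \<open>pair M v K\<close> lies below the length,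
  and then all positions for its colors do. The bounded quantifiers over \<open>x\<close>,
  \<open>y\<close> and \<open>c\<close> amount to unbounded ones, since these numbers lie below
  \<open>s\<close> whenever their pairs occur in it.\<close>

lemma partial_coloring_iff:
  "partial_coloring K V E s l \<longleftrightarrow>
     (\<forall>v. v \<in> V \<longrightarrow> pair M v K \<prec> l \<longrightarrow> (\<exists>c. c \<prec> K \<and> pair M (pair M v c) \<one> \<in> elems M s)) \<and>
     (\<forall>x y c. pair M x y \<in> E \<longrightarrow> pair M (pair M x c) \<one> \<in> elems M s \<longrightarrow> pair M (pair M y c) \<one> \<notin> elems M s)"
proof -
  have 1: "pair M v K \<prec> l \<Longrightarrow> v \<prec> l" for v using le_pair1 le_less_trans by blast
  have 2: "x \<prec> s \<and> c \<prec> s" if "pair M (pair M x c) w \<in> elems M s" for x c w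
    using elems_less[OF that] le_pair1 le_pair2 le_less_trans by metis
  show ?thesis unfolding partial_coloring_def using 1 2 by meson
qed

section \<open>The tree of partial colorings\<close>

definition coloring_tree :: "'a \<Rightarrow> 'a set \<Rightarrow> 'a set \<Rightarrow> 'a set" where
  "coloring_tree K V E = {s. \<exists>l. l \<prec> s \<oplus> \<one> \<and> binary_seq M s l \<and> partial_coloring K V E s l}"

lemma coloring_tree_iff:
  "s \<in> coloring_tree K V E \<longleftrightarrow> (\<exists>l. binary_seq M s l \<and> partial_coloring K V E s l)"
  unfolding coloring_tree_def using binary_seq_length_le less_succ_iff by auto

lemma coloring_tree_in_Sets:
  assumes "V \<in> Sets M" "E \<in> Sets M"
  shows "coloring_tree K V E \<in> Sets M"
  unfolding coloring_tree_def partial_coloring_def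
  by (rule delta0_comprehension) (intro definable delta0_binary_seq delta0_mem_elems assms)

lemma binary_seq_length_mono:
  assumes "binary_seq M t l" "binary_seq M s l'" "elems M t \<subseteq> elems M s"
  shows "l \<preceq> l'"
proof (rule ccontr)
  assume "\<not> l \<preceq> l'"
  then have "l' \<prec> l" by (simp add: not_le)
  then obtain v where "pair M l' v \<in> elems M t" using binary_seqD(3)[OF assms(1)] by blast
  then have "pair M l' v \<in> elems M s" using assms(3) by blast
  then have "l' \<prec> l'" by (rule binary_seqD(4)[OF assms(2)])
  then show False using less_irrefl' by blast
qed

text \<open>If \<open>t\<close> must color \<open>v\<close>, its length exceeds
  \<open>pair M v K\<close> and hence the position of the color that \<open>s\<close> gives to
  \<open>v\<close>. So \<open>t\<close> has an entry there, and as a part of \<open>s\<close> it has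
  the same one.\<close>

lemma binary_tree_coloring_tree:
  assumes "V \<in> Sets M" "E \<in> Sets M"
  shows "binary_tree M (coloring_tree K V E)"
  unfolding binary_tree_def
proof (intro conjI ballI allI impI)
  show "coloring_tree K V E \<in> Sets M" by (rule coloring_tree_in_Sets[OF assms])
  fix s assume s: "s \<in> coloring_tree K V E"
  then obtain l where l: "binary_seq M s l" "partial_coloring K V E s l" unfolding coloring_tree_iff by blast
  then show "\<exists>l. binary_seq M s l" by blast
  fix t l' assume t: "binary_seq M t l' \<and> elems M t \<subseteq> elems M s"
  have le: "l' \<preceq> l" using binary_seq_length_mono t l(1) by blast
  note pc = l(2)[unfolded partial_coloring_iff]
  have "\<exists>c. c \<prec> K \<and> pair M (pair M v c) \<one> \<in> elems M t" if v: "v \<in> V" "pair M v K \<prec> l'" for v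
  proof -
    have "pair M v K \<prec> l" using v(2) le less_le_trans by blast
    then obtain c where c: "c \<prec> K" "pair M (pair M v c) \<one> \<in> elems M s" using pc v(1) by blast
    have "pair M v c \<prec> l'" using pair_less2[OF c(1)] v(2) less_trans' by blast
    then obtain w where w: "pair M (pair M v c) w \<in> elems M t"
      using binary_seqD(3) t by blast
    then have "w = \<one>" using binary_seqD(6)[OF l(1)] c(2) t by blast
    then show ?thesis using w c by blast
  qed
  then have "partial_coloring K V E t l'" unfolding partial_coloring_iff using pc t by blast
  then show "t \<in> coloring_tree K V E" unfolding coloring_tree_iff using t by blast
qed

lemma induced_subgraph:
  assumes "is_graph M V E"
  shows "is_graph M {v. v \<in> V \<and> v \<prec> l}
    {q. q \<in> E \<and> (\<exists>x. x \<prec> q \<oplus> \<one> \<and> (\<exists>y. y \<prec> q \<oplus> \<one> \<and> x \<prec> l \<and> y \<prec> l \<and> q = pair M x y))}"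
proof -
  have G: "V \<in> Sets M" "E \<in> Sets M" "\<And>p. p \<in> E \<Longrightarrow> \<exists>x\<in>V. \<exists>y\<in>V. p = pair M x y"
    "\<And>x y. pair M x y \<in> E \<Longrightarrow> pair M y x \<in> E" using assms unfolding is_graph_def by blast+
  define E' where "E' = {q. q \<in> E \<and> (\<exists>x. x \<prec> q \<oplus> \<one> \<and> (\<exists>y. y \<prec> q \<oplus> \<one> \<and> x \<prec> l \<and> y \<prec> l \<and> q = pair M x y))}"
  have E': "pair M x y \<in> E' \<longleftrightarrow> pair M x y \<in> E \<and> x \<prec> l \<and> y \<prec> l" for x y
    unfolding E'_def using less_pair_succ1[OF refl, of x y] less_pair_succ2[OF refl, of y x] by auto
  have "E' \<in> Sets M" unfolding E'_def by (rule delta0_comprehension) (intro definable G)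
  moreover have "{v. v \<in> V \<and> v \<prec> l} \<in> Sets M" by (rule delta0_comprehension) (intro definable G)
  moreover have "\<exists>x\<in>{v. v \<in> V \<and> v \<prec> l}. \<exists>y\<in>{v. v \<in> V \<and> v \<prec> l}. p = pair M x y" if "p \<in> E'" for p
  proof -
    from that have "p \<in> E" unfolding E'_def by simp
    then obtain x y where "x \<in> V" "y \<in> V" "p = pair M x y" using G(3) by blast
    then show ?thesis using that E' by blast
  qed
  ultimately show ?thesis unfolding is_graph_def E'_def[symmetric] using E' G(4) by simp
qed

lemma coloring_tree_infinite:
  assumes G: "is_graph M V E" and loc: "locally_chromatic M k V E"
  shows "\<not> finite_set M (coloring_tree (num M k) V E)"
proof
  define K where "K = num M k"
  assume "finite_set M (coloring_tree (num M k) V E)"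
  then obtain b where b: "coloring_tree K V E \<subseteq> below M b" unfolding finite_set_def K_def by blast
  \<comment> \<open>A node of length \<open>l\<close> has a code no smaller than \<open>l\<close>,
    so it escapes the bound \<open>b\<close>.\<close>
  define l where "l = b \<oplus> \<one>"
  define V' where "V' = {v. v \<in> V \<and> v \<prec> l}"
  define E' where "E' = {q. q \<in> E \<and> (\<exists>x. x \<prec> q \<oplus> \<one> \<and> (\<exists>y. y \<prec> q \<oplus> \<one> \<and> x \<prec> l \<and> y \<prec> l \<and> q = pair M x y))}"
  have E': "pair M x y \<in> E'" if "pair M x y \<in> E" "x \<prec> l" "y \<prec> l" for x y
    unfolding E'_def using that less_pair_succ1[OF refl, of x y] less_pair_succ2[OF refl, of y x] by auto
  have G': "is_graph M V' E'" unfolding V'_def E'_def by (rule induced_subgraph[OF G])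
  moreover have "V' \<in> Sets M" using G' unfolding is_graph_def by blast
  then have "finite_set M V'" unfolding finite_set_def below_def V'_def by blast
  moreover have "V' \<subseteq> V" "E' \<subseteq> E" unfolding V'_def E'_def by auto
  ultimately have "chromatic M k V' E'" using loc unfolding locally_chromatic_def by blast
  then obtain C where "is_coloring M k V' E' C" unfolding chromatic_def by blast
  note C = is_coloringD[OF this, folded K_def]
  \<comment> \<open>As the position for the color \<open>c\<close> at \<open>v\<close> is
    \<open>pair M v c\<close>, the required node is the characteristic function of \<open>C\<close>
    below \<open>l\<close>.\<close>
  define X where "X = {p. \<exists>i. i \<prec> p \<oplus> \<one> \<and> (\<exists>v. v \<prec> p \<oplus> \<one> \<and> p = pair M i v \<and> i \<prec> l \<and>
     (v = \<zero> \<and> i \<notin> C \<or> v = \<one> \<and> i \<in> C))}"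
  have XS: "X \<in> Sets M" unfolding X_def by (rule delta0_comprehension) (intro definable C)
  have X: "pair M i v \<in> X \<longleftrightarrow> i \<prec> l \<and> (v = \<zero> \<and> i \<notin> C \<or> v = \<one> \<and> i \<in> C)" for i v
    unfolding X_def using less_pair_succ1[OF refl, of i v] less_pair_succ2[OF refl, of v i] by auto
  from XS obtain s where s: "binary_seq M s l" "elems M s = X"
  proof (rule binary_seq_exists)
    fix p assume "p \<in> X"
    moreover from this obtain i v where "p = pair M i v" unfolding X_def by blast
    ultimately show "\<exists>i v. i \<prec> l \<and> (v = \<zero> \<or> v = \<one>) \<and> p = pair M i v" using X by blast
  next
    fix i assume "i \<prec> l"
    then show "\<exists>v. pair M i v \<in> X" unfolding X by blast
  next
    fix i v w assume "pair M i v \<in> X" "pair M i w \<in> X"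
    then show "v = w" unfolding X by blast
  qed
  have "partial_coloring K V E s l"
    unfolding partial_coloring_iff s(2) X
  proof (intro conjI allI impI)
    fix v assume v: "v \<in> V" "pair M v K \<prec> l"
    then have "v \<in> V'" unfolding V'_def using le_pair1 le_less_trans by blast
    then obtain c where c: "pair M v c \<in> C" using C(4) by blast
    then have "c \<prec> K" by (rule C(3))
    moreover from this have "pair M v c \<prec> l" using pair_less2 v(2) less_trans' by blast
    ultimately show "\<exists>c. c \<prec> K \<and> pair M v c \<prec> l \<and> (\<one> = \<zero> \<and> pair M v c \<notin> C \<or> \<one> = \<one> \<and> pair M v c \<in> C)"
      using c by blast
  next
    fix x y c assume e: "pair M x y \<in> E"
      and x: "pair M x c \<prec> l \<and> (\<one> = \<zero> \<and> pair M x c \<notin> C \<or> \<one> = \<one> \<and> pair M x c \<in> C)"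
    show "\<not> (pair M y c \<prec> l \<and> (\<one> = \<zero> \<and> pair M y c \<notin> C \<or> \<one> = \<one> \<and> pair M y c \<in> C))"
    proof
      assume y: "pair M y c \<prec> l \<and> (\<one> = \<zero> \<and> pair M y c \<notin> C \<or> \<one> = \<one> \<and> pair M y c \<in> C)"
      have "x \<prec> l" "y \<prec> l" using x y le_pair1 le_less_trans by blast+
      then have "pair M x y \<in> E'" using E' e by blast
      moreover have "pair M x c \<in> C" "pair M y c \<in> C" using x y one_neq_zero by auto
      ultimately show False using C(6) by blast
    qed
  qed
  then have "s \<in> coloring_tree K V E" unfolding coloring_tree_iff using s(1) by blast
  then have "s \<prec> b" using b unfolding below_def by blast
  moreover have "b \<prec> l" unfolding l_def peano(8) by simp
  ultimately show False using binary_seq_length_le[OF s(1)] less_trans' by (metis not_less)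
qed

lemma coloring_from_path:
  assumes G: "is_graph M V E" and F: "infinite_path M F (coloring_tree (num M k) V E)"
  shows "chromatic M k V E"
proof -
  define K where "K = num M k"
  have VS: "V \<in> Sets M" using G unfolding is_graph_def by blast
  have FS: "F \<in> Sets M" and FF: "\<And>i v w. pair M i v \<in> F \<Longrightarrow> pair M i w \<in> F \<Longrightarrow> v = w"
    using F unfolding infinite_path_def is_function_def by blast+
  have path: "\<exists>s. binary_seq M s l \<and> partial_coloring K V E s l \<and> elems M s \<subseteq> F" for l
  proof -
    obtain s where s: "s \<in> coloring_tree K V E" "binary_seq M s l" "elems M s \<subseteq> F"
      using F unfolding infinite_path_def K_def by blast
    then obtain l' where l': "binary_seq M s l'" "partial_coloring K V E s l'" unfolding coloring_tree_iff by blast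
    have "l' = l" using binary_seq_length_mono[OF s(2) l'(1)] binary_seq_length_mono[OF l'(1) s(2)] by simp
    then show ?thesis using l' s by blast
  qed
  define C where "C = {q. \<exists>v. v \<prec> q \<oplus> \<one> \<and> (\<exists>c. c \<prec> q \<oplus> \<one> \<and> q = pair M v c \<and> v \<in> V \<and> c \<prec> K \<and>
     pair M (pair M v c) \<one> \<in> F \<and> (\<forall>d. d \<prec> c \<longrightarrow> pair M (pair M v d) \<one> \<notin> F))}"
  have CS: "C \<in> Sets M" unfolding C_def by (rule delta0_comprehension) (intro definable VS FS)
  have C: "pair M v c \<in> C \<longleftrightarrow> v \<in> V \<and> c \<prec> K \<and> pair M (pair M v c) \<one> \<in> F \<and> (\<forall>d. d \<prec> c \<longrightarrow> pair M (pair M v d) \<one> \<notin> F)"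
    for v c unfolding C_def using less_pair_succ1[OF refl, of v c] less_pair_succ2[OF refl, of c v] by auto
  have "is_coloring M k V E C"
    unfolding is_coloring_def is_function_def K_def[symmetric]
  proof (intro conjI ballI allI impI)
    show "C \<in> Sets M" by (rule CS)
    fix p assume p: "p \<in> C"
    then obtain v c where vc: "p = pair M v c" unfolding C_def by blast
    then show "\<exists>x\<in>V. \<exists>y\<in>below M K. p = pair M x y" using p unfolding vc C below_def by blast
  next
    fix v assume v: "v \<in> V"
    \<comment> \<open>This is the least length at which \<open>v\<close> must have a color.\<close>
    obtain s where s: "partial_coloring K V E s (pair M v K \<oplus> \<one>)" "elems M s \<subseteq> F" using path by blast
    have "pair M v K \<prec> pair M v K \<oplus> \<one>" unfolding peano(8) by simp
    then obtain c where c: "c \<prec> K" "pair M (pair M v c) \<one> \<in> F"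
      using s v unfolding partial_coloring_iff by blast
    have "delta0 (\<lambda>e. pair M (pair M v (e 0)) \<one> \<in> F)" by (intro definable FS)
    from least_number[of "\<lambda>c. pair M (pair M v c) \<one> \<in> F", OF this c(2)] obtain m where
      m: "pair M (pair M v m) \<one> \<in> F" "\<forall>b. b \<prec> m \<longrightarrow> pair M (pair M v b) \<one> \<notin> F" by blast
    then have "m \<preceq> c" using c(2) less_linear' le_def by blast
    then have "m \<prec> K" using c(1) le_less_trans by blast
    then have "pair M v m \<in> C" unfolding C using v m by blast
    moreover have "d = m" if "pair M v d \<in> C" for d
      using that m unfolding C using less_linear'[of d m] by blast
    ultimately show "\<exists>!y. pair M v y \<in> C" by blast
  next
    fix x y u v assume *: "pair M x y \<in> E \<and> pair M x u \<in> C \<and> pair M y v \<in> C"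
    show "u \<noteq> v"
    proof
      assume uv: "u = v"
      \<comment> \<open>Long enough for both bits to occur in one node, which excludes that both are
        \<open>\<one>\<close>.\<close>
      define l where "l = pair M x u \<oplus> pair M y u \<oplus> \<one>"
      obtain s where s: "binary_seq M s l" "partial_coloring K V E s l" "elems M s \<subseteq> F" using path by blast
      have "pair M x u \<prec> l" "pair M y u \<prec> l" unfolding l_def less_succ_iff by (rule le_add_right le_add_left)+
      then obtain a b where ab: "pair M (pair M x u) a \<in> elems M s" "pair M (pair M y u) b \<in> elems M s"
        using binary_seqD(3)[OF s(1)] by meson
      have "pair M (pair M x u) \<one> \<in> F" "pair M (pair M y u) \<one> \<in> F" using * C uv by simp_all
      then have "a = \<one>" "b = \<one>" using ab s(3) FF by blast+
      then show False using ab * s(2) unfolding partial_coloring_iff by blast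
    qed
  qed
  then show ?thesis unfolding chromatic_def by blast
qed

lemma weak_koenig_lemma_imp_chromatic:
  assumes "weak_koenig_lemma M" "is_graph M V E" "locally_chromatic M k V E"
  shows "chromatic M k V E"
proof -
  have "binary_tree M (coloring_tree (num M k) V E)"
    using assms(2) binary_tree_coloring_tree unfolding is_graph_def by blast
  moreover have "\<not> finite_set M (coloring_tree (num M k) V E)"
    using coloring_tree_infinite assms(2,3) .
  ultimately obtain F where "infinite_path M F (coloring_tree (num M k) V E)"
    using assms(1) unfolding weak_koenig_lemma_def by blast
  then show ?thesis using coloring_from_path assms(2) by blast
qed

end

section \<open>Colorings of grids\<close>

definition grid_proper :: "'i set \<Rightarrow> ('i \<Rightarrow> 'i \<Rightarrow> 'c) \<Rightarrow> ('i \<Rightarrow> 'i \<Rightarrow> 'c) \<Rightarrow> bool" where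
  "grid_proper K c d \<longleftrightarrow> (\<forall>i\<in>K. \<forall>j\<in>K. \<forall>i'\<in>K. \<forall>j'\<in>K. i \<noteq> i' \<longrightarrow> j \<noteq> j' \<longrightarrow> c i j \<noteq> d i' j')"

definition rows_repeat :: "'i set \<Rightarrow> ('i \<Rightarrow> 'i \<Rightarrow> 'c) \<Rightarrow> bool" where
  "rows_repeat K c \<longleftrightarrow> (\<forall>i\<in>K. \<exists>j\<in>K. \<exists>j'\<in>K. j \<noteq> j' \<and> c i j = c i j')"

lemma grid_properD:
  "grid_proper K c d \<Longrightarrow> i \<in> K \<Longrightarrow> j \<in> K \<Longrightarrow> i' \<in> K \<Longrightarrow> j' \<in> K \<Longrightarrow> i \<noteq> i' \<Longrightarrow> j \<noteq> j' \<Longrightarrow> c i j \<noteq> d i' j'"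
  unfolding grid_proper_def by blast

lemma grid_proper_transpose:
  "grid_proper K c d \<Longrightarrow> grid_proper K (\<lambda>i j. c j i) (\<lambda>i j. d j i)"
  unfolding grid_proper_def by blast

lemma grid_proper_sym: "grid_proper K c d \<Longrightarrow> grid_proper K d c"
  unfolding grid_proper_def by metis

lemma rows_or_columns_repeat:
  assumes "finite K" "finite L" "card L < 2 * card K - 1" "\<And>i j. i \<in> K \<Longrightarrow> j \<in> K \<Longrightarrow> c i j \<in> L"
    and "grid_proper K c c"
  shows "rows_repeat K c \<or> rows_repeat K (\<lambda>i j. c j i)"
proof (rule ccontr)
  assume "\<not> ?thesis"
  then obtain i j where i: "i \<in> K" "\<And>a b. a \<in> K \<Longrightarrow> b \<in> K \<Longrightarrow> c i a = c i b \<Longrightarrow> a = b"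
    and j: "j \<in> K" "\<And>a b. a \<in> K \<Longrightarrow> b \<in> K \<Longrightarrow> c a j = c b j \<Longrightarrow> a = b"
    unfolding rows_repeat_def by metis
  \<comment> \<open>The column is taken without row \<open>i\<close>, as the crossing
    \<open>(i, j)\<close> already counts in the row.\<close>
  have "inj_on (c i) K" "inj_on (\<lambda>a. c a j) (K - {i})" using i(2) j(2) by (auto simp: inj_on_def)
  then have "card (c i ` K) = card K" "card ((\<lambda>a. c a j) ` (K - {i})) = card K - 1"
    using i(1) assms(1) by (simp_all add: card_image)
  \<comment> \<open>For \<open>b\<close> other than \<open>j\<close> the two cells differ in both
    coordinates and are adjacent; for \<open>b = j\<close> both lie in the repetition-free
    column.\<close>
  moreover have "c i b \<noteq> c a j" if "a \<in> K - {i}" "b \<in> K" for a b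
    using that i(1) j grid_properD[OF assms(5), of i b a j] by (cases "b = j") auto
  then have "c i ` K \<inter> (\<lambda>a. c a j) ` (K - {i}) = {}" by auto
  ultimately have "card (c i ` K \<union> (\<lambda>a. c a j) ` (K - {i})) = card K + (card K - 1)"
    using assms(1) by (simp add: card_Un_disjoint)
  moreover have "card (c i ` K \<union> (\<lambda>a. c a j) ` (K - {i})) \<le> card L"
    by (rule card_mono[OF assms(2)]) (use assms(4) i(1) j(1) in auto)
  ultimately show False using assms(3) by simp
qed

text \<open>A color repeated in row \<open>i\<close> of \<open>c\<close> cannot occur in another
  row, because any cell there differs in column from one of its two occurrences; likewise for the
  columns of \<open>d\<close>. A repeated row color of \<open>c\<close> also differs from a repeated
  column color of \<open>d\<close>: occurrences off column \<open>j\<close> and off row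
  \<open>i\<close> can be chosen, and these are adjacent.\<close>

lemma not_rows_and_columns_repeat:
  assumes "finite K" "finite L" "card L < 2 * card K - 1" "\<And>i j. i \<in> K \<Longrightarrow> j \<in> K \<Longrightarrow> c i j \<in> L"
    and "\<And>i j. i \<in> K \<Longrightarrow> j \<in> K \<Longrightarrow> d i j \<in> L"
    and "grid_proper K c c" "grid_proper K d d" "grid_proper K c d"
    and "rows_repeat K c" "rows_repeat K (\<lambda>i j. d j i)"
  shows False
proof -
  obtain f g where fg: "\<And>i. i \<in> K \<Longrightarrow> f i \<in> K \<and> g i \<in> K \<and> f i \<noteq> g i \<and> c i (f i) = c i (g i)"
    using assms(9) unfolding rows_repeat_def by metis
  obtain f' g' where fg': "\<And>j. j \<in> K \<Longrightarrow> f' j \<in> K \<and> g' j \<in> K \<and> f' j \<noteq> g' j \<and> d (f' j) j = d (g' j) j"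
    using assms(10) unfolding rows_repeat_def by metis
  have "inj_on (\<lambda>i. c i (f i)) K"
  proof (rule inj_onI, rule ccontr)
    fix i i' assume *: "i \<in> K" "i' \<in> K" "c i (f i) = c i' (f i')" "i \<noteq> i'"
    show False
    proof (cases "f i = f i'")
      case True
      then show False using * fg[of i] fg[of i'] grid_properD[OF assms(6), of i "g i" i' "f i'"] by auto
    next
      case False
      then show False using * fg[of i] fg[of i'] grid_properD[OF assms(6), of i "f i" i' "f i'"] by auto
    qed
  qed
  moreover have "inj_on (\<lambda>j. d (f' j) j) K"
  proof (rule inj_onI, rule ccontr)
    fix i i' assume *: "i \<in> K" "i' \<in> K" "d (f' i) i = d (f' i') i'" "i \<noteq> i'"
    show False
    proof (cases "f' i = f' i'")
      case True
      then show False using * fg'[of i] fg'[of i'] grid_properD[OF assms(7), of "g' i" i "f' i'" i'] by auto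
    next
      case False
      then show False using * fg'[of i] fg'[of i'] grid_properD[OF assms(7), of "f' i" i "f' i'" i'] by auto
    qed
  qed
  ultimately have "card ((\<lambda>i. c i (f i)) ` K) = card K" "card ((\<lambda>j. d (f' j) j) ` K) = card K"
    by (simp_all add: card_image)
  moreover have "c i (f i) \<noteq> d (f' j) j" if ij: "i \<in> K" "j \<in> K" for i j
  proof -
    obtain a where a: "a \<in> K" "a \<noteq> j" "c i a = c i (f i)" using fg[OF ij(1)] by metis
    obtain b where b: "b \<in> K" "b \<noteq> i" "d b j = d (f' j) j" using fg'[OF ij(2)] by metis
    show ?thesis using grid_properD[OF assms(8), of i a b j] a b ij by simp
  qed
  then have "(\<lambda>i. c i (f i)) ` K \<inter> (\<lambda>j. d (f' j) j) ` K = {}" by auto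
  ultimately have "card ((\<lambda>i. c i (f i)) ` K \<union> (\<lambda>j. d (f' j) j) ` K) = card K + card K"
    using assms(1) by (simp add: card_Un_disjoint)
  moreover have "card ((\<lambda>i. c i (f i)) ` K \<union> (\<lambda>j. d (f' j) j) ` K) \<le> card L"
    by (rule card_mono[OF assms(2)]) (use assms(4,5) fg fg' in auto)
  ultimately show False using assms(3) by simp
qed

text \<open>Each grid has repetitions in all rows or in all columns, and rows of one grid exclude
  columns of the other. Both directions of exclusion are used, so the link is also read
  backwards.\<close>

lemma rows_repeat_linked:
  assumes "finite K" "finite L" "card L < 2 * card K - 1" "\<And>i j. i \<in> K \<Longrightarrow> j \<in> K \<Longrightarrow> c i j \<in> L"
    and "\<And>i j. i \<in> K \<Longrightarrow> j \<in> K \<Longrightarrow> d i j \<in> L"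
    and "grid_proper K c c" "grid_proper K d d" "grid_proper K c d"
  shows "rows_repeat K c \<longleftrightarrow> rows_repeat K d"
  using rows_or_columns_repeat[OF assms(1-4,6)] rows_or_columns_repeat[OF assms(1-3,5,7)]
    not_rows_and_columns_repeat[OF assms]
    not_rows_and_columns_repeat[OF assms(1-3,5,4,7,6) grid_proper_sym[OF assms(8)]] by blast

text \<open>With both grids equal to \<open>d\<close>, \<open>not_rows_and_columns_repeat\<close>
  says that rows and columns of \<open>d\<close> cannot both repeat. Transposing a grid therefore
  negates its bit.\<close>

lemma rows_repeat_linked_transpose:
  assumes "finite K" "finite L" "card L < 2 * card K - 1" "\<And>i j. i \<in> K \<Longrightarrow> j \<in> K \<Longrightarrow> c i j \<in> L"
    and "\<And>i j. i \<in> K \<Longrightarrow> j \<in> K \<Longrightarrow> d i j \<in> L"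
    and "grid_proper K c c" "grid_proper K d d" "grid_proper K c (\<lambda>i j. d j i)"
  shows "rows_repeat K c \<longleftrightarrow> \<not> rows_repeat K d"
proof -
  have d: "(\<lambda>i j. d j i) i j \<in> L" if "i \<in> K" "j \<in> K" for i j
    using assms(5)[OF that(2,1)] by simp
  have "rows_repeat K c \<longleftrightarrow> rows_repeat K (\<lambda>i j. d j i)"
    by (rule rows_repeat_linked[OF assms(1-4) d assms(6) grid_proper_transpose[OF assms(7)] assms(8)])
  then show ?thesis
    using rows_or_columns_repeat[OF assms(1-3,5,7)] not_rows_and_columns_repeat[OF assms(1-3,5,5,7,7,7)] by blast
qed

section \<open>The graph of a separation problem\<close>

context rca
begin

definition vertex :: "'a \<Rightarrow> 'a \<Rightarrow> 'a \<Rightarrow> 'a \<Rightarrow> 'a" where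
  "vertex p t i j = pair M (pair M p t) (pair M i j)"

lemma vertex_eq_iff [simp]: "vertex p t i j = vertex p' t' i' j' \<longleftrightarrow> p = p' \<and> t = t' \<and> i = i' \<and> j = j'"
  unfolding vertex_def by auto

lemma term_vertex:
  assumes "term_definable p" "term_definable t" "term_definable i" "term_definable j"
  shows "term_definable (\<lambda>e. vertex (p e) (t e) (i e) (j e))"
  unfolding vertex_def by (intro term_pair assms)

lemma le_vertex: "p \<preceq> vertex p t i j" "t \<preceq> vertex p t i j" "i \<preceq> vertex p t i j" "j \<preceq> vertex p t i j"
  unfolding vertex_def using le_pair1 le_pair2 order_trans by blast+

lemma vertex_mono:
  "p \<preceq> p' \<Longrightarrow> t \<preceq> t' \<Longrightarrow> i \<preceq> i' \<Longrightarrow> j \<preceq> j' \<Longrightarrow> vertex p t i j \<preceq> vertex p' t' i' j'"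
  unfolding vertex_def by (intro pair_mono)

text \<open>
  The vertex \<open>vertex p t i j\<close> is the cell \<open>(i, j)\<close> of the grid at stage \<open>t\<close> of chain \<open>p\<close>. Chain \<open>\<zero>\<close> is the
  reference chain, and chain \<open>\<sigma> \<oplus> \<one>\<close> is joined to it straight for \<open>\<sigma>\<close> in \<open>P\<close> and transposed for \<open>\<sigma>\<close> in \<open>Q\<close>.
\<close>

definition link :: "'a set \<Rightarrow> 'a set \<Rightarrow> 'a \<Rightarrow> 'a \<Rightarrow> 'a \<Rightarrow> 'a \<Rightarrow> 'a \<Rightarrow> 'a \<Rightarrow> bool" where
  "link P Q \<sigma> t i j i' j' \<longleftrightarrow> \<sigma> \<prec> t \<oplus> \<one> \<and>
     (pair M \<sigma> t \<in> P \<and> i \<noteq> i' \<and> j \<noteq> j' \<or> pair M \<sigma> t \<in> Q \<and> i \<noteq> j' \<and> j \<noteq> i')"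

text \<open>\<open>link\<close> is symmetric in the two cells, so both directions of a link can pass
  them in the same order. The predecessor \<sigma> is given by a bounded quantifier to keep the
  formula bounded.\<close>

definition adj :: "'a set \<Rightarrow> 'a set \<Rightarrow> 'a \<Rightarrow> 'a \<Rightarrow> 'a \<Rightarrow> 'a \<Rightarrow> 'a \<Rightarrow> 'a \<Rightarrow> 'a \<Rightarrow> 'a \<Rightarrow> bool" where
  "adj P Q p t i j p' t' i' j' \<longleftrightarrow>
     p = p' \<and> (t = t' \<or> t' = t \<oplus> \<one> \<or> t = t' \<oplus> \<one>) \<and> i \<noteq> i' \<and> j \<noteq> j' \<or>
     t = t' \<and> p' = \<zero> \<and> (\<exists>\<sigma>. \<sigma> \<prec> p \<and> p = \<sigma> \<oplus> \<one> \<and> link P Q \<sigma> t i j i' j') \<or>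
     t = t' \<and> p = \<zero> \<and> (\<exists>\<sigma>. \<sigma> \<prec> p' \<and> p' = \<sigma> \<oplus> \<one> \<and> link P Q \<sigma> t i j i' j')"

lemma adj_sym: "adj P Q p t i j p' t' i' j' \<Longrightarrow> adj P Q p' t' i' j' p t i j"
  unfolding adj_def link_def by metis

definition graph_vertices :: "'a \<Rightarrow> 'a set" where
  "graph_vertices K = {x. \<exists>p t i j. x = vertex p t i j \<and> i \<prec> K \<and> j \<prec> K}"

definition graph_edges :: "'a set \<Rightarrow> 'a set \<Rightarrow> 'a \<Rightarrow> 'a set" where
  "graph_edges P Q K = {q. \<exists>p t i j p' t' i' j'. q = pair M (vertex p t i j) (vertex p' t' i' j') \<and>
     i \<prec> K \<and> j \<prec> K \<and> i' \<prec> K \<and> j' \<prec> K \<and> adj P Q p t i j p' t' i' j'}"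

text \<open>Coordinates do not exceed their vertex, so one bound on vertices bounds four
  quantifiers. This brings the sets that describe the graph under comprehension for bounded
  formulas.\<close>

lemma ex_vertex_bounded:
  assumes "\<And>p t i j. A p t i j \<Longrightarrow> vertex p t i j \<preceq> q"
  shows "(\<exists>p t i j. A p t i j) \<longleftrightarrow> (\<exists>p. p \<prec> q \<oplus> \<one> \<and> (\<exists>t. t \<prec> q \<oplus> \<one> \<and> (\<exists>i. i \<prec> q \<oplus> \<one> \<and> (\<exists>j. j \<prec> q \<oplus> \<one> \<and> A p t i j))))"
    (is "?l \<longleftrightarrow> ?r")
proof
  assume ?l
  then obtain p t i j where A: "A p t i j" by blast
  have "p \<preceq> q" "t \<preceq> q" "i \<preceq> q" "j \<preceq> q"
    using le_vertex order_trans[OF _ assms[OF A]] by blast+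
  then show ?r using A unfolding less_succ_iff by blast
qed blast

section \<open>Existence and boundedness of the graph\<close>

lemma graph_vertices_in_Sets: "graph_vertices K \<in> Sets M"
proof -
  have "(\<exists>p t i j. x = vertex p t i j \<and> i \<prec> K \<and> j \<prec> K) \<longleftrightarrow>
    (\<exists>p. p \<prec> x \<oplus> \<one> \<and> (\<exists>t. t \<prec> x \<oplus> \<one> \<and> (\<exists>i. i \<prec> x \<oplus> \<one> \<and> (\<exists>j. j \<prec> x \<oplus> \<one> \<and> x = vertex p t i j \<and> i \<prec> K \<and> j \<prec> K))))"
    for x by (rule ex_vertex_bounded) simp
  then show ?thesis unfolding graph_vertices_def
    by (simp only:) (rule delta0_comprehension, intro definable term_vertex)
qed

lemma graph_edges_in_Sets:
  assumes "P \<in> Sets M" "Q \<in> Sets M"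
  shows "graph_edges P Q K \<in> Sets M"
proof -
  define A where "A = (\<lambda>q p t i j p' t' i' j'. q = pair M (vertex p t i j) (vertex p' t' i' j') \<and>
     i \<prec> K \<and> j \<prec> K \<and> i' \<prec> K \<and> j' \<prec> K \<and> adj P Q p t i j p' t' i' j')"
  have 1: "vertex p t i j \<preceq> q" if "\<exists>p' t' i' j'. A q p t i j p' t' i' j'" for q p t i j
    using that le_pair1 unfolding A_def by auto
  have 2: "vertex p' t' i' j' \<preceq> q" if "A q p t i j p' t' i' j'" for q p t i j p' t' i' j'
    using that le_pair2 unfolding A_def by auto
  have e1: "(\<exists>p t i j. \<exists>p' t' i' j'. A q p t i j p' t' i' j') \<longleftrightarrow>
     (\<exists>p. p \<prec> q \<oplus> \<one> \<and> (\<exists>t. t \<prec> q \<oplus> \<one> \<and> (\<exists>i. i \<prec> q \<oplus> \<one> \<and> (\<exists>j. j \<prec> q \<oplus> \<one> \<and>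
     (\<exists>p' t' i' j'. A q p t i j p' t' i' j')))))" for q
    by (rule ex_vertex_bounded) (rule 1)
  have e2: "(\<exists>p' t' i' j'. A q p t i j p' t' i' j') \<longleftrightarrow> (\<exists>p'. p' \<prec> q \<oplus> \<one> \<and>
     (\<exists>t'. t' \<prec> q \<oplus> \<one> \<and> (\<exists>i'. i' \<prec> q \<oplus> \<one> \<and> (\<exists>j'. j' \<prec> q \<oplus> \<one> \<and> A q p t i j p' t' i' j'))))" for q p t i j
    by (rule ex_vertex_bounded) (rule 2)
  have "(\<exists>p t i j p' t' i' j'. A q p t i j p' t' i' j') \<longleftrightarrow>
     (\<exists>p. p \<prec> q \<oplus> \<one> \<and> (\<exists>t. t \<prec> q \<oplus> \<one> \<and> (\<exists>i. i \<prec> q \<oplus> \<one> \<and> (\<exists>j. j \<prec> q \<oplus> \<one> \<and>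
     (\<exists>p'. p' \<prec> q \<oplus> \<one> \<and> (\<exists>t'. t' \<prec> q \<oplus> \<one> \<and> (\<exists>i'. i' \<prec> q \<oplus> \<one> \<and> (\<exists>j'. j' \<prec> q \<oplus> \<one> \<and> A q p t i j p' t' i' j'))))))))" for q
    by (rule trans[OF e1]) (simp only: e2)
  then have "graph_edges P Q K = {q. \<exists>p. p \<prec> q \<oplus> \<one> \<and> (\<exists>t. t \<prec> q \<oplus> \<one> \<and> (\<exists>i. i \<prec> q \<oplus> \<one> \<and> (\<exists>j. j \<prec> q \<oplus> \<one> \<and>
     (\<exists>p'. p' \<prec> q \<oplus> \<one> \<and> (\<exists>t'. t' \<prec> q \<oplus> \<one> \<and> (\<exists>i'. i' \<prec> q \<oplus> \<one> \<and> (\<exists>j'. j' \<prec> q \<oplus> \<one> \<and> A q p t i j p' t' i' j')))))))}"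
    unfolding graph_edges_def A_def by (rule Collect_cong)
  also have "\<dots> \<in> Sets M"
    unfolding A_def adj_def link_def
    by (rule delta0_comprehension) (intro definable term_vertex assms)
  finally show ?thesis .
qed

lemma is_graph_gadget:
  assumes "P \<in> Sets M" "Q \<in> Sets M"
  shows "is_graph M (graph_vertices K) (graph_edges P Q K)"
  unfolding is_graph_def
proof (intro conjI ballI allI impI)
  show "graph_vertices K \<in> Sets M" by (rule graph_vertices_in_Sets)
  show "graph_edges P Q K \<in> Sets M" by (rule graph_edges_in_Sets[OF assms])
  show "\<exists>x\<in>graph_vertices K. \<exists>y\<in>graph_vertices K. p = pair M x y" if "p \<in> graph_edges P Q K" for p
    using that unfolding graph_edges_def graph_vertices_def by blast
  show "pair M y x \<in> graph_edges P Q K" if "pair M x y \<in> graph_edges P Q K" for x y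
    using that adj_sym unfolding graph_edges_def by auto
qed

lemma graph_edges_iff:
  "pair M (vertex p t i j) (vertex p' t' i' j') \<in> graph_edges P Q K \<longleftrightarrow>
     i \<prec> K \<and> j \<prec> K \<and> i' \<prec> K \<and> j' \<prec> K \<and> adj P Q p t i j p' t' i' j'"
  unfolding graph_edges_def by auto

lemma graph_vertices_iff: "vertex p t i j \<in> graph_vertices K \<longleftrightarrow> i \<prec> K \<and> j \<prec> K"
  unfolding graph_vertices_def by auto

lemma graph_edgesE:
  assumes "pair M x y \<in> graph_edges P Q K"
  obtains p t i j p' t' i' j' where "x = vertex p t i j" "y = vertex p' t' i' j'"
    "i \<prec> K" "j \<prec> K" "i' \<prec> K" "j' \<prec> K" "adj P Q p t i j p' t' i' j'"
  using assms unfolding graph_edges_def by auto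

text \<open>A vertex of the reference chain at stage \<open>t\<close> meets other chains
  \<open>\<sigma> \<oplus> \<one>\<close> only for \<open>\<sigma> \<preceq> t\<close>, by the first
  condition in \<open>link\<close>. The common bound on \<open>p'\<close> also covers staying in
  chain \<open>p\<close> and passing to chain \<open>\<zero>\<close>.\<close>

lemma adj_bound:
  assumes "adj P Q p t i j p' t' i' j'"
  shows "p' \<preceq> p \<oplus> t \<oplus> \<one>" "t' \<preceq> t \<oplus> \<one>"
proof -
  have 1: "a \<preceq> a \<oplus> \<one>" for a by (rule le_add_right)
  have 2: "p \<preceq> p \<oplus> t \<oplus> \<one>" using le_add_right order_trans by blast
  have 3: "s \<oplus> \<one> \<preceq> p \<oplus> t \<oplus> \<one>" if "s \<prec> t \<oplus> \<one>" for s
  proof -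
    have "s \<preceq> t" using that less_succ_iff by simp
    then have "s \<preceq> p \<oplus> t" using le_add_left order_trans by blast
    then show ?thesis by simp
  qed
  show "p' \<preceq> p \<oplus> t \<oplus> \<one>" using assms 2 3 zero_le_all unfolding adj_def link_def by blast
  show "t' \<preceq> t \<oplus> \<one>" using assms 1 1[THEN order_trans, OF 1] unfolding adj_def by auto
qed

lemma bounded_gadget:
  assumes "P \<in> Sets M" "Q \<in> Sets M"
  shows "bounded_graph M (graph_vertices K) (graph_edges P Q K)"
proof -
  \<comment> \<open>The value of the bounding function is a vertex whose coordinates are at least
    those of every neighbor; \<open>K\<close> exceeds all indices of cells.\<close>
  define A where "A = (\<lambda>q p t i j. q = pair M (vertex p t i j) (vertex (p \<oplus> t \<oplus> \<one>) (t \<oplus> \<one>) K K) \<and> i \<prec> K \<and> j \<prec> K)"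
  define H where "H = {q. \<exists>p t i j. A q p t i j}"
  have "(\<exists>p t i j. A q p t i j) \<longleftrightarrow>
    (\<exists>p. p \<prec> q \<oplus> \<one> \<and> (\<exists>t. t \<prec> q \<oplus> \<one> \<and> (\<exists>i. i \<prec> q \<oplus> \<one> \<and> (\<exists>j. j \<prec> q \<oplus> \<one> \<and> A q p t i j))))" for q
    by (rule ex_vertex_bounded) (simp add: A_def le_pair1)
  then have HS: "H \<in> Sets M" unfolding H_def A_def
    by (simp only:) (rule delta0_comprehension, intro definable term_vertex)
  have H: "pair M (vertex p t i j) b \<in> H \<longleftrightarrow> i \<prec> K \<and> j \<prec> K \<and> b = vertex (p \<oplus> t \<oplus> \<one>) (t \<oplus> \<one>) K K" for p t i j b
    unfolding H_def A_def by auto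
  have "is_function M H (graph_vertices K) UNIV"
    unfolding is_function_def
  proof (intro conjI ballI)
    show "H \<in> Sets M" by (rule HS)
    show "\<exists>x\<in>graph_vertices K. \<exists>y\<in>UNIV. q = pair M x y" if "q \<in> H" for q
      using that unfolding H_def A_def graph_vertices_def by blast
    fix x assume "x \<in> graph_vertices K"
    then obtain p t i j where x: "x = vertex p t i j" "i \<prec> K" "j \<prec> K" unfolding graph_vertices_def by blast
    then show "\<exists>!y. pair M x y \<in> H" by (simp add: H)
  qed
  moreover have "y \<prec> b \<or> y = b" if "pair M x y \<in> graph_edges P Q K" "pair M x b \<in> H" for x y b
  proof -
    from that(1) obtain p t i j p' t' i' j' where *: "x = vertex p t i j" "y = vertex p' t' i' j'"
      "i' \<prec> K" "j' \<prec> K" "adj P Q p t i j p' t' i' j'" by (rule graph_edgesE)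
    have "b = vertex (p \<oplus> t \<oplus> \<one>) (t \<oplus> \<one>) K K" using that(2) unfolding *(1) H by simp
    moreover have "y \<preceq> vertex (p \<oplus> t \<oplus> \<one>) (t \<oplus> \<one>) K K"
      unfolding *(2) using adj_bound[OF *(5)] *(3,4) less_imp_le by (intro vertex_mono)
    ultimately show ?thesis unfolding le_def by simp
  qed
  ultimately show ?thesis unfolding bounded_graph_def by blast
qed

text \<open>Whether a chain is ever linked crosswise is a \<open>\<Sigma>\<^sub>1\<close> question.
  Vertices below \<open>b\<close> have stages below \<open>b\<close>, however, so for a finite
  subgraph a bounded search is enough and the coloring exists by comprehension. Disjointness of the
  events keeps straight links away from the chains that are colored by columns.\<close>

lemma locally_chromatic_gadget:
  assumes "P \<in> Sets M" "Q \<in> Sets M"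
    and disj: "\<And>\<sigma> s s'. pair M \<sigma> s \<in> P \<Longrightarrow> pair M \<sigma> s' \<notin> Q"
  shows "locally_chromatic M k (graph_vertices (num M k)) (graph_edges P Q (num M k))"
  unfolding locally_chromatic_def
proof (intro allI impI)
  fix V' E'
  define K where "K = num M k"
  assume "is_graph M V' E' \<and> finite_set M V' \<and> V' \<subseteq> graph_vertices (num M k) \<and> E' \<subseteq> graph_edges P Q (num M k)"
  then have G: "is_graph M V' E'" and "finite_set M V'" and sub: "V' \<subseteq> graph_vertices K" "E' \<subseteq> graph_edges P Q K"
    unfolding K_def by simp_all
  then obtain b where "V' \<subseteq> below M b" and VS: "V' \<in> Sets M" unfolding finite_set_def by blast
  then have b: "x \<prec> b" if "x \<in> V'" for x using that unfolding below_def by auto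
  have EV: "x \<in> V' \<and> y \<in> V'" if "pair M x y \<in> E'" for x y
  proof -
    have "\<forall>p\<in>E'. \<exists>x\<in>V'. \<exists>y\<in>V'. p = pair M x y" using G unfolding is_graph_def by simp
    from bspec[OF this that] show ?thesis by auto
  qed
  \<comment> \<open>The chains that some stage below \<open>b\<close> links crosswise are coloured by columns, all others by rows.\<close>
  define W where "W = (\<lambda>p. \<exists>\<sigma>. \<sigma> \<prec> p \<and> p = \<sigma> \<oplus> \<one> \<and> (\<exists>s. s \<prec> b \<and> pair M \<sigma> s \<in> Q))"
  define A where "A = (\<lambda>q p t i j. vertex p t i j \<in> V' \<and> (W p \<and> q = pair M (vertex p t i j) j \<or> \<not> W p \<and> q = pair M (vertex p t i j) i))"
  define C where "C = {q. \<exists>p t i j. A q p t i j}"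
  have "(\<exists>p t i j. A q p t i j) \<longleftrightarrow>
    (\<exists>p. p \<prec> q \<oplus> \<one> \<and> (\<exists>t. t \<prec> q \<oplus> \<one> \<and> (\<exists>i. i \<prec> q \<oplus> \<one> \<and> (\<exists>j. j \<prec> q \<oplus> \<one> \<and> A q p t i j))))" for q
    by (rule ex_vertex_bounded) (auto simp: A_def le_pair1)
  then have CS: "C \<in> Sets M" unfolding C_def A_def W_def
    by (simp only:) (rule delta0_comprehension, intro definable term_vertex VS assms(2))
  have C: "pair M (vertex p t i j) c \<in> C \<longleftrightarrow> vertex p t i j \<in> V' \<and> c = (if W p then j else i)" for p t i j c
    unfolding C_def A_def by auto
  have "is_coloring M k V' E' C"
    unfolding is_coloring_def is_function_def K_def[symmetric]
  proof (intro conjI ballI allI impI)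
    show "C \<in> Sets M" by (rule CS)
    fix q assume "q \<in> C"
    then obtain p t i j where "A q p t i j" unfolding C_def by blast
    then have v: "vertex p t i j \<in> V'" and q: "q = pair M (vertex p t i j) (if W p then j else i)"
      unfolding A_def by auto
    have "i \<prec> K" "j \<prec> K" using v sub(1) graph_vertices_iff by blast+
    then show "\<exists>x\<in>V'. \<exists>y\<in>below M K. q = pair M x y"
      using v q by (intro bexI[of _ "vertex p t i j"] bexI[of _ "if W p then j else i"]) (auto simp: below_def)
  next
    fix x assume x: "x \<in> V'"
    then obtain p t i j where "x = vertex p t i j" using sub(1) unfolding graph_vertices_def by blast
    then show "\<exists>!y. pair M x y \<in> C" using x by (simp add: C)
  next
    fix x y u v assume *: "pair M x y \<in> E' \<and> pair M x u \<in> C \<and> pair M y v \<in> C"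
    then have "pair M x y \<in> graph_edges P Q K" using sub(2) by blast
    then obtain p t i j p' t' i' j' where v: "x = vertex p t i j" "y = vertex p' t' i' j'"
      "i \<prec> K" "j \<prec> K" "i' \<prec> K" "j' \<prec> K" and adj: "adj P Q p t i j p' t' i' j'" by (rule graph_edgesE)
    have u: "u = (if W p then j else i)" "v = (if W p' then j' else i')" using * unfolding v C by blast+
    have "x \<prec> b" "y \<prec> b" using * EV b by blast+
    then have tb: "t \<prec> b" "t' \<prec> b" unfolding v using le_vertex(2) le_less_trans by blast+
    have W0: "\<not> W \<zero>" unfolding W_def using peano(7) by blast
    have WP: "\<not> W (\<sigma> \<oplus> \<one>)" if "pair M \<sigma> s \<in> P" for \<sigma> s
      unfolding W_def using disj[OF that] by auto
    have WQ: "W (\<sigma> \<oplus> \<one>)" if "pair M \<sigma> s \<in> Q" "s \<prec> b" for \<sigma> s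
      unfolding W_def using that by (auto simp: less_succ_iff)
    from adj consider "p = p'" "i \<noteq> i'" "j \<noteq> j'"
      | \<sigma> where "t = t'" "p' = \<zero>" "p = \<sigma> \<oplus> \<one>" "link P Q \<sigma> t i j i' j'"
      | \<sigma> where "t = t'" "p = \<zero>" "p' = \<sigma> \<oplus> \<one>" "link P Q \<sigma> t i j i' j'"
      unfolding adj_def by blast
    then show "u \<noteq> v"
    proof cases
      case 1
      then show ?thesis using u by simp
    next
      case 2
      then show ?thesis using u W0 WP WQ tb unfolding link_def by auto
    next
      case 3
      then show ?thesis using u W0 WP WQ tb unfolding link_def by auto
    qed
  qed
  then show "chromatic M k V' E'" unfolding chromatic_def by blast
qed

lemma separation:
  assumes k: "k \<ge> 2" and "P \<in> Sets M" "Q \<in> Sets M"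
    and disj: "\<And>\<sigma> s s'. pair M \<sigma> s \<in> P \<Longrightarrow> pair M \<sigma> s' \<notin> Q"
    and colorable: "\<And>V E. is_graph M V E \<Longrightarrow> bounded_graph M V E \<Longrightarrow> locally_chromatic M k V E \<Longrightarrow>
      chromatic M (2 * k - 2) V E"
  shows "\<exists>D\<in>Sets M. \<forall>\<sigma> t. \<sigma> \<preceq> t \<longrightarrow> (pair M \<sigma> t \<in> P \<longrightarrow> \<sigma> \<in> D) \<and> (pair M \<sigma> t \<in> Q \<longrightarrow> \<sigma> \<notin> D)"
proof -
  define K where "K = num M k"
  define L where "L = num M (2 * k - 2)"
  have "chromatic M (2 * k - 2) (graph_vertices K) (graph_edges P Q K)"
    unfolding K_def using assms(2,3)
    by (intro colorable is_graph_gadget bounded_gadget locally_chromatic_gadget disj)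
  then obtain C where "is_coloring M (2 * k - 2) (graph_vertices K) (graph_edges P Q K) C"
    unfolding chromatic_def by blast
  note C = is_coloringD[OF this, folded L_def]
  define col where "col = (\<lambda>p t i j. THE u. pair M (vertex p t i j) u \<in> C)"
  have col: "pair M (vertex p t i j) u \<in> C \<longleftrightarrow> u = col p t i j" if ij: "i \<prec> K" "j \<prec> K" for p t i j u
  proof -
    obtain w where w: "pair M (vertex p t i j) w \<in> C" using C(4) graph_vertices_iff ij by blast
    then have "col p t i j = w" unfolding col_def using C(5) by (intro the_equality) blast+
    then show ?thesis using w C(5) by blast
  qed
  have colL: "col p t i j \<in> below M L" if "i \<in> below M K" "j \<in> below M K" for p t i j
  proof -
    have "pair M (vertex p t i j) (col p t i j) \<in> C" using col that unfolding below_def by blast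
    then show ?thesis using C(3) unfolding below_def by blast
  qed
  have edge: "col p t i j \<noteq> col p' t' i' j'"
    if "adj P Q p t i j p' t' i' j'" "i \<in> below M K" "j \<in> below M K" "i' \<in> below M K" "j' \<in> below M K"
    for p t i j p' t' i' j'
  proof -
    have b: "i \<prec> K" "j \<prec> K" "i' \<prec> K" "j' \<prec> K" using that unfolding below_def by simp_all
    have "pair M (vertex p t i j) (vertex p' t' i' j') \<in> graph_edges P Q K" using b that(1) graph_edges_iff by blast
    then show ?thesis using C(6) col b by blast
  qed
  have fin: "finite (below M K)" "finite (below M L)" "card (below M L) < 2 * card (below M K) - 1"
    unfolding K_def L_def using finite_below_num card_below_num k by simp_all
  define rows where "rows = (\<lambda>p t. rows_repeat (below M K) (col p t))"
  have proper: "grid_proper (below M K) (col p t) (col p t)" for p t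
    unfolding grid_proper_def using edge[of p t _ _ p t] by (auto simp: adj_def)
  have step: "rows p t \<longleftrightarrow> rows p (t \<oplus> \<one>)" for p t
  proof -
    have "grid_proper (below M K) (col p t) (col p (t \<oplus> \<one>))"
      unfolding grid_proper_def using edge[of p t _ _ p "t \<oplus> \<one>"] by (auto simp: adj_def)
    then show ?thesis unfolding rows_def by (intro rows_repeat_linked[OF fin colL colL proper proper])
  qed
  \<comment> \<open>Expressed through the graph \<open>C\<close> of the coloring, the row property
    becomes a bounded formula with parameter \<open>C\<close>.\<close>
  have rows_iff: "rows p t \<longleftrightarrow> (\<forall>i. i \<prec> K \<longrightarrow> (\<exists>j. j \<prec> K \<and> (\<exists>j'. j' \<prec> K \<and> j \<noteq> j' \<and>
      (\<exists>u. u \<prec> L \<and> pair M (vertex p t i j) u \<in> C \<and> pair M (vertex p t i j') u \<in> C))))" for p t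
  proof -
    have "col p t i j = col p t i j' \<longleftrightarrow>
      (\<exists>u. u \<prec> L \<and> pair M (vertex p t i j) u \<in> C \<and> pair M (vertex p t i j') u \<in> C)"
      if "i \<prec> K" "j \<prec> K" "j' \<prec> K" for i j j'
      using colL[of i j p t] col that unfolding below_def by auto
    then show ?thesis unfolding rows_def rows_repeat_def below_def by (auto 0 4)
  qed
  have rows_delta0: "delta0 (\<lambda>e. rows (p e) (t e))" if "term_definable p" "term_definable t" for p t
    by (rule delta0_subst2[OF _ that]) (unfold rows_iff, intro definable term_vertex C(1))
  \<comment> \<open>Stages may be nonstandard, so \<open>step\<close> is iterated by induction
    inside \<open>M\<close>.\<close>
  have rows0: "rows p t \<longleftrightarrow> rows p \<zero>" for p t
    by (rule delta0_induct[of "\<lambda>t. rows p t \<longleftrightarrow> rows p \<zero>"]) (intro definable rows_delta0, simp_all add: step[symmetric])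
  \<comment> \<open>The comparison with the reference chain is made at stage \<open>\<zero>\<close>,
    which keeps the definition bounded; \<open>rows0\<close> carries it to the stage of a
    link.\<close>
  define D where "D = {\<sigma>. rows (\<sigma> \<oplus> \<one>) \<zero> \<longleftrightarrow> rows \<zero> \<zero>}"
  have "D \<in> Sets M" unfolding D_def by (rule delta0_comprehension) (intro definable rows_delta0)
  moreover have "\<sigma> \<in> D" if "\<sigma> \<preceq> t" "pair M \<sigma> t \<in> P" for \<sigma> t
  proof -
    have "grid_proper (below M K) (col (\<sigma> \<oplus> \<one>) t) (col \<zero> t)"
      unfolding grid_proper_def using edge[of "\<sigma> \<oplus> \<one>" t _ _ \<zero> t] that
      by (auto simp: adj_def link_def less_succ_iff)
    then have "rows (\<sigma> \<oplus> \<one>) t \<longleftrightarrow> rows \<zero> t"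
      unfolding rows_def by (intro rows_repeat_linked[OF fin colL colL proper proper])
    then show ?thesis using rows0[of _ t] unfolding D_def by simp
  qed
  moreover have "\<sigma> \<notin> D" if "\<sigma> \<preceq> t" "pair M \<sigma> t \<in> Q" for \<sigma> t
  proof -
    have "grid_proper (below M K) (col (\<sigma> \<oplus> \<one>) t) (\<lambda>i j. col \<zero> t j i)"
      unfolding grid_proper_def using edge[of "\<sigma> \<oplus> \<one>" t _ _ \<zero> t] that
      by (auto simp: adj_def link_def less_succ_iff)
    then have "rows (\<sigma> \<oplus> \<one>) t \<longleftrightarrow> \<not> rows \<zero> t"
      unfolding rows_def by (intro rows_repeat_linked_transpose[OF fin colL colL proper proper])
    then show ?thesis using rows0[of _ t] unfolding D_def by simp
  qed
  ultimately show ?thesis by blast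
qed

section \<open>Paths from separating sets\<close>

text \<open>This gathers several witnesses under one number, the single unbounded quantifier of a
  \<open>\<Sigma>\<^sub>1\<close> formula.\<close>

lemma common_bound: "\<exists>z. a \<prec> z \<and> b \<prec> z \<and> c \<prec> z \<and> d \<prec> z"
proof (intro exI conjI)
  let ?z = "a \<oplus> (b \<oplus> (c \<oplus> d)) \<oplus> \<one>"
  show "a \<prec> ?z" unfolding less_succ_iff by (rule le_add_right)
  show "b \<prec> ?z" unfolding less_succ_iff by (rule order_trans[OF le_add_right le_add_left])
  have "c \<preceq> c \<oplus> d" "d \<preceq> c \<oplus> d" by (rule le_add_right le_add_left)+
  moreover have "c \<oplus> d \<preceq> a \<oplus> (b \<oplus> (c \<oplus> d))" by (rule order_trans[OF le_add_left le_add_left])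
  ultimately show "c \<prec> ?z" "d \<prec> ?z" unfolding less_succ_iff using order_trans by blast+
qed

section \<open>Recursion along a set of nodes\<close>

lemma delta0_elems_subset_set:
  assumes "term_definable t" "F \<in> Sets M"
  shows "delta0 (\<lambda>e. elems M (t e) \<subseteq> F)"
proof (rule delta0_subst[OF _ assms(1)])
  have "elems M c \<subseteq> F \<longleftrightarrow> (\<forall>i. i \<prec> c \<longrightarrow> i \<in> elems M c \<longrightarrow> i \<in> F)" for c using elems_less by blast
  then show "delta0 (\<lambda>e. elems M (e 0) \<subseteq> F)" by (simp only:) (intro definable delta0_mem_elems assms(2))
qed

text \<open>
  \<open>Y\<close> obeys the recursion that makes the bit at position \<open>j\<close> equal to \<open>\<one>\<close> iff the restriction of \<open>Y\<close> to \<open>j\<close>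
  is in \<open>D\<close>.
\<close>

definition follows :: "'a set \<Rightarrow> 'a \<Rightarrow> 'a set \<Rightarrow> bool" where
  "follows D i Y \<longleftrightarrow> (\<forall>j \<rho>. j \<prec> i \<longrightarrow> binary_seq M \<rho> j \<longrightarrow> elems M \<rho> \<subseteq> Y \<longrightarrow>
     (\<rho> \<in> D \<longrightarrow> pair M j \<one> \<in> Y) \<and> (\<rho> \<notin> D \<longrightarrow> pair M j \<zero> \<in> Y))"

lemma followsD:
  assumes "follows D l Y" "binary_seq M \<rho> j" "j \<prec> l" "elems M \<rho> \<subseteq> Y"
  shows "pair M j (if \<rho> \<in> D then \<one> else \<zero>) \<in> Y"
  using assms unfolding follows_def by simp

text \<open>The argument \<open>B\<close> bounds the codes of all prefixes that have to be tested.
  Thus \<sigma> following \<open>D\<close> becomes a bounded statement about \<open>B\<close>,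
  \<sigma> and \<open>l\<close>, and a \<open>\<Sigma>\<^sub>1\<close> one after quantification over
  \<open>B\<close>.\<close>

definition follows_below :: "'a set \<Rightarrow> 'a \<Rightarrow> 'a \<Rightarrow> 'a \<Rightarrow> bool" where
  "follows_below D B \<sigma> l \<longleftrightarrow> seq_bound l B \<and> binary_seq M \<sigma> l \<and>
     (\<forall>\<rho>. \<rho> \<prec> B \<longrightarrow> (\<forall>j. j \<prec> l \<longrightarrow> binary_seq M \<rho> j \<longrightarrow> elems M \<rho> \<subseteq> elems M \<sigma> \<longrightarrow>
     (\<rho> \<in> D \<longrightarrow> pair M j \<one> \<in> elems M \<sigma>) \<and> (\<rho> \<notin> D \<longrightarrow> pair M j \<zero> \<in> elems M \<sigma>)))"

lemma follows_below_iff: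
  "follows_below D B \<sigma> l \<longleftrightarrow> seq_bound l B \<and> binary_seq M \<sigma> l \<and> follows D l (elems M \<sigma>)"
proof (cases "seq_bound l B")
  case True
  then have "\<rho> \<prec> B" if "j \<prec> l" "binary_seq M \<rho> j" for j \<rho>
    using binary_seq_less[OF that(2) less_imp_le[OF that(1)]] by blast
  then show ?thesis unfolding follows_below_def follows_def by meson
next
  case False
  then show ?thesis unfolding follows_below_def by simp
qed

lemma delta0_follows_below:
  assumes "D \<in> Sets M" "term_definable t" "term_definable u" "term_definable v"
  shows "delta0 (\<lambda>e. follows_below D (t e) (u e) (v e))"
  by (rule delta0_subst3[OF _ assms(2-4)])
    (unfold follows_below_def, intro definable delta0_seq_bound delta0_binary_seq delta0_elems_subset delta0_mem_elems assms(1))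

lemma follows_extend:
  assumes "binary_seq M \<sigma> l" "follows D l (elems M \<sigma>)"
  shows "\<exists>\<tau>. binary_seq M \<tau> (l \<oplus> \<one>) \<and> follows D (l \<oplus> \<one>) (elems M \<tau>)"
proof -
  define v where "v = (if \<sigma> \<in> D then \<one> else \<zero>)"
  have "v = \<zero> \<or> v = \<one>" unfolding v_def by simp
  from binary_seq_extend[OF assms(1) this] obtain \<tau>
    where \<tau>: "binary_seq M \<tau> (l \<oplus> \<one>)" "elems M \<tau> = insert (pair M l v) (elems M \<sigma>)" .
  have "(\<rho> \<in> D \<longrightarrow> pair M j \<one> \<in> elems M \<tau>) \<and> (\<rho> \<notin> D \<longrightarrow> pair M j \<zero> \<in> elems M \<tau>)"
    if j: "j \<prec> l \<oplus> \<one>" and \<rho>: "binary_seq M \<rho> j" "elems M \<rho> \<subseteq> elems M \<tau>" for j \<rho>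
  proof -
    have jl: "j \<preceq> l" using j less_succ_iff by simp
    \<comment> \<open>A prefix of length at most \<open>l\<close> does not reach the new bit and so
      is a prefix of \<sigma>; the new bit is tested only by \<sigma> itself.\<close>
    have "pair M l v \<notin> elems M \<rho>"
    proof
      assume "pair M l v \<in> elems M \<rho>"
      then have "l \<prec> j" by (rule binary_seqD(4)[OF \<rho>(1)])
      then show False using jl by (simp add: not_less[symmetric])
    qed
    then have sub: "elems M \<rho> \<subseteq> elems M \<sigma>" using \<rho>(2) unfolding \<tau>(2) by blast
    show ?thesis
    proof (cases "j = l")
      case True
      then have "\<rho> = \<sigma>" using binary_seq_unique \<rho>(1) assms(1) sub by blast
      then show ?thesis using True unfolding \<tau>(2) v_def by simp
    next
      case False
      then have "j \<prec> l" using jl le_def by simp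
      then show ?thesis using assms(2) \<rho>(1) sub unfolding follows_def \<tau>(2) by blast
    qed
  qed
  then have "follows D (l \<oplus> \<one>) (elems M \<tau>)" unfolding follows_def by blast
  then show ?thesis using \<tau>(1) by blast
qed

text \<open>Consider the least position at which \<sigma> has an entry missing in \<tau>. Both
  contain the restriction of \<sigma> to that position, and the recursion prescribes the same entry
  for both. The least position exists because the disagreement is a bounded relation.\<close>

lemma follows_subset:
  assumes "binary_seq M \<sigma> l" "follows D l (elems M \<sigma>)" "binary_seq M \<tau> l'" "follows D l' (elems M \<tau>)" "l \<preceq> l'"
  shows "elems M \<sigma> \<subseteq> elems M \<tau>"
proof (rule ccontr)
  assume "\<not> elems M \<sigma> \<subseteq> elems M \<tau>"
  then obtain p where p: "p \<in> elems M \<sigma>" "p \<notin> elems M \<tau>" by blast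
  then obtain i w where iw: "p = pair M i w" using binary_seqD(2)[OF assms(1)] by blast
  define R where "R = (\<lambda>i. \<exists>w. w \<prec> \<sigma> \<and> pair M i w \<in> elems M \<sigma> \<and> pair M i w \<notin> elems M \<tau>)"
  have ws: "w \<prec> \<sigma>" if "pair M i w \<in> elems M \<sigma>" for i w
    using elems_less[OF that] le_pair2 le_less_trans by blast
  have "delta0 (\<lambda>e. R (e 0))" unfolding R_def by (intro definable delta0_mem_elems)
  moreover have "R i" unfolding R_def using p iw ws by blast
  ultimately obtain j where j: "R j" "\<forall>b. b \<prec> j \<longrightarrow> \<not> R b" using least_number[of R i] by blast
  then obtain w where w: "pair M j w \<in> elems M \<sigma>" "pair M j w \<notin> elems M \<tau>" unfolding R_def by blast
  have jl: "j \<prec> l" by (rule binary_seqD(4)[OF assms(1) w(1)])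
  obtain \<rho> where \<rho>: "binary_seq M \<rho> j" "elems M \<rho> \<subseteq> elems M \<sigma>"
    using binary_seq_restrict[OF assms(1) less_imp_le[OF jl]] .
  have "elems M \<rho> \<subseteq> elems M \<tau>"
  proof
    fix q assume q: "q \<in> elems M \<rho>"
    then obtain b u where bu: "q = pair M b u" "b \<prec> j" using binary_seqD(2)[OF \<rho>(1)] by blast
    then have "\<not> R b" using j(2) by blast
    then show "q \<in> elems M \<tau>" using q \<rho>(2) bu(1) ws unfolding R_def by blast
  qed
  then have "pair M j (if \<rho> \<in> D then \<one> else \<zero>) \<in> elems M \<tau>"
    using followsD[OF assms(4) \<rho>(1)] jl assms(5) less_le_trans by blast
  moreover have "pair M j (if \<rho> \<in> D then \<one> else \<zero>) \<in> elems M \<sigma>"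
    by (rule followsD[OF assms(2) \<rho>(1) jl \<rho>(2)])
  ultimately show False using w binary_seqD(6)[OF assms(1)] by metis
qed

lemma follows_exists:
  assumes "D \<in> Sets M"
  shows "\<exists>\<sigma>. binary_seq M \<sigma> l \<and> follows D l (elems M \<sigma>)"
proof -
  \<comment> \<open>The number \<open>b\<close> bounds both \<open>B\<close> and \<sigma>, because
    \<open>sigma1_induct\<close> offers one unbounded witness.\<close>
  have ex: "\<exists>b. \<exists>B. B \<prec> b \<and> (\<exists>\<sigma>. \<sigma> \<prec> b \<and> follows_below D B \<sigma> l)"
    if "binary_seq M \<sigma> l" "follows D l (elems M \<sigma>)" for l \<sigma>
  proof -
    obtain B where B: "seq_bound l B" unfolding seq_bound_def using code_bound_exists by blast
    obtain b where "B \<prec> b" "\<sigma> \<prec> b" using common_bound by blast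
    then show ?thesis unfolding follows_below_iff using B that by blast
  qed
  have "\<exists>b. \<exists>B. B \<prec> b \<and> (\<exists>\<sigma>. \<sigma> \<prec> b \<and> follows_below D B \<sigma> l)"
  proof (rule sigma1_induct[of "\<lambda>b l. \<exists>B. B \<prec> b \<and> (\<exists>\<sigma>. \<sigma> \<prec> b \<and> follows_below D B \<sigma> l)"])
    show "delta0 (\<lambda>e. \<exists>B. B \<prec> e 0 \<and> (\<exists>\<sigma>. \<sigma> \<prec> e 0 \<and> follows_below D B \<sigma> (e (Suc 0))))"
      by (intro definable delta0_follows_below assms)
    have "{} \<in> Sets M"
    proof -
      have "{a. a \<prec> \<zero>} \<in> Sets M" by (rule delta0_comprehension) (intro definable)
      then show ?thesis by (simp add: peano)
    qed
    then obtain \<sigma> where "binary_seq M \<sigma> \<zero>" "elems M \<sigma> = {}"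
      by (rule binary_seq_exists[of "{}" \<zero>]) (simp_all add: peano)
    moreover have "follows D \<zero> (elems M \<sigma>)" unfolding follows_def using peano(7) by blast
    ultimately show "\<exists>b. \<exists>B. B \<prec> b \<and> (\<exists>\<sigma>. \<sigma> \<prec> b \<and> follows_below D B \<sigma> \<zero>)" using ex by blast
    fix l assume "\<exists>b. \<exists>B. B \<prec> b \<and> (\<exists>\<sigma>. \<sigma> \<prec> b \<and> follows_below D B \<sigma> l)"
    then obtain \<sigma> where "binary_seq M \<sigma> l" "follows D l (elems M \<sigma>)" unfolding follows_below_iff by blast
    then obtain \<tau> where "binary_seq M \<tau> (l \<oplus> \<one>)" "follows D (l \<oplus> \<one>) (elems M \<tau>)" using follows_extend by blast
    then show "\<exists>b. \<exists>B. B \<prec> b \<and> (\<exists>\<sigma>. \<sigma> \<prec> b \<and> follows_below D B \<sigma> (l \<oplus> \<one>))" by (rule ex)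
  qed
  then show ?thesis unfolding follows_below_iff by blast
qed

text \<open>Sequences that follow \<open>D\<close> exist in every length and are unique in each.
  Hence belonging to some such sequence of length \<open>i \<oplus> \<one>\<close> and belonging to
  every such sequence agree; the first is \<open>\<Sigma>\<^sub>1\<close> with matrix
  \<open>S\<close>, the second \<open>\<Pi>\<^sub>1\<close> with matrix \<open>U\<close>, and
  \<open>F\<close> exists by \<open>\<Delta>\<^sub>1\<close> comprehension.\<close>

lemma path_by_recursion:
  assumes D: "D \<in> Sets M"
  shows "\<exists>F. is_function M F UNIV {\<zero>, \<one>} \<and> (\<forall>l. \<exists>\<sigma>. binary_seq M \<sigma> l \<and> elems M \<sigma> \<subseteq> F) \<and>
    (\<forall>\<rho> j. binary_seq M \<rho> j \<longrightarrow> elems M \<rho> \<subseteq> F \<longrightarrow> pair M j (if \<rho> \<in> D then \<one> else \<zero>) \<in> F)"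
proof -
  define good where "good = (\<lambda>\<sigma> l. binary_seq M \<sigma> l \<and> follows D l (elems M \<sigma>))"
  have good_ex: "\<exists>\<sigma>. good \<sigma> l" for l unfolding good_def by (rule follows_exists[OF D])
  have good_sub: "elems M \<sigma> \<subseteq> elems M \<tau>" if "good \<sigma> l" "good \<tau> l'" "l \<preceq> l'" for \<sigma> \<tau> l l'
    using that follows_subset unfolding good_def by blast
  have good_below: "(\<exists>b B. B \<prec> b \<and> \<sigma> \<prec> b \<and> follows_below D B \<sigma> l) \<longleftrightarrow> good \<sigma> l" for \<sigma> l
  proof
    assume "good \<sigma> l"
    moreover obtain B where B: "seq_bound l B" unfolding seq_bound_def using code_bound_exists by blast
    moreover obtain b where "B \<prec> b" "\<sigma> \<prec> b" using common_bound by blast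
    ultimately show "\<exists>b B. B \<prec> b \<and> \<sigma> \<prec> b \<and> follows_below D B \<sigma> l" unfolding follows_below_iff good_def by blast
  qed (auto simp: follows_below_iff good_def)
  define S where "S = (\<lambda>b q. \<exists>i. i \<prec> q \<oplus> \<one> \<and> (\<exists>w. w \<prec> q \<oplus> \<one> \<and> q = pair M i w \<and>
     (\<exists>B. B \<prec> b \<and> (\<exists>\<sigma>. \<sigma> \<prec> b \<and> follows_below D B \<sigma> (i \<oplus> \<one>) \<and> q \<in> elems M \<sigma>))))"
  define U where "U = (\<lambda>b q. \<exists>i. i \<prec> q \<oplus> \<one> \<and> (\<exists>w. w \<prec> q \<oplus> \<one> \<and> q = pair M i w \<and>
     (\<forall>B. B \<prec> b \<longrightarrow> (\<forall>\<sigma>. \<sigma> \<prec> b \<longrightarrow> follows_below D B \<sigma> (i \<oplus> \<one>) \<longrightarrow> q \<in> elems M \<sigma>))))"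
  have pairI: "i \<prec> pair M i w \<oplus> \<one>" "w \<prec> pair M i w \<oplus> \<one>" for i w
    by (simp_all add: less_succ_iff le_pair1 le_pair2)
  have S: "(\<exists>b. S b (pair M i w)) \<longleftrightarrow> (\<exists>\<sigma>. good \<sigma> (i \<oplus> \<one>) \<and> pair M i w \<in> elems M \<sigma>)" for i w
    unfolding S_def good_below[symmetric] using pairI(1)[of i w] pairI(2)[of w i] by auto
  have U: "(\<forall>b. U b (pair M i w)) \<longleftrightarrow> (\<forall>\<sigma>. good \<sigma> (i \<oplus> \<one>) \<longrightarrow> pair M i w \<in> elems M \<sigma>)" for i w
    unfolding U_def good_below[symmetric] using pairI(1)[of i w] pairI(2)[of w i] by auto
  have SU: "(\<exists>b. S b q) \<longleftrightarrow> (\<forall>b. U b q)" for q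
  proof (cases "\<exists>i w. q = pair M i w")
    case True
    then obtain i w where "q = pair M i w" by blast
    then show ?thesis using S U good_ex good_sub order_refl by (metis subsetD)
  next
    \<comment> \<open>A number that is no pair satisfies neither \<open>S\<close> nor
      \<open>U\<close>.\<close>
    case False
    then show ?thesis unfolding S_def U_def by auto
  qed
  define F where "F = {q. \<exists>b. S b q}"
  have FS: "F \<in> Sets M" unfolding F_def
  proof (rule delta1_comprehension[OF _ _ SU])
    show "delta0 (\<lambda>e. S (e 0) (e (Suc 0)))" "delta0 (\<lambda>e. U (e 0) (e (Suc 0)))"
      unfolding S_def U_def by (intro definable delta0_follows_below delta0_mem_elems D)+
  qed
  have F: "pair M i w \<in> F \<longleftrightarrow> (\<exists>\<sigma>. good \<sigma> (i \<oplus> \<one>) \<and> pair M i w \<in> elems M \<sigma>)" for i w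
    unfolding F_def using S by simp
  have F_uniq: "v = w" if "pair M i v \<in> F" "pair M i w \<in> F" for i v w
  proof -
    obtain \<sigma> \<tau> where st: "good \<sigma> (i \<oplus> \<one>)" "pair M i v \<in> elems M \<sigma>" "good \<tau> (i \<oplus> \<one>)" "pair M i w \<in> elems M \<tau>"
      using \<open>pair M i v \<in> F\<close> \<open>pair M i w \<in> F\<close> F by metis
    then have "pair M i v \<in> elems M \<tau>" using good_sub order_refl by blast
    then show ?thesis using st(3,4) binary_seqD(6) unfolding good_def by blast
  qed
  have good_F: "elems M \<sigma> \<subseteq> F" if g: "good \<sigma> l" for \<sigma> l
  proof
    fix p assume p: "p \<in> elems M \<sigma>"
    then obtain i w where iw: "p = pair M i w" "i \<prec> l" using binary_seqD(2) g unfolding good_def by blast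
    obtain \<tau> where \<tau>: "good \<tau> (i \<oplus> \<one>)" using good_ex by blast
    have "i \<prec> i \<oplus> \<one>" by (simp add: less_succ_iff)
    then obtain u where u: "pair M i u \<in> elems M \<tau>" using \<tau> binary_seqD(3) unfolding good_def by blast
    have "i \<oplus> \<one> \<preceq> l" using iw(2) succ_le_iff by simp
    then have "pair M i u \<in> elems M \<sigma>" using good_sub[OF \<tau> g] u by blast
    then have "u = w" using binary_seqD(6) g p iw(1) unfolding good_def by blast
    then show "p \<in> F" using iw(1) u \<tau> F by blast
  qed
  have F_total: "\<exists>w. (w = \<zero> \<or> w = \<one>) \<and> pair M i w \<in> F" for i
  proof -
    obtain \<tau> where \<tau>: "good \<tau> (i \<oplus> \<one>)" using good_ex by blast
    have "i \<prec> i \<oplus> \<one>" by (simp add: less_succ_iff)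
    then obtain w where "(w = \<zero> \<or> w = \<one>) \<and> pair M i w \<in> elems M \<tau>"
      using \<tau> binary_seqD(3) unfolding good_def by blast
    then show ?thesis using good_F[OF \<tau>] by blast
  qed
  have F_pair: "\<exists>i w. q = pair M i w" if "q \<in> F" for q
    using that unfolding F_def S_def by blast
  have "is_function M F UNIV {\<zero>, \<one>}"
    unfolding is_function_def
  proof (intro conjI ballI)
    show "F \<in> Sets M" by (rule FS)
    show "\<exists>x\<in>UNIV. \<exists>y\<in>{\<zero>, \<one>}. q = pair M x y" if "q \<in> F" for q
      using F_pair[OF that] F_total F_uniq that by blast
    show "\<exists>!y. pair M i y \<in> F" for i using F_total[of i] F_uniq[of i] by blast
  qed
  moreover have "pair M j (if \<rho> \<in> D then \<one> else \<zero>) \<in> F" if \<rho>: "binary_seq M \<rho> j" "elems M \<rho> \<subseteq> F" for \<rho> j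
  proof -
    obtain \<tau> where \<tau>: "good \<tau> (j \<oplus> \<one>)" using good_ex by blast
    have "j \<prec> j \<oplus> \<one>" by (simp add: less_succ_iff)
    moreover have "elems M \<rho> \<subseteq> elems M \<tau>"
    proof (rule binary_seq_subset_mono[OF \<rho>(1) _ _ \<rho>(2) good_F[OF \<tau>]])
      show "binary_seq M \<tau> (j \<oplus> \<one>)" using \<tau> unfolding good_def by blast
      show "j \<preceq> j \<oplus> \<one>" by (rule le_add_right)
    qed (rule F_uniq)
    ultimately have "pair M j (if \<rho> \<in> D then \<one> else \<zero>) \<in> elems M \<tau>"
      using followsD \<tau> \<rho>(1) unfolding good_def by blast
    then show ?thesis using good_F[OF \<tau>] by blast
  qed
  moreover have "\<exists>\<sigma>. binary_seq M \<sigma> l \<and> elems M \<sigma> \<subseteq> F" for l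
    using good_ex[of l] good_F unfolding good_def by blast
  ultimately show ?thesis by blast
qed

text \<open>
  All witnesses are bounded by the stage \<open>s\<close>, which makes the relation bounded, and monotone in \<open>s\<close>.
\<close>

definition child_dead :: "'a set \<Rightarrow> 'a \<Rightarrow> 'a \<Rightarrow> 'a \<Rightarrow> bool" where
  "child_dead T \<sigma> v s \<longleftrightarrow> (\<exists>n. n \<prec> s \<and> (\<exists>l. l \<prec> s \<and> (\<exists>B. B \<prec> s \<and> n \<prec> l \<and> binary_seq M \<sigma> n \<and> seq_bound l B \<and>
     (\<forall>\<tau>. \<tau> \<prec> B \<longrightarrow> \<not> (\<tau> \<in> T \<and> binary_seq M \<tau> l \<and> elems M \<sigma> \<subseteq> elems M \<tau> \<and> pair M n v \<in> elems M \<tau>)))))"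

section \<open>Nodes and children without long extensions\<close>

lemma delta0_child_dead:
  assumes "T \<in> Sets M" "term_definable t" "term_definable u" "term_definable v"
  shows "delta0 (\<lambda>e. child_dead T (t e) (u e) (v e))"
  by (rule delta0_subst3[OF _ assms(2-4)])
    (unfold child_dead_def, intro definable delta0_seq_bound delta0_binary_seq delta0_elems_subset delta0_mem_elems assms(1))

lemma child_dead_mono:
  assumes "child_dead T \<sigma> v s" "s \<preceq> s'"
  shows "child_dead T \<sigma> v s'"
proof -
  have "x \<prec> s'" if "x \<prec> s" for x using that assms(2) less_le_trans by blast
  then show ?thesis using assms(1) unfolding child_dead_def by meson
qed

text \<open>Quantifying over the stage removes the auxiliary bounds: the length of \<sigma> is
  unique, and \<open>B\<close> exceeds the codes of all sequences of length
  \<open>l\<close>.\<close>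

lemma child_dead_iff:
  assumes "binary_seq M \<sigma> n"
  shows "(\<exists>s. child_dead T \<sigma> v s) \<longleftrightarrow> (\<exists>l. n \<prec> l \<and>
     (\<forall>\<tau>\<in>T. binary_seq M \<tau> l \<longrightarrow> elems M \<sigma> \<subseteq> elems M \<tau> \<longrightarrow> pair M n v \<notin> elems M \<tau>))"
proof
  assume "\<exists>s. child_dead T \<sigma> v s"
  then obtain n' l B where *: "n' \<prec> l" "binary_seq M \<sigma> n'" "seq_bound l B"
     "\<forall>\<tau>. \<tau> \<prec> B \<longrightarrow> \<not> (\<tau> \<in> T \<and> binary_seq M \<tau> l \<and> elems M \<sigma> \<subseteq> elems M \<tau> \<and> pair M n' v \<in> elems M \<tau>)"
    unfolding child_dead_def by blast
  have "n' = n"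
    using binary_seq_length_mono[OF *(2) assms] binary_seq_length_mono[OF assms *(2)] by simp
  then show "\<exists>l. n \<prec> l \<and> (\<forall>\<tau>\<in>T. binary_seq M \<tau> l \<longrightarrow> elems M \<sigma> \<subseteq> elems M \<tau> \<longrightarrow> pair M n v \<notin> elems M \<tau>)"
    using * binary_seq_less[OF _ order_refl *(3)] by blast
next
  assume "\<exists>l. n \<prec> l \<and> (\<forall>\<tau>\<in>T. binary_seq M \<tau> l \<longrightarrow> elems M \<sigma> \<subseteq> elems M \<tau> \<longrightarrow> pair M n v \<notin> elems M \<tau>)"
  then obtain l where l: "n \<prec> l" "\<forall>\<tau>\<in>T. binary_seq M \<tau> l \<longrightarrow> elems M \<sigma> \<subseteq> elems M \<tau> \<longrightarrow> pair M n v \<notin> elems M \<tau>"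
    by blast
  obtain B where B: "seq_bound l B" unfolding seq_bound_def using code_bound_exists by blast
  obtain s where "n \<prec> s" "l \<prec> s" "B \<prec> s" using common_bound by blast
  then have "child_dead T \<sigma> v s" unfolding child_dead_def using l B assms by blast
  then show "\<exists>s. child_dead T \<sigma> v s" by blast
qed

text \<open>The case \<open>m = l\<close> is included, so a sequence of length \<open>l\<close> that
  is not dead belongs to \<open>T\<close> itself.\<close>

definition dead :: "'a set \<Rightarrow> 'a \<Rightarrow> 'a \<Rightarrow> bool" where
  "dead T \<sigma> l \<longleftrightarrow> (\<exists>m. l \<preceq> m \<and> (\<forall>\<tau>\<in>T. binary_seq M \<tau> m \<longrightarrow> \<not> elems M \<sigma> \<subseteq> elems M \<tau>))"

lemma binary_tree_restrict:
  assumes "binary_tree M T" "\<tau> \<in> T" "binary_seq M \<tau> m" "l \<preceq> m"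
  obtains \<rho> where "\<rho> \<in> T" "binary_seq M \<rho> l" "elems M \<rho> \<subseteq> elems M \<tau>"
proof -
  obtain \<rho> where \<rho>: "binary_seq M \<rho> l" "elems M \<rho> \<subseteq> elems M \<tau>" using binary_seq_restrict[OF assms(3,4)] .
  then have "\<rho> \<in> T" using assms(1,2) unfolding binary_tree_def by blast
  then show thesis using that \<rho> by blast
qed

text \<open>An extension of length \<open>a \<oplus> b\<close> restricts to the lengths
  \<open>a\<close> and \<open>b\<close> at which the two children have no extensions left, so its
  entry at \<open>n\<close> could be neither \<open>\<zero>\<close> nor
  \<open>\<one>\<close>.\<close>

lemma dead_if_children_dead:
  assumes T: "binary_tree M T" and \<sigma>: "binary_seq M \<sigma> n"
    and "child_dead T \<sigma> \<zero> s" "child_dead T \<sigma> \<one> s'"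
  shows "dead T \<sigma> n"
proof -
  obtain a where a: "n \<prec> a"
    "\<And>\<tau>. \<tau> \<in> T \<Longrightarrow> binary_seq M \<tau> a \<Longrightarrow> elems M \<sigma> \<subseteq> elems M \<tau> \<Longrightarrow> pair M n \<zero> \<notin> elems M \<tau>"
    using child_dead_iff[OF \<sigma>, of T \<zero>] assms(3) by blast
  obtain b where b: "n \<prec> b"
    "\<And>\<tau>. \<tau> \<in> T \<Longrightarrow> binary_seq M \<tau> b \<Longrightarrow> elems M \<sigma> \<subseteq> elems M \<tau> \<Longrightarrow> pair M n \<one> \<notin> elems M \<tau>"
    using child_dead_iff[OF \<sigma>, of T \<one>] assms(4) by blast
  have "\<not> elems M \<sigma> \<subseteq> elems M \<tau>" if \<tau>: "\<tau> \<in> T" "binary_seq M \<tau> (a \<oplus> b)" for \<tau>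
  proof
    assume sub: "elems M \<sigma> \<subseteq> elems M \<tau>"
    have res: "\<exists>\<rho>\<in>T. binary_seq M \<rho> c \<and> elems M \<sigma> \<subseteq> elems M \<rho> \<and> elems M \<rho> \<subseteq> elems M \<tau>"
      if c: "n \<prec> c" "c \<preceq> a \<oplus> b" for c
    proof -
      obtain \<rho> where \<rho>: "\<rho> \<in> T" "binary_seq M \<rho> c" "elems M \<rho> \<subseteq> elems M \<tau>"
        using binary_tree_restrict[OF T \<tau> c(2)] .
      have "elems M \<sigma> \<subseteq> elems M \<rho>"
        by (rule binary_seq_subset_mono[OF \<sigma> \<rho>(2) less_imp_le[OF c(1)] sub \<rho>(3)])
          (rule binary_seqD(6)[OF \<tau>(2)])
      then show ?thesis using \<rho> by blast
    qed
    obtain \<rho> where \<rho>: "\<rho> \<in> T" "binary_seq M \<rho> a" "elems M \<sigma> \<subseteq> elems M \<rho>" "elems M \<rho> \<subseteq> elems M \<tau>"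
      using res[OF a(1) le_add_right] by blast
    obtain \<rho>' where \<rho>': "\<rho>' \<in> T" "binary_seq M \<rho>' b" "elems M \<sigma> \<subseteq> elems M \<rho>'" "elems M \<rho>' \<subseteq> elems M \<tau>"
      using res[OF b(1) le_add_left] by blast
    obtain v where v: "v = \<zero> \<or> v = \<one>" "pair M n v \<in> elems M \<rho>" using binary_seqD(3)[OF \<rho>(2) a(1)] by blast
    then have v1: "v = \<one>" using a(2)[OF \<rho>(1-3)] by blast
    obtain w where w: "w = \<zero> \<or> w = \<one>" "pair M n w \<in> elems M \<rho>'" using binary_seqD(3)[OF \<rho>'(2) b(1)] by blast
    then have "w = \<zero>" using b(2)[OF \<rho>'(1-3)] by blast
    then have "pair M n \<one> \<in> elems M \<tau>" "pair M n \<zero> \<in> elems M \<tau>" using v(2) v1 w(2) \<rho>(4) \<rho>'(4) by blast+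
    then show False using binary_seqD(6)[OF \<tau>(2)] one_neq_zero by blast
  qed
  moreover have "n \<preceq> a \<oplus> b" using less_imp_le[OF a(1)] le_add_right order_trans by blast
  ultimately show ?thesis unfolding dead_def by blast
qed

text \<open>An infinite tree exceeds every bound, in particular the one for codes of sequences of
  length at most \<open>m\<close>. So it has a node longer than \<open>m\<close>, whose restriction
  to \<open>m\<close> extends the empty sequence.\<close>

lemma not_dead_root:
  assumes T: "binary_tree M T" and inf: "\<not> finite_set M T" and \<sigma>: "binary_seq M \<sigma> \<zero>"
  shows "\<not> dead T \<sigma> \<zero>"
proof
  assume "dead T \<sigma> \<zero>"
  then obtain m where m: "\<And>\<tau>. \<tau> \<in> T \<Longrightarrow> binary_seq M \<tau> m \<Longrightarrow> \<not> elems M \<sigma> \<subseteq> elems M \<tau>"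
    unfolding dead_def by blast
  have "elems M \<sigma> = {}" using binary_seqD(2)[OF \<sigma>] peano(7) by blast
  then have m: "\<tau> \<in> T \<Longrightarrow> \<not> binary_seq M \<tau> m" for \<tau> using m by blast
  obtain B where B: "seq_bound m B" unfolding seq_bound_def using code_bound_exists by blast
  have "T \<in> Sets M" using T unfolding binary_tree_def by blast
  then have "\<not> T \<subseteq> below M B" using inf unfolding finite_set_def by blast
  then obtain \<tau> where \<tau>: "\<tau> \<in> T" "\<not> \<tau> \<prec> B" unfolding below_def by blast
  obtain l where l: "binary_seq M \<tau> l" using T \<tau>(1) unfolding binary_tree_def by blast
  have "\<not> l \<preceq> m" using binary_seq_less[OF l _ B] \<tau>(2) by blast
  then have "m \<preceq> l" by simp
  then obtain \<rho> where "\<rho> \<in> T" "binary_seq M \<rho> m" using binary_tree_restrict[OF T \<tau>(1) l] by blast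
  then show False using m by blast
qed

text \<open>An extension of \<sigma> with entry \<open>v\<close> at \<open>n\<close> contains all of
  \<tau>, so the length at which \<tau> has no extensions left serves for this child too.\<close>

lemma dead_predecessor:
  assumes T: "binary_tree M T" and \<tau>: "binary_seq M \<tau> (n \<oplus> \<one>)" and \<sigma>: "binary_seq M \<sigma> n"
    and sub: "elems M \<sigma> \<subseteq> elems M \<tau>" and v: "pair M n v \<in> elems M \<tau>" and d: "dead T \<tau> (n \<oplus> \<one>)"
  shows "\<exists>s. child_dead T \<sigma> v s"
proof -
  obtain m where m: "n \<oplus> \<one> \<preceq> m" "\<And>\<rho>. \<rho> \<in> T \<Longrightarrow> binary_seq M \<rho> m \<Longrightarrow> \<not> elems M \<tau> \<subseteq> elems M \<rho>"
    using d unfolding dead_def by blast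
  have "pair M n v \<notin> elems M \<rho>" if \<rho>: "\<rho> \<in> T" "binary_seq M \<rho> m" "elems M \<sigma> \<subseteq> elems M \<rho>" for \<rho>
  proof
    assume nv: "pair M n v \<in> elems M \<rho>"
    have "elems M \<tau> \<subseteq> elems M \<rho>"
    proof
      fix p assume p: "p \<in> elems M \<tau>"
      then obtain i w where iw: "p = pair M i w" "i \<prec> n \<oplus> \<one>" using binary_seqD(2)[OF \<tau>] by blast
      then consider "i = n" | "i \<prec> n" unfolding peano(8) by blast
      then show "p \<in> elems M \<rho>"
      proof cases
        case 1
        then have "w = v" using binary_seqD(6)[OF \<tau>] v p iw(1) by blast
        then show ?thesis using 1 iw(1) nv by simp
      next
        case 2
        then obtain u where u: "pair M i u \<in> elems M \<sigma>" using binary_seqD(3)[OF \<sigma>] by blast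
        then have "u = w" using binary_seqD(6)[OF \<tau>] sub p iw(1) by blast
        then show ?thesis using u iw(1) \<rho>(3) by blast
      qed
    qed
    then show False using m(2) \<rho> by blast
  qed
  moreover have "n \<prec> m" using m(1) succ_le_iff by simp
  ultimately show ?thesis unfolding child_dead_iff[OF \<sigma>] by blast
qed

text \<open>Deadness is \<open>\<Sigma>\<^sub>1\<close>, so it is propagated from a node of the path down to the root: the
  contrapositive would be an induction on a \<open>\<Pi>\<^sub>1\<close> statement.\<close>

lemma path_not_dead:
  assumes T: "binary_tree M T" and inf: "\<not> finite_set M T" and F: "F \<in> Sets M"
    and down: "\<And>\<sigma> \<tau> n. binary_seq M \<tau> (n \<oplus> \<one>) \<Longrightarrow> elems M \<tau> \<subseteq> F \<Longrightarrow> dead T \<tau> (n \<oplus> \<one>) \<Longrightarrow>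
      binary_seq M \<sigma> n \<Longrightarrow> elems M \<sigma> \<subseteq> elems M \<tau> \<Longrightarrow> dead T \<sigma> n"
    and \<sigma>: "binary_seq M \<sigma> a" "elems M \<sigma> \<subseteq> F"
  shows "\<not> dead T \<sigma> a"
proof
  assume dead: "dead T \<sigma> a"
  have TS: "T \<in> Sets M" using T unfolding binary_tree_def by blast
  \<comment> \<open>\<open>b\<close> counts the steps from the given node towards the root, so the
    node reached has length \<open>l\<close> with \<open>l \<oplus> b = a\<close>; the disjunct
    \<open>a \<prec> b\<close> lets the induction run on past the root. The numbers \<open>m\<close>
    and \<open>B\<close> express \<open>dead\<close> by a bounded formula in
    \<open>z\<close>.\<close>
  define S where "S = (\<lambda>z b. a \<prec> b \<or> (\<exists>l. l \<prec> z \<and> (\<exists>\<rho>. \<rho> \<prec> z \<and> (\<exists>m. m \<prec> z \<and> (\<exists>B. B \<prec> z \<and>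
    l \<oplus> b = a \<and> binary_seq M \<rho> l \<and> elems M \<rho> \<subseteq> F \<and> l \<preceq> m \<and> seq_bound m B \<and>
    (\<forall>\<tau>. \<tau> \<prec> B \<longrightarrow> \<not> (\<tau> \<in> T \<and> binary_seq M \<tau> m \<and> elems M \<rho> \<subseteq> elems M \<tau>)))))))"
  have SI: "\<exists>z. S z b" if "l \<oplus> b = a" "binary_seq M \<rho> l" "elems M \<rho> \<subseteq> F" "dead T \<rho> l" for l \<rho> b
  proof -
    obtain m where m: "l \<preceq> m" "\<forall>\<tau>\<in>T. binary_seq M \<tau> m \<longrightarrow> \<not> elems M \<rho> \<subseteq> elems M \<tau>"
      using \<open>dead T \<rho> l\<close> unfolding dead_def by blast
    obtain B where B: "seq_bound m B" unfolding seq_bound_def using code_bound_exists by blast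
    obtain z where "l \<prec> z" "\<rho> \<prec> z" "m \<prec> z" "B \<prec> z" using common_bound by blast
    then have "S z b" unfolding S_def using that m B by blast
    then show ?thesis by blast
  qed
  have SE: "a \<prec> b \<or> (\<exists>l \<rho>. l \<oplus> b = a \<and> binary_seq M \<rho> l \<and> elems M \<rho> \<subseteq> F \<and> dead T \<rho> l)" if "S z b" for z b
  proof (rule disjCI)
    assume "\<not> (\<exists>l \<rho>. l \<oplus> b = a \<and> binary_seq M \<rho> l \<and> elems M \<rho> \<subseteq> F \<and> dead T \<rho> l)"
    moreover have "dead T \<rho> l" if "l \<preceq> m" "seq_bound m B"
      "\<forall>\<tau>. \<tau> \<prec> B \<longrightarrow> \<not> (\<tau> \<in> T \<and> binary_seq M \<tau> m \<and> elems M \<rho> \<subseteq> elems M \<tau>)" for \<rho> l m B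
      unfolding dead_def using that binary_seq_less[OF _ order_refl that(2)] by blast
    ultimately show "a \<prec> b" using \<open>S z b\<close> unfolding S_def by blast
  qed
  have "\<exists>z. S z b" for b
  proof (rule sigma1_induct[of S])
    show "delta0 (\<lambda>e. S (e 0) (e (Suc 0)))" unfolding S_def
      by (intro definable delta0_seq_bound delta0_binary_seq delta0_elems_subset delta0_elems_subset_set delta0_le TS F)
    show "\<exists>z. S z \<zero>" by (rule SI[OF _ \<sigma> dead]) simp
    fix b assume "\<exists>z. S z b"
    then obtain z where "S z b" by blast
    from SE[OF this] show "\<exists>z. S z (b \<oplus> \<one>)"
    proof
      assume "a \<prec> b"
      then have "S z (b \<oplus> \<one>)" unfolding S_def peano(8) by blast
      then show ?thesis by blast
    next
      assume "\<exists>l \<rho>. l \<oplus> b = a \<and> binary_seq M \<rho> l \<and> elems M \<rho> \<subseteq> F \<and> dead T \<rho> l"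
      then obtain l \<rho> where \<rho>: "l \<oplus> b = a" "binary_seq M \<rho> l" "elems M \<rho> \<subseteq> F" "dead T \<rho> l" by blast
      from zero_or_succ[of l] show ?thesis
      proof
        assume "l = \<zero>"
        then have "a \<prec> b \<oplus> \<one>" using \<rho>(1) by (simp add: less_succ_iff)
        then show ?thesis unfolding S_def by blast
      next
        assume "\<exists>n. l = n \<oplus> \<one>"
        then obtain n where n: "l = n \<oplus> \<one>" by blast
        have "n \<preceq> l" unfolding n by (rule le_add_right)
        obtain \<pi> where \<pi>: "binary_seq M \<pi> n" "elems M \<pi> \<subseteq> elems M \<rho>"
          using binary_seq_restrict[OF \<rho>(2) \<open>n \<preceq> l\<close>] .
        have "dead T \<pi> n" using down[of \<rho> n \<pi>] \<rho> \<pi> unfolding n by blast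
        moreover have "n \<oplus> (b \<oplus> \<one>) = a" using \<rho>(1) unfolding n by (simp add: ac_simps)
        moreover have "elems M \<pi> \<subseteq> F" using \<pi>(2) \<rho>(3) by blast
        ultimately show ?thesis by (intro SI[OF _ \<pi>(1)])
      qed
    qed
  qed
  \<comment> \<open>For \<open>b = a\<close> the dead node is the root.\<close>
  then obtain z where "S z a" by blast
  then obtain l \<rho> where \<rho>: "l \<oplus> a = a" "binary_seq M \<rho> l" "dead T \<rho> l"
    using SE less_irrefl' by blast
  then have "l = \<zero>" by simp
  then show False using not_dead_root[OF T inf] \<rho> by blast
qed

lemma weak_koenig_lemma_if_colorable:
  assumes k: "k \<ge> 2"
    and colorable: "\<And>V E. is_graph M V E \<Longrightarrow> bounded_graph M V E \<Longrightarrow> locally_chromatic M k V E \<Longrightarrow>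
      chromatic M (2 * k - 2) V E"
  shows "weak_koenig_lemma M"
  unfolding weak_koenig_lemma_def
proof (intro allI impI)
  fix T assume "binary_tree M T \<and> \<not> finite_set M T"
  then have T: "binary_tree M T" and inf: "\<not> finite_set M T" by simp_all
  have TS: "T \<in> Sets M" using T unfolding binary_tree_def by blast
  \<comment> \<open>Both children are tested at the same stage \<open>s\<close>, so monotonicity of
    \<open>child_dead\<close> makes the two orders of events exclusive. If both are first seen dead
    at one stage, neither order holds and \<open>D\<close> is free to choose.\<close>
  define first where "first = (\<lambda>v w \<sigma> t. \<exists>s. s \<prec> t \<oplus> \<one> \<and> child_dead T \<sigma> v s \<and> \<not> child_dead T \<sigma> w s)"
  define R where "R = (\<lambda>v w. {q. \<exists>\<sigma>. \<sigma> \<prec> q \<oplus> \<one> \<and> (\<exists>t. t \<prec> q \<oplus> \<one> \<and> q = pair M \<sigma> t \<and> first v w \<sigma> t)})"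
  have RS: "R v w \<in> Sets M" for v w unfolding R_def first_def
    by (rule delta0_comprehension) (intro definable delta0_child_dead TS)
  have R: "pair M \<sigma> t \<in> R v w \<longleftrightarrow> first v w \<sigma> t" for v w \<sigma> t
    unfolding R_def using less_pair_succ1[OF refl, of \<sigma> t] less_pair_succ2[OF refl, of t \<sigma>] by auto
  have disj: "pair M \<sigma> t' \<notin> R \<one> \<zero>" if "pair M \<sigma> t \<in> R \<zero> \<one>" for \<sigma> t t'
  proof
    assume "pair M \<sigma> t' \<in> R \<one> \<zero>"
    then obtain s' where s': "child_dead T \<sigma> \<one> s'" "\<not> child_dead T \<sigma> \<zero> s'" unfolding R first_def by blast
    obtain s where s: "child_dead T \<sigma> \<zero> s" "\<not> child_dead T \<sigma> \<one> s" using \<open>pair M \<sigma> t \<in> R \<zero> \<one>\<close> unfolding R first_def by blast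
    have "s \<preceq> s' \<or> s' \<preceq> s" by (rule linear)
    then show False using child_dead_mono s s' by blast
  qed
  have "\<exists>D\<in>Sets M. \<forall>\<sigma> t. \<sigma> \<preceq> t \<longrightarrow>
      (pair M \<sigma> t \<in> R \<zero> \<one> \<longrightarrow> \<sigma> \<in> D) \<and> (pair M \<sigma> t \<in> R \<one> \<zero> \<longrightarrow> \<sigma> \<notin> D)"
    by (rule separation[OF k RS RS]) (erule disj, rule colorable)
  then obtain D where D: "D \<in> Sets M"
    and D0: "\<And>\<sigma> t. \<sigma> \<preceq> t \<Longrightarrow> pair M \<sigma> t \<in> R \<zero> \<one> \<Longrightarrow> \<sigma> \<in> D"
    and D1: "\<And>\<sigma> t. \<sigma> \<preceq> t \<Longrightarrow> pair M \<sigma> t \<in> R \<one> \<zero> \<Longrightarrow> \<sigma> \<notin> D"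
    by meson
  \<comment> \<open>The stage \<open>\<sigma> \<oplus> s\<close> lies beyond both the event and
    \<sigma>, as a link requires.\<close>
  have stage: "\<exists>t. \<sigma> \<preceq> t \<and> pair M \<sigma> t \<in> R v w" if "child_dead T \<sigma> v s" "\<not> child_dead T \<sigma> w s" for \<sigma> v w s
  proof (intro exI conjI)
    show "\<sigma> \<preceq> \<sigma> \<oplus> s" by (rule le_add_right)
    show "pair M \<sigma> (\<sigma> \<oplus> s) \<in> R v w"
      unfolding R first_def using that le_add_left less_succ_iff by blast
  qed
  \<comment> \<open>\<open>D\<close> avoids a child that is dead first. So if the child that it
    selects is dead at stage \<open>s\<close>, the other one is dead at \<open>s\<close> as
    well.\<close>
  have both: "\<exists>s. child_dead T \<sigma> \<zero> s \<and> child_dead T \<sigma> \<one> s"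
    if "child_dead T \<sigma> (if \<sigma> \<in> D then \<one> else \<zero>) s" for \<sigma> s
  proof (cases "\<sigma> \<in> D")
    case True
    then show ?thesis using that stage[of \<sigma> \<one> s \<zero>] D1 by auto
  next
    case False
    then show ?thesis using that stage[of \<sigma> \<zero> s \<one>] D0 by auto
  qed
  obtain F where F: "is_function M F UNIV {\<zero>, \<one>}"
    and Fseq: "\<And>l. \<exists>\<sigma>. binary_seq M \<sigma> l \<and> elems M \<sigma> \<subseteq> F"
    and Fstep: "\<And>\<rho> j. binary_seq M \<rho> j \<Longrightarrow> elems M \<rho> \<subseteq> F \<Longrightarrow> pair M j (if \<rho> \<in> D then \<one> else \<zero>) \<in> F"
    using path_by_recursion[OF D] by blast
  have FS: "F \<in> Sets M" using F unfolding is_function_def by blast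
  have Funiq: "v = w" if "pair M i v \<in> F" "pair M i w \<in> F" for i v w
    using F that unfolding is_function_def by blast
  have down: "dead T \<sigma> n"
    if \<tau>: "binary_seq M \<tau> (n \<oplus> \<one>)" "elems M \<tau> \<subseteq> F" "dead T \<tau> (n \<oplus> \<one>)"
      and \<sigma>: "binary_seq M \<sigma> n" "elems M \<sigma> \<subseteq> elems M \<tau>" for \<sigma> \<tau> n
  proof -
    define v where "v = (if \<sigma> \<in> D then \<one> else \<zero>)"
    have "elems M \<sigma> \<subseteq> F" using \<sigma>(2) \<tau>(2) by blast
    then have vF: "pair M n v \<in> F" unfolding v_def by (rule Fstep[OF \<sigma>(1)])
    have "n \<prec> n \<oplus> \<one>" by (simp add: less_succ_iff)
    then obtain w where w: "pair M n w \<in> elems M \<tau>" using binary_seqD(3)[OF \<tau>(1)] by blast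
    then have "w = v" using Funiq vF \<tau>(2) by blast
    then have "\<exists>s. child_dead T \<sigma> v s" using dead_predecessor[OF T \<tau>(1) \<sigma> _ \<tau>(3)] w by blast
    then obtain s where "child_dead T \<sigma> \<zero> s" "child_dead T \<sigma> \<one> s" using both unfolding v_def by blast
    then show ?thesis by (rule dead_if_children_dead[OF T \<sigma>(1)])
  qed
  have "infinite_path M F T"
    unfolding infinite_path_def
  proof (intro conjI allI)
    show "is_function M F UNIV {\<zero>, \<one>}" by (rule F)
    fix l
    obtain \<sigma> where \<sigma>: "binary_seq M \<sigma> l" "elems M \<sigma> \<subseteq> F" using Fseq by blast
    have "\<not> dead T \<sigma> l" by (rule path_not_dead[OF T inf FS down \<sigma>])
    then obtain \<tau> where \<tau>: "\<tau> \<in> T" "binary_seq M \<tau> l" "elems M \<sigma> \<subseteq> elems M \<tau>"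
      unfolding dead_def using order_refl by blast
    then have "\<sigma> = \<tau>" using binary_seq_unique \<sigma>(1) by blast
    then show "\<exists>s\<in>T. binary_seq M s l \<and> elems M s \<subseteq> F" using \<tau>(1) \<sigma> by blast
  qed
  then show "\<exists>F. infinite_path M F T" by blast
qed

end

theorem theorem13:
  fixes k :: nat and M :: "'a l2_structure"
  assumes "k \<ge> 2" and "RCA0 M"
  shows "WKL0 M \<longleftrightarrow>
    (\<forall>V E. is_graph M V E \<and> bounded_graph M V E \<and> locally_chromatic M k V E
       \<longrightarrow> chromatic M (2 * k - 2) V E)"
proof -
  interpret rca M by (rule rca.intro) (rule assms(2))
  show ?thesis
  proof
    assume "WKL0 M"
    then have "weak_koenig_lemma M" unfolding WKL0_def by blast
    moreover have "k \<le> 2 * k - 2" using assms(1) by simp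
    ultimately show "\<forall>V E. is_graph M V E \<and> bounded_graph M V E \<and> locally_chromatic M k V E
       \<longrightarrow> chromatic M (2 * k - 2) V E"
      using weak_koenig_lemma_imp_chromatic chromatic_mono by blast
  next
    assume "\<forall>V E. is_graph M V E \<and> bounded_graph M V E \<and> locally_chromatic M k V E
       \<longrightarrow> chromatic M (2 * k - 2) V E"
    then have "weak_koenig_lemma M" using weak_koenig_lemma_if_colorable[OF assms(1)] by blast
    then show "WKL0 M" unfolding WKL0_def using assms(2) by blast
  qed
qed

end
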